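(* Let $G$ be a $3$-connected graph with at least six vertices and let $uv$ be an edge of $G$. Then $G$ has no prism-minor using $uv$ if and only if (a) $G$ is isomorphic to one of $W_n$, $K_{3,n}$, $K'_{3,n}$, $K''_{3,n}$, $K'''_{3,n}$ for some integer $n\ge 3$; or (b) $G$ has a vertex $w$ such that $\{u,v,w\}$ is a vertex-cut of $G$ and each connected component $K$ of $G-\{u,v,w\}$ is a tree containing exactly one neighbor (in $G$) of $w$.
   Context: Graphs are finite, without loops or parallel edges. The prism is the graph obtained from two disjoint triangles by adding a perfect matching between their vertex sets. $W_n$ is the wheel with $n$ spokes (a cycle of length $n$ plus a vertex, the hub, adjacent to all cycle vertices). $K'_{3,n}$, $K''_{3,n}$, $K'''_{3,n}$ are obtained from the complete bipartite graph $K_{3,n}$ by adding, respectively, one, two or three edges inside the part of size three. A minor $H$ of $G$ uses the edge $uv$ of $G$ if $H$ has an edge $xy$ such that each of $x,y$ either is one of $u,v$ or is the vertex obtained, in the contractions producing $H$, by identifying a set of vertices that meets $\{u,v\}$; equivalently, $H$ is a minor "rooted" on $uv$. *)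

theory Defs
  imports "Graph_Theory.Graph_Theory"
begin

text \<open>
  A finite graph without loops or parallel edges is a \<^locale>\<open>pair_graph\<close>: every edge is
  represented by its two opposite arcs.
\<close>

definition del_verts :: "'a pair_pre_digraph \<Rightarrow> 'a set \<Rightarrow> ('a, 'a \<times> 'a) pre_digraph" where
  "del_verts G S = with_proj G \<restriction> (pverts G - S)"

text \<open>
  For symmetric graphs the strongly connected components are the connected components.
\<close>

definition components :: "('a, 'b) pre_digraph \<Rightarrow> ('a, 'b) pre_digraph set" where
  "components G = pre_digraph.sccs G"

text \<open>
  The library predicate \<^const>\<open>connected\<close> excludes the graph without vertices, hence the
  nonemptiness condition below.
\<close>

definition vertex_cut :: "'a pair_pre_digraph \<Rightarrow> 'a set \<Rightarrow> bool" where
  "vertex_cut G S \<longleftrightarrow>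
     S \<subseteq> pverts G \<and> pverts G - S \<noteq> {} \<and> \<not> connected (del_verts G S)"

definition k_connected :: "nat \<Rightarrow> 'a pair_pre_digraph \<Rightarrow> bool" where
  "k_connected k G \<longleftrightarrow>
     k < card (pverts G) \<and> (\<forall>S \<subseteq> pverts G. card S < k \<longrightarrow> \<not> vertex_cut G S)"

text \<open>
  The library predicate \<^const>\<open>tree\<close> is not usable for symmetric graphs: traversing an edge
  back and forth is a directed cycle of length two. The cycles of the undirected graph are the
  directed cycles of length at least three.
\<close>

definition undirected_tree :: "('a, 'b) pre_digraph \<Rightarrow> bool" where
  "undirected_tree G \<longleftrightarrow> connected G \<and> \<not> (\<exists>p. pre_digraph.cycle G p \<and> 3 \<le> length p)"

definition prism :: "nat pair_pre_digraph" where
  "prism = \<lparr> pverts = {0..<6},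
     parcs = symcl {(0, 1), (1, 2), (0, 2), (3, 4), (4, 5), (3, 5), (0, 3), (1, 4), (2, 5)} \<rparr>"

text \<open>The hub is 0, the cycle of the wheel is 1, 2, ..., n.\<close>

definition wheel :: "nat \<Rightarrow> nat pair_pre_digraph" where
  "wheel n = \<lparr> pverts = {0..n},
     parcs = symcl ({(0, i) | i. 1 \<le> i \<and> i \<le> n} \<union> {(i, i + 1) | i. 1 \<le> i \<and> i < n} \<union> {(n, 1)}) \<rparr>"

text \<open>\<open>K3_plus E n\<close> is the complete bipartite graph with parts \<open>{0, 1, 2}\<close> and
  \<open>{3, ..., n + 2}\<close> together with the edges \<open>E\<close>.\<close>

definition K3_plus :: "nat rel \<Rightarrow> nat \<Rightarrow> nat pair_pre_digraph" where
  "K3_plus E n = \<lparr> pverts = {0..<n + 3}, parcs = symcl ({0..<3} \<times> {3..<n + 3} \<union> E) \<rparr>"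

definition K3 :: "nat \<Rightarrow> nat pair_pre_digraph" where
  "K3 = K3_plus {}"

definition K3' :: "nat \<Rightarrow> nat pair_pre_digraph" where
  "K3' = K3_plus {(0, 1)}"

definition K3'' :: "nat \<Rightarrow> nat pair_pre_digraph" where
  "K3'' = K3_plus {(0, 1), (1, 2)}"

definition K3''' :: "nat \<Rightarrow> nat pair_pre_digraph" where
  "K3''' = K3_plus {(0, 1), (1, 2), (0, 2)}"

definition graph_iso :: "'a pair_pre_digraph \<Rightarrow> 'b pair_pre_digraph \<Rightarrow> bool" where
  "graph_iso G H \<longleftrightarrow> digraph_iso (with_proj G) (with_proj H)"

text \<open>
  \<open>minor_model H G B\<close>: deleting the vertices of \<open>G\<close> outside all sets \<open>B x\<close>, contracting each
  \<open>B x\<close> to a single vertex \<open>x\<close> and deleting superfluous edges yields \<open>H\<close>.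
  The sets \<open>B x\<close> are nonempty since \<^const>\<open>connected\<close> graphs are.
\<close>

definition minor_model ::
  "'b pair_pre_digraph \<Rightarrow> 'a pair_pre_digraph \<Rightarrow> ('b \<Rightarrow> 'a set) \<Rightarrow> bool" where
  "minor_model H G B \<longleftrightarrow>
     (\<forall>x \<in> pverts H. B x \<subseteq> pverts G \<and> connected (with_proj G \<restriction> B x)) \<and>
     (\<forall>x \<in> pverts H. \<forall>y \<in> pverts H. x \<noteq> y \<longrightarrow> B x \<inter> B y = {}) \<and>
     (\<forall>(x, y) \<in> parcs H. \<exists>a \<in> B x. \<exists>b \<in> B y. (a, b) \<in> parcs G)"

definition has_minor_using ::
  "'b pair_pre_digraph \<Rightarrow> 'a pair_pre_digraph \<Rightarrow> 'a \<Rightarrow> 'a \<Rightarrow> bool" where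
  "has_minor_using H G u v \<longleftrightarrow>
     (\<exists>B. minor_model H G B \<and>
        (\<exists>(x, y) \<in> parcs H. B x \<inter> {u, v} \<noteq> {} \<and> B y \<inter> {u, v} \<noteq> {}))"

lemma pair_graph_symcl:
  assumes "finite V" "E \<subseteq> V \<times> V" "\<And>x. (x, x) \<notin> E"
  shows "pair_graph \<lparr> pverts = V, parcs = symcl E \<rparr>"
proof -
  have "finite E" using assms finite_subset by blast
  then show ?thesis
    using assms by unfold_locales (auto simp: symcl_def symmetric_def intro!: symI)
qed

lemma pair_graph_prism: "pair_graph prism"
  unfolding prism_def by (rule pair_graph_symcl) auto

lemma pair_graph_wheel: "3 \<le> n \<Longrightarrow> pair_graph (wheel n)"
  unfolding wheel_def by (rule pair_graph_symcl) auto

lemma pair_graph_K3: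
  "pair_graph (K3 n)" "pair_graph (K3' n)" "pair_graph (K3'' n)" "pair_graph (K3''' n)"
  unfolding K3_def K3'_def K3''_def K3'''_def K3_plus_def
  by (rule pair_graph_symcl; auto)+

lemma K3_complete_bipartite: "complete_bipartite_digraph 3 n (with_proj (K3 n))"
  unfolding complete_bipartite_digraph_pair_def
  by (intro conjI exI[of _ "{0..<3}"] exI[of _ "{3..<n + 3}"])
    (auto simp: K3_def K3_plus_def symcl_def image_iff)

end

theory Submission
  imports Defs
begin

text \<open>
  Let \<open>H = G - {u, v}\<close>. Condition (b) says that \<open>H\<close> is a tree, so it excludes a rooted prism, as such a
  prism always leaves a cycle in \<open>H\<close>; condition (a) excludes it since wheels and the graphs \<open>K\<^sub>3\<^sub>,\<^sub>n\<close> with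
  extra edges have no two disjoint cycles.

  Conversely, let \<open>H\<close> contain a cycle and suppose there is no rooted prism. By Menger's theorem no
  cycle through \<open>uv\<close> is disjoint from another cycle. A cycle \<open>C\<close> through \<open>uv\<close> with a largest component
  in \<open>G - C\<close> is induced and \<open>T = G - C\<close> is connected, hence \<open>T\<close> is a tree. A leaf of \<open>T\<close> adjacent to
  neither or both of \<open>u\<close>, \<open>v\<close> yields a rooted prism or a better choice of \<open>C\<close>. If all leaves are adjacent to the same end of \<open>uv\<close>,
  then \<open>T\<close> is a star and \<open>G\<close> is a \<open>K\<^sub>3\<^sub>,\<^sub>n\<close> with extra edges. If both kinds of leaves occur, then \<open>C\<close> is a
  triangle and \<open>G\<close> is a wheel, or \<open>C\<close> is a quadrilateral and \<open>G\<close> has six vertices.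
\<close>

section \<open>Connected sets of vertices\<close>

text \<open>Connections are handled as vertex sets rather than as paths: connectivity is a cut
  condition, and a cycle through the root edge is represented by a \<open>linking\<close> set, a
  connected set that sees both \<open>u\<close> and \<open>v\<close>. Branch sets can then be
  assembled by unions. A prism can carry the root edge in two ways, which gives two tools for
  contradictions: a cycle disjoint from a linking set places \<open>uv\<close> in a triangle of the
  prism, while six explicit branch sets place it in the matching. The maximal choice ranges over all
  linking sets, because later exchanges compare with sets such as a single leaf seeing both ends.
  Leaves are decisive because degrees are at least three: a leaf has only one neighbour in
  \<open>T\<close>, hence at least two on the cycle. The converse needs two separate invariants:
  \<open>H\<close> may contain cycles in case (a), and \<open>G\<close> may have two disjoint cycles
  in case (b).\<close>

definition joined :: "'a rel \<Rightarrow> 'a set \<Rightarrow> 'a set \<Rightarrow> bool" where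
  "joined R A B \<longleftrightarrow> (\<exists>a\<in>A. \<exists>b\<in>B. (a, b) \<in> R)"

text \<open>A cut condition in place of reachability: unions and deletions become set reasoning, and
  an actual path is extracted only where the order of its vertices matters.\<close>

definition conn :: "'a rel \<Rightarrow> 'a set \<Rightarrow> bool" where
  "conn R S \<longleftrightarrow> S \<noteq> {} \<and> (\<forall>A\<subseteq>S. A \<noteq> {} \<longrightarrow> A \<noteq> S \<longrightarrow> joined R A (S - A))"

lemma joinedI: "a \<in> A \<Longrightarrow> b \<in> B \<Longrightarrow> (a, b) \<in> R \<Longrightarrow> joined R A B"
  by (auto simp: joined_def)

lemma joined_sym: "sym R \<Longrightarrow> joined R A B \<longleftrightarrow> joined R B A"
  by (auto simp: joined_def dest: symD)

lemma joined_mono: "joined R A B \<Longrightarrow> A \<subseteq> A' \<Longrightarrow> B \<subseteq> B' \<Longrightarrow> joined R A' B'"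
  by (auto simp: joined_def)

lemma joined_Un [simp]:
  "joined R (A \<union> B) C \<longleftrightarrow> joined R A C \<or> joined R B C"
  "joined R C (A \<union> B) \<longleftrightarrow> joined R C A \<or> joined R C B"
  by (auto simp: joined_def)

text \<open>The premise excludes \<open>{a}\<close>, which is itself \<open>insert a {}\<close> and
  would make the rewriting loop.\<close>

lemma joined_insert [simp]:
  "joined R (insert a A) C \<longleftrightarrow> joined R {a} C \<or> joined R A C"
  "joined R C (insert a A) \<longleftrightarrow> joined R C {a} \<or> joined R C A" if "A \<noteq> {}"
  by (auto simp: joined_def)

lemma joined_empty [simp]: "\<not> joined R {} A" "\<not> joined R A {}"
  by (auto simp: joined_def)

lemma joined_singleton [simp]: "joined R {a} {b} \<longleftrightarrow> (a, b) \<in> R"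
  by (auto simp: joined_def)

lemma conn_nonempty: "conn R S \<Longrightarrow> S \<noteq> {}"
  by (simp add: conn_def)

lemma conn_joined: "conn R S \<Longrightarrow> A \<subseteq> S \<Longrightarrow> A \<noteq> {} \<Longrightarrow> A \<noteq> S \<Longrightarrow> joined R A (S - A)"
  by (simp add: conn_def)

lemma conn_mono: "conn R S \<Longrightarrow> R \<subseteq> R' \<Longrightarrow> conn R' S"
  unfolding conn_def joined_def by (meson subsetD)

lemma conn_singleton [simp]: "conn R {a}"
  by (auto simp: conn_def)

text \<open>A cut of the union either properly cuts \<open>A\<close> or \<open>B\<close>, whose own
  connectivity then helps, or it separates \<open>A\<close> from \<open>B\<close> as a whole; only
  the latter uses the overlap or the joining edge.\<close>

lemma conn_Un:
  assumes "sym R" "conn R A" "conn R B" "A \<inter> B \<noteq> {} \<or> joined R A B"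
  shows "conn R (A \<union> B)"
  unfolding conn_def
proof (intro conjI allI impI)
  show "A \<union> B \<noteq> {}" using assms(2) by (auto simp: conn_def)
  fix C assume C: "C \<subseteq> A \<union> B" "C \<noteq> {}" "C \<noteq> A \<union> B"
  consider "C \<inter> A \<noteq> {}" "C \<inter> A \<noteq> A" | "C \<inter> B \<noteq> {}" "C \<inter> B \<noteq> B"
    | "C \<inter> A = {} \<or> C \<inter> A = A" "C \<inter> B = {} \<or> C \<inter> B = B" by blast
  then show "joined R C (A \<union> B - C)"
  proof cases
    case 1
    then have "joined R (C \<inter> A) (A - C \<inter> A)" using conn_joined[OF assms(2)] by blast
    then show ?thesis by (rule joined_mono) auto
  next
    case 2
    then have "joined R (C \<inter> B) (B - C \<inter> B)" using conn_joined[OF assms(3)] by blast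
    then show ?thesis by (rule joined_mono) auto
  next
    case 3
    then have *: "(A \<subseteq> C \<and> C \<inter> B = {}) \<or> (B \<subseteq> C \<and> C \<inter> A = {})" using C by blast
    moreover have "A \<inter> B = {}" using * by blast
    then have "joined R A B" "joined R B A" using assms(4) joined_sym[OF assms(1)] by blast+
    ultimately show ?thesis
      using joined_mono[of R A B C "A \<union> B - C"] joined_mono[of R B A C "A \<union> B - C"] by auto
  qed
qed

lemma conn_insert: "sym R \<Longrightarrow> conn R A \<Longrightarrow> joined R A {x} \<Longrightarrow> conn R (insert x A)"
  using conn_Un[of R A "{x}"] by simp

text \<open>A maximal connected subset containing \<open>x\<close>: an edge leaving it inside
  \<open>X\<close> would enlarge it.\<close>

lemma ex_component:
  assumes "finite X" "x \<in> X" "sym R"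
  obtains K where "x \<in> K" "K \<subseteq> X" "conn R K" "\<not> joined R K (X - K)"
proof -
  define \<K> where "\<K> = {K. x \<in> K \<and> K \<subseteq> X \<and> conn R K}"
  have "finite \<K>" using assms(1) unfolding \<K>_def by (rule_tac finite_subset[of _ "Pow X"]) auto
  moreover have "{x} \<in> \<K>" using assms by (simp add: \<K>_def)
  ultimately obtain K where K: "K \<in> \<K>" "\<And>K'. K' \<in> \<K> \<Longrightarrow> K \<subseteq> K' \<Longrightarrow> K' = K"
    using finite_has_maximal[of \<K>] by (metis empty_iff)
  have "\<not> joined R K (X - K)"
  proof
    assume "joined R K (X - K)"
    then obtain y where y: "y \<in> X - K" "joined R K {y}" by (auto simp: joined_def)
    then have "insert y K \<in> \<K>" using K(1) conn_insert[OF assms(3)] by (auto simp: \<K>_def)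
    then show False using K(2)[of "insert y K"] y by auto
  qed
  then show ?thesis using that K(1) by (auto simp: \<K>_def)
qed

lemma conn_component_eq:
  assumes "conn R S" "K \<subseteq> S" "K \<noteq> {}" "\<not> joined R K (S - K)"
  shows "K = S"
  using assms conn_joined by blast

text \<open>A maximal connected proper subset \<open>K\<close> above \<open>P\<close> misses exactly
  one vertex, since adding a neighbour of \<open>K\<close> must already give \<open>T\<close>. This
  is the source of leaves.\<close>

lemma ex_noncut:
  assumes "finite T" "conn R T" "conn R P" "P \<subset> T" "sym R"
  obtains z where "z \<in> T - P" "conn R (T - {z})"
proof -
  define \<K> where "\<K> = {K. P \<subseteq> K \<and> K \<subset> T \<and> conn R K}"
  have "finite \<K>" using assms(1) unfolding \<K>_def by (rule_tac finite_subset[of _ "Pow T"]) auto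
  moreover have "P \<in> \<K>" using assms by (simp add: \<K>_def)
  ultimately obtain K where K: "K \<in> \<K>" "\<And>K'. K' \<in> \<K> \<Longrightarrow> K \<subseteq> K' \<Longrightarrow> K' = K"
    using finite_has_maximal[of \<K>] by (metis empty_iff)
  then have "joined R K (T - K)" using assms(2) by (auto simp: \<K>_def dest: conn_nonempty intro!: conn_joined)
  then obtain z where z: "z \<in> T - K" "joined R K {z}" by (auto simp: joined_def)
  then have "conn R (insert z K)" using K(1) conn_insert[OF assms(5)] by (auto simp: \<K>_def)
  moreover have "insert z K \<notin> \<K>" using K(2)[of "insert z K"] z by auto
  ultimately have "insert z K = T" using K(1) z by (auto simp: \<K>_def)
  then have "T - {z} = K" using z by auto
  then show ?thesis using that[of z] K(1) z by (auto simp: \<K>_def)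
qed

text \<open>\<open>K\<close> is the component of \<open>x\<close> in \<open>T - {y}\<close>, and
  \<open>L\<close> the component of \<open>y\<close> in \<open>T - K\<close>. A leftover vertex
  would be adjacent to neither, so nothing is left over.\<close>

lemma ex_split:
  assumes "finite T" "conn R T" "x \<in> T" "y \<in> T" "x \<noteq> y" "sym R"
  obtains A B where "x \<in> A" "y \<in> B" "A \<inter> B = {}" "A \<union> B = T" "conn R A" "conn R B" "joined R A B"
proof -
  obtain K where K: "x \<in> K" "K \<subseteq> T - {y}" "conn R K" "\<not> joined R K (T - {y} - K)"
    using ex_component[of "T - {y}" x R] assms by blast
  obtain L where L: "y \<in> L" "L \<subseteq> T - K" "conn R L" "\<not> joined R L (T - K - L)"
    using ex_component[of "T - K" y R] assms K by blast
  have *: "K \<union> L = T"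
  proof (rule conn_component_eq[OF assms(2)])
    have "T - (K \<union> L) \<subseteq> T - {y} - K" "T - (K \<union> L) = T - K - L" using L by auto
    then show "\<not> joined R (K \<union> L) (T - (K \<union> L))" using K(4) L(4) joined_mono by (metis joined_Un(1) order_refl)
  qed (use K L in auto)
  then have "T - K = L" using L by auto
  then have "joined R K L" using conn_joined[OF assms(2), of K] K L assms by (metis Diff_iff insertI1 subset_eq * sup_ge1 emptyE)
  then show ?thesis using that[of K L] K L * by auto
qed

lemma conn_no_edge_singleton:
  assumes "conn R S" "x \<in> S" "\<And>y. y \<in> S \<Longrightarrow> (x, y) \<notin> R"
  shows "S = {x}"
  using conn_joined[of R S "{x}"] assms by (auto simp: joined_def)

section \<open>Menger's theorem for connected sets\<close>

text \<open>Choosing a point of \<open>P\<close> in each of the \<open>k\<close> disjoint sets is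
  injective, hence bijective, so no set contains a second point. Linkages can thus be indexed by the
  vertices of a separator.\<close>

lemma reindex_family:
  assumes P: "card P = k" and k: "0 < k"
    and f: "\<And>i. i < k \<Longrightarrow> f i \<inter> P \<noteq> {}" "\<And>i j. i < k \<Longrightarrow> j < k \<Longrightarrow> i \<noteq> j \<Longrightarrow> f i \<inter> f j = {}"
  obtains \<sigma> where "bij_betw \<sigma> P {..<k}" "\<And>p. p \<in> P \<Longrightarrow> f (\<sigma> p) \<inter> P = {p}"
proof -
  define \<tau> where "\<tau> i = (SOME p. p \<in> f i \<inter> P)" for i
  have \<tau>: "\<tau> i \<in> f i \<inter> P" if "i < k" for i
    unfolding \<tau>_def using f(1)[OF that] some_in_eq[of "f i \<inter> P"] by blast
  have inj: "inj_on \<tau> {..<k}" using \<tau> f(2) by (intro inj_onI) (metis IntI Int_iff empty_iff lessThan_iff)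
  have finP: "finite P" using P k card_gt_0_iff by blast
  have img: "\<tau> ` {..<k} = P"
    using \<tau> card_image[OF inj] P finP by (intro card_subset_eq) auto
  have bij: "bij_betw (the_inv_into {..<k} \<tau>) P {..<k}"
    using inj img bij_betw_the_inv_into by (metis bij_betw_def)
  show ?thesis
  proof (rule that[OF bij])
    fix p assume "p \<in> P"
    then obtain i where i: "i < k" "p = \<tau> i" using img by auto
    then have s: "the_inv_into {..<k} \<tau> p = i" using inj by (simp add: the_inv_into_f_f)
    have "q = p" if q: "q \<in> f i \<inter> P" for q
    proof -
      obtain j where "j < k" "q = \<tau> j" using img q by auto
      then show ?thesis using \<tau>[of j] f(2)[of i j] i q by (cases "i = j") auto
    qed
    moreover have "p \<in> f i \<inter> P" using \<tau>[of i] i by simp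
    ultimately show "f (the_inv_into {..<k} \<tau> p) \<inter> P = {p}" unfolding s by blast
  qed
qed

text \<open>
  Following Goering, by induction on the number of edges: if the deletion of the edge \<open>xy\<close>
  creates a separator \<open>X\<close> of size \<open>k - 1\<close>, glue the linkages between \<open>A\<close> and \<open>X \<union> {x}\<close> to those
  between \<open>X \<union> {y}\<close> and \<open>B\<close>.
\<close>

lemma menger_side:
  assumes R: "sym R"
    and sep: "\<forall>Z. conn R' Z \<longrightarrow> Z \<inter> X = {} \<longrightarrow> Z \<inter> A \<noteq> {} \<longrightarrow> Z \<inter> B = {}"
    and R': "R' = R - {(x, y), (y, x)}"
    and lnk: "\<forall>Y. finite Y \<longrightarrow> card Y < k \<longrightarrow> (\<exists>Z. finite Z \<and> conn R Z \<and> Z \<inter> Y = {} \<and> Z \<inter> A \<noteq> {} \<and> Z \<inter> B \<noteq> {})"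
    and S: "S = {z. \<exists>Z. conn R' Z \<and> z \<in> Z \<and> Z \<inter> X = {} \<and> Z \<inter> A \<noteq> {}}"
    and xy: "x \<in> S" "y \<notin> S" "x \<noteq> y"
    and RA: "RA = R' \<inter> ((S \<union> X) \<times> (S \<union> X))"
  shows "\<forall>Y. finite Y \<longrightarrow> card Y < k \<longrightarrow> (\<exists>Z. finite Z \<and> conn RA Z \<and> Z \<inter> Y = {} \<and> Z \<inter> A \<noteq> {} \<and> Z \<inter> insert x X \<noteq> {})"
proof (intro allI impI)
  fix Y :: "'a set" assume Y: "finite Y" "card Y < k"
  have symR': "sym R'" using R R' by (auto simp: sym_def)
  then have symRA: "sym RA" using RA by (auto simp: sym_def)
  have SB: "S \<inter> B = {}" using sep S by blast
  have closed: "b \<in> S" if ab: "a \<in> S" "(a, b) \<in> R'" "b \<notin> X" for a b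
  proof -
    obtain Z where Z: "conn R' Z" "a \<in> Z" "Z \<inter> X = {}" "Z \<inter> A \<noteq> {}" using ab(1) S by blast
    have "conn R' (insert b Z)" using conn_insert[OF symR' Z(1)] Z(2) ab by (auto simp: joined_def)
    then show ?thesis using Z ab S by blast
  qed
  obtain Z0 where Z0: "finite Z0" "conn R Z0" "Z0 \<inter> Y = {}" "Z0 \<inter> A \<noteq> {}" "Z0 \<inter> B \<noteq> {}"
    using lnk Y by meson
  then obtain z0 where z0: "z0 \<in> Z0" "z0 \<in> A" by blast
  obtain Z where Z: "z0 \<in> Z" "Z \<subseteq> Z0" "conn RA Z" "\<not> joined RA Z (Z0 - Z)"
    using ex_component[OF Z0(1) z0(1) symRA] by blast
  \<comment> \<open>Otherwise \<open>Z\<close> lies in \<open>S\<close>, which misses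
    \<open>B\<close>, so some edge of \<open>R\<close> leaves \<open>Z\<close>. Its end in
    \<open>Z\<close> is neither \<open>x\<close> nor \<open>y\<close>; the edge is therefore not the
    deleted one and survives in \<open>RA\<close>, contrary to the choice of
    \<open>Z\<close>.\<close>
  have "Z \<inter> insert x X \<noteq> {}"
  proof
    assume disj: "Z \<inter> insert x X = {}"
    have ZS: "Z \<subseteq> S"
    proof
      fix z assume "z \<in> Z"
      moreover have "conn R' Z" by (rule conn_mono[OF Z(3)]) (auto simp: RA)
      ultimately show "z \<in> S" using Z z0 disj S by blast
    qed
    then have "Z \<noteq> Z0" using Z0(5) SB by blast
    then have "joined R Z (Z0 - Z)" using conn_joined[OF Z0(2) Z(2)] Z(1) by blast
    then obtain a b where ab: "a \<in> Z" "b \<in> Z0 - Z" "(a, b) \<in> R" by (auto simp: joined_def)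
    have "a \<noteq> x" "a \<noteq> y" using ab(1) disj ZS xy by auto
    then have 1: "(a, b) \<in> R'" using ab R' by auto
    then have "b \<in> S \<union> X" using closed ab ZS by blast
    then have "(a, b) \<in> RA" using 1 ab ZS RA by auto
    then show False using Z(4) ab by (auto simp: joined_def)
  qed
  then show "\<exists>Z. finite Z \<and> conn RA Z \<and> Z \<inter> Y = {} \<and> Z \<inter> A \<noteq> {} \<and> Z \<inter> insert x X \<noteq> {}"
    using Z Z0 z0 finite_subset by (intro exI[of _ Z]) auto
qed

text \<open>Branch sets only need connected sets, so these replace paths both in the linkage and in
  the hypothesis, which says that fewer than \<open>k\<close> vertices never separate
  \<open>A\<close> from \<open>B\<close>. A single vertex of \<open>A \<inter> B\<close> counts as a
  connection.\<close>

theorem menger_conn: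
  fixes R :: "'a rel"
  assumes "finite R" "sym R" "irrefl R" "finite A" "finite B" "0 < k"
    and "\<forall>Y. finite Y \<longrightarrow> card Y < k \<longrightarrow> (\<exists>Z. finite Z \<and> conn R Z \<and> Z \<inter> Y = {} \<and> Z \<inter> A \<noteq> {} \<and> Z \<inter> B \<noteq> {})"
  shows "\<exists>f. (\<forall>i<k. finite (f i) \<and> conn R (f i) \<and> f i \<inter> A \<noteq> {} \<and> f i \<inter> B \<noteq> {}) \<and>
    (\<forall>i<k. \<forall>j<k. i \<noteq> j \<longrightarrow> f i \<inter> f j = {})"
  using assms
proof (induction "card R" arbitrary: R A B rule: less_induct)
  case less
  note fin = less.prems(1,4,5) and symR = less.prems(2) and irr = less.prems(3) and k = less.prems(6)
    and lnk = less.prems(7)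
  show ?case
  proof (cases "R = {}")
    case True
    \<comment> \<open>Without edges all connections are single vertices, so
      \<open>A \<inter> B\<close> is itself a separator.\<close>
    have "card (A \<inter> B) \<ge> k"
    proof (rule ccontr)
      assume "\<not> card (A \<inter> B) \<ge> k"
      then obtain Z where Z: "conn R Z" "Z \<inter> (A \<inter> B) = {}" "Z \<inter> A \<noteq> {}" "Z \<inter> B \<noteq> {}"
        using lnk[rule_format, of "A \<inter> B"] fin by (metis finite_Int not_le)
      then obtain z where z: "z \<in> Z" "z \<in> A" by blast
      then have "Z = {z}" using conn_no_edge_singleton[OF Z(1)] True by blast
      then show False using Z z by auto
    qed
    then obtain C where C: "C \<subseteq> A \<inter> B" "card C = k" "finite C" by (meson obtain_subset_with_card_n)
    then obtain h where h: "bij_betw h {..<k} C" by (metis ex_bij_betw_nat_finite atLeast0LessThan)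
    show ?thesis
    proof (intro exI[of _ "\<lambda>i. {h i}"] conjI allI impI)
      fix i assume "i < k"
      then have "h i \<in> C" using h by (auto simp: bij_betw_def)
      then show "{h i} \<inter> A \<noteq> {}" "{h i} \<inter> B \<noteq> {}" using C by auto
      fix j assume "j < k" "i \<noteq> j"
      then show "{h i} \<inter> {h j} = {}" using h \<open>i < k\<close> by (auto simp: bij_betw_def inj_on_def)
    qed auto
  next
    case False
    then obtain x0 y0 where e: "(x0, y0) \<in> R" by auto
    define R' where "R' = R - {(x0, y0), (y0, x0)}"
    have R': "finite R'" "sym R'" "irrefl R'" "card R' < card R"
      using fin symR irr e by (auto simp: R'_def sym_def irrefl_def intro!: psubset_card_mono)
    show ?thesis
    proof (cases "\<forall>Y. finite Y \<longrightarrow> card Y < k \<longrightarrow> (\<exists>Z. finite Z \<and> conn R' Z \<and> Z \<inter> Y = {} \<and> Z \<inter> A \<noteq> {} \<and> Z \<inter> B \<noteq> {})")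
      case True
      then obtain f where "(\<forall>i<k. finite (f i) \<and> conn R' (f i) \<and> f i \<inter> A \<noteq> {} \<and> f i \<inter> B \<noteq> {}) \<and>
          (\<forall>i<k. \<forall>j<k. i \<noteq> j \<longrightarrow> f i \<inter> f j = {})"
        using less.hyps[OF R'(4) R'(1-3) fin(2,3) k] by blast
      then show ?thesis using conn_mono[of R' _ R] by (intro exI[of _ f]) (auto simp: R'_def)
    next
      case False
      then obtain X where X: "finite X" "card X < k"
        and sep0: "\<And>Z. finite Z \<Longrightarrow> conn R' Z \<Longrightarrow> Z \<inter> X = {} \<Longrightarrow> Z \<inter> A \<noteq> {} \<Longrightarrow> Z \<inter> B \<noteq> {} \<Longrightarrow> False" by meson
      \<comment> \<open>The separation by \<open>X\<close> is known for finite connections only. A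
        connected set with more than one vertex lies in the field of the finite relation
        \<open>R'\<close>, so all are finite.\<close>
      have fin_conn: "finite Z" if "conn R' Z" for Z
      proof (rule ccontr)
        assume inf: "infinite Z"
        have "Z \<subseteq> Field R'"
        proof
          fix z assume "z \<in> Z"
          then have "{z} \<noteq> Z" using inf by auto
          then show "z \<in> Field R'" using conn_joined[OF that, of "{z}"] \<open>z \<in> Z\<close>
            by (auto simp: joined_def Field_def)
        qed
        then show False using inf finite_Field[OF R'(1)] finite_subset by blast
      qed
      have sep: "\<forall>Z. conn R' Z \<longrightarrow> Z \<inter> X = {} \<longrightarrow> Z \<inter> A \<noteq> {} \<longrightarrow> Z \<inter> B = {}" using sep0 fin_conn by blast
      \<comment> \<open>The two sides of the separation: what remains reachable from
        \<open>A\<close>, respectively \<open>B\<close>, off \<open>X\<close> after deleting the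
        edge.\<close>
      define SA where "SA = {z. \<exists>Z. conn R' Z \<and> z \<in> Z \<and> Z \<inter> X = {} \<and> Z \<inter> A \<noteq> {}}"
      define SB where "SB = {z. \<exists>Z. conn R' Z \<and> z \<in> Z \<and> Z \<inter> X = {} \<and> Z \<inter> B \<noteq> {}}"
      have disj: "SA \<inter> SB = {}"
      proof -
        have False if z: "z \<in> SA" "z \<in> SB" for z
        proof -
          obtain Z Z' where Z: "conn R' Z" "z \<in> Z" "Z \<inter> X = {}" "Z \<inter> A \<noteq> {}"
            "conn R' Z'" "z \<in> Z'" "Z' \<inter> X = {}" "Z' \<inter> B \<noteq> {}" using z unfolding SA_def SB_def by blast
          then have "conn R' (Z \<union> Z')" using conn_Un[OF R'(2)] by blast
          then show False using sep[rule_format, of "Z \<union> Z'"] Z by auto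
        qed
        then show ?thesis by blast
      qed
      have DX: "SA \<inter> X = {}" "SB \<inter> X = {}" by (auto simp: SA_def SB_def)
      \<comment> \<open>A connection in \<open>R\<close> that avoids \<open>X\<close> has to leave
        the side \<open>S\<close>, and it can do so only along the deleted edge. Stated for general
        \<open>C\<close>, \<open>D\<close> to serve both sides.\<close>
      have cross: "\<exists>a b. a \<in> Z \<inter> S \<and> b \<in> Z - S \<and> (a, b) \<in> R \<and> (a, b) \<notin> R'"
        if Z: "conn R Z" "Z \<inter> X = {}" "Z \<inter> C \<noteq> {}" "Z \<inter> D \<noteq> {}" and S: "S = {z. \<exists>Z. conn R' Z \<and> z \<in> Z \<and> Z \<inter> X = {} \<and> Z \<inter> C \<noteq> {}}"
          and SD: "\<forall>Z. conn R' Z \<longrightarrow> Z \<inter> X = {} \<longrightarrow> Z \<inter> C \<noteq> {} \<longrightarrow> Z \<inter> D = {}" for Z S C D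
      proof -
        obtain c where c: "c \<in> Z" "c \<in> C" using Z by blast
        then have "c \<in> S" unfolding S using Z(2) by (auto intro!: exI[of _ "{c}"])
        moreover have "S \<inter> D = {}" using S SD by blast
        ultimately have "joined R (Z \<inter> S) (Z - Z \<inter> S)" using c Z by (intro conn_joined) auto
        then obtain a b where ab: "a \<in> Z" "a \<in> S" "b \<in> Z" "b \<notin> S" "(a, b) \<in> R" by (auto simp: joined_def)
        moreover have "(a, b) \<notin> R'"
        proof
          assume ab': "(a, b) \<in> R'"
          obtain W where W: "conn R' W" "a \<in> W" "W \<inter> X = {}" "W \<inter> C \<noteq> {}" using ab S by blast
          have "conn R' (insert b W)" using conn_insert[OF R'(2) W(1)] W(2) ab' by (auto simp: joined_def)
          then show False using W ab Z(2) S by blast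
        qed
        ultimately show ?thesis by blast
      qed
      have sep': "\<forall>Z. conn R' Z \<longrightarrow> Z \<inter> X = {} \<longrightarrow> Z \<inter> B \<noteq> {} \<longrightarrow> Z \<inter> A = {}" using sep by blast
      obtain Z0 where Z0: "conn R Z0" "Z0 \<inter> X = {}" "Z0 \<inter> A \<noteq> {}" "Z0 \<inter> B \<noteq> {}" using lnk X by meson
      obtain x y where xy: "x \<in> SA" "y \<notin> SA" "(x, y) \<in> R" "(x, y) \<notin> R'"
        using cross[OF Z0 SA_def sep] by blast
      obtain x' y' where xy': "x' \<in> SB" "y' \<notin> SB" "(x', y') \<in> R" "(x', y') \<notin> R'"
        using cross[OF Z0(1,2,4,3) SB_def sep'] by blast
      \<comment> \<open>Both \<open>x\<close> and \<open>x'\<close> are ends of the deleted edge and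
        lie on disjoint sides, so \<open>x'\<close> is \<open>y\<close>.\<close>
      have yB: "y \<in> SB" using xy xy' disj by (auto simp: R'_def)
      have xB: "x \<notin> SB" using xy disj by auto
      have Rxy: "R' = R - {(x, y), (y, x)}" "R' = R - {(y, x), (x, y)}" using xy by (auto simp: R'_def)
      have nexy: "x \<noteq> y" using xy by auto
      \<comment> \<open>Adding one end of the deleted edge to \<open>X\<close> separates
        \<open>A\<close> from \<open>B\<close> in all of \<open>R\<close>, so \<open>X\<close> has
        exactly \<open>k - 1\<close> elements.\<close>
      have cX: "card (insert x X) = k \<and> card (insert y X) = k"
      proof -
        have "\<not> card (insert x X) < k"
        proof
          assume "card (insert x X) < k"
          then obtain Z where Z: "conn R Z" "Z \<inter> insert x X = {}" "Z \<inter> A \<noteq> {}" "Z \<inter> B \<noteq> {}"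
            using lnk[rule_format, of "insert x X"] X by auto
          then have "Z \<inter> X = {}" by auto
          then obtain a b where "a \<in> Z" "a \<in> SA" "(a, b) \<in> R" "(a, b) \<notin> R'"
            using cross[OF Z(1) _ Z(3,4) SA_def sep] by blast
          then show False using Z xy Rxy by auto
        qed
        moreover have "x \<notin> X" "y \<notin> X" using xy(1) yB DX by auto
        ultimately show ?thesis using X by auto
      qed
      define RA where "RA = R' \<inter> ((SA \<union> X) \<times> (SA \<union> X))"
      define RB where "RB = R' \<inter> ((SB \<union> X) \<times> (SB \<union> X))"
      have lnk': "\<forall>Y. finite Y \<longrightarrow> card Y < k \<longrightarrow> (\<exists>Z. finite Z \<and> conn R Z \<and> Z \<inter> Y = {} \<and> Z \<inter> B \<noteq> {} \<and> Z \<inter> A \<noteq> {})"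
        using lnk by meson
      have RAB: "finite RA" "sym RA" "irrefl RA" "card RA < card R" "finite RB" "sym RB" "irrefl RB" "card RB < card R"
        using R' card_mono[of R' RA] card_mono[of R' RB]
        by (auto simp: RA_def RB_def sym_def irrefl_def)
      obtain f where f: "\<forall>i<k. finite (f i) \<and> conn RA (f i) \<and> f i \<inter> A \<noteq> {} \<and> f i \<inter> insert x X \<noteq> {}"
          "\<forall>i<k. \<forall>j<k. i \<noteq> j \<longrightarrow> f i \<inter> f j = {}"
        using less.hyps[OF RAB(4,1-3) fin(2) finite.insertI[OF X(1), of x] k
            menger_side[OF symR sep Rxy(1) lnk SA_def xy(1,2) nexy RA_def]] by blast
      obtain g where g: "\<forall>i<k. finite (g i) \<and> conn RB (g i) \<and> g i \<inter> B \<noteq> {} \<and> g i \<inter> insert y X \<noteq> {}"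
          "\<forall>i<k. \<forall>j<k. i \<noteq> j \<longrightarrow> g i \<inter> g j = {}"
        using less.hyps[OF RAB(8,5-7) fin(3) finite.insertI[OF X(1), of y] k
            menger_side[OF symR sep' Rxy(2) lnk' SB_def yB xB nexy[symmetric] RB_def]] by blast
      obtain \<sigma> where \<sigma>: "bij_betw \<sigma> (insert x X) {..<k}" "\<And>p. p \<in> insert x X \<Longrightarrow> f (\<sigma> p) \<inter> insert x X = {p}"
        using reindex_family[of "insert x X" k f] cX k f by metis
      obtain \<tau> where \<tau>: "bij_betw \<tau> (insert y X) {..<k}" "\<And>p. p \<in> insert y X \<Longrightarrow> g (\<tau> p) \<inter> insert y X = {p}"
        using reindex_family[of "insert y X" k g] cX k g by metis
      have sub: "Z \<subseteq> S \<union> X" if "conn (R' \<inter> ((S \<union> X) \<times> (S \<union> X))) Z" "Z \<inter> (S \<union> X) \<noteq> {}" for Z S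
      proof
        fix z assume z: "z \<in> Z"
        show "z \<in> S \<union> X"
        proof (rule ccontr)
          assume "z \<notin> S \<union> X"
          then have "Z = {z}" using conn_no_edge_singleton[OF that(1) z] by blast
          then show False using that(2) \<open>z \<notin> S \<union> X\<close> by auto
        qed
      qed
      \<comment> \<open>The pieces with index in \<open>X\<close> share that vertex; the pieces at
        \<open>x\<close> and \<open>y\<close> are joined by the deleted edge.\<close>
      define h where "h p = f (\<sigma> p) \<union> g (\<tau> (if p = x then y else p))" for p
      let ?q = "\<lambda>p. if p = x then y else p"
      have \<sigma>k: "\<sigma> p < k" if "p \<in> insert x X" for p using \<sigma>(1) that by (auto simp: bij_betw_def)
      have \<tau>k: "\<tau> p < k" if "p \<in> insert y X" for p using \<tau>(1) that by (auto simp: bij_betw_def)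
      have q: "?q p \<in> insert y X" if "p \<in> insert x X" for p using that by auto
      have fs: "f (\<sigma> p) \<subseteq> SA \<union> X" if "p \<in> insert x X" for p
        using sub[of SA "f (\<sigma> p)"] f(1) \<sigma>k[OF that] \<sigma>(2)[OF that] xy(1) that unfolding RA_def by blast
      have gs: "g (\<tau> p) \<subseteq> SB \<union> X" if "p \<in> insert y X" for p
        using sub[of SB "g (\<tau> p)"] g(1) \<tau>k[OF that] \<tau>(2)[OF that] yB that unfolding RB_def by blast
      have \<sigma>i: "\<sigma> p \<noteq> \<sigma> p'" if "p \<in> insert x X" "p' \<in> insert x X" "p \<noteq> p'" for p p'
        using \<sigma>(1) that by (auto simp: bij_betw_def inj_on_def)
      have \<tau>i: "\<tau> p \<noteq> \<tau> p'" if "p \<in> insert y X" "p' \<in> insert y X" "p \<noteq> p'" for p p'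
        using \<tau>(1) that by (auto simp: bij_betw_def inj_on_def)
      have yX: "y \<notin> X" "x \<notin> X" using xy(1) yB DX by auto
      \<comment> \<open>The two sides meet only in \<open>X\<close>, and a common vertex in
        \<open>X\<close> would be the index of both pieces.\<close>
      have fg: "f (\<sigma> p) \<inter> g (\<tau> (?q p')) = {}" if p: "p \<in> insert x X" "p' \<in> insert x X" "p \<noteq> p'" for p p'
      proof -
        have False if t: "t \<in> f (\<sigma> p)" "t \<in> g (\<tau> (?q p'))" for t
        proof -
          have "t \<in> X" using t fs[OF p(1)] gs[OF q[OF p(2)]] disj by blast
          then have "t \<in> f (\<sigma> p) \<inter> insert x X" "t \<in> g (\<tau> (?q p')) \<inter> insert y X" using t by auto
          then have "t = p" "t = ?q p'" using \<sigma>(2)[OF p(1)] \<tau>(2)[OF q[OF p(2)]] by auto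
          then show False using p \<open>t \<in> X\<close> yX by (auto split: if_splits)
        qed
        then show ?thesis by blast
      qed
      have h: "finite (h p) \<and> conn R (h p) \<and> h p \<inter> A \<noteq> {} \<and> h p \<inter> B \<noteq> {}" if p: "p \<in> insert x X" for p
      proof -
        have 1: "conn R (f (\<sigma> p))" "conn R (g (\<tau> (?q p)))"
          using f(1) g(1) \<sigma>k[OF p] \<tau>k[OF q[OF p]] by (auto simp: RA_def RB_def R'_def elim!: conn_mono)
        have mem: "p \<in> f (\<sigma> p)" "?q p \<in> g (\<tau> (?q p))" using \<sigma>(2)[OF p] \<tau>(2)[OF q[OF p]] by blast+
        have "f (\<sigma> p) \<inter> g (\<tau> (?q p)) \<noteq> {} \<or> joined R (f (\<sigma> p)) (g (\<tau> (?q p)))"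
        proof (cases "p = x")
          case True
          then show ?thesis using mem xy(3) by (auto intro!: joinedI)
        next
          case False
          then show ?thesis using mem by auto
        qed
        then have "conn R (h p)" unfolding h_def by (rule conn_Un[OF symR 1])
        then show ?thesis using f(1) g(1) \<sigma>k[OF p] \<tau>k[OF q[OF p]] unfolding h_def by blast
      qed
      have hd: "h p \<inter> h p' = {}" if p: "p \<in> insert x X" "p' \<in> insert x X" "p \<noteq> p'" for p p'
      proof -
        have "?q p \<noteq> ?q p'" using p yX by auto
        then show ?thesis
        using f(2) g(2) \<sigma>k[OF p(1)] \<sigma>k[OF p(2)] \<tau>k[OF q[OF p(1)]] \<tau>k[OF q[OF p(2)]] \<sigma>i[OF p]
            \<tau>i[OF q[OF p(1)] q[OF p(2)]] fg[OF p] fg[OF p(2,1)] p(3)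
        unfolding h_def Int_Un_distrib Int_Un_distrib2 by (metis Int_commute sup_bot.right_neutral)
      qed
      obtain e where e: "bij_betw e {..<k} (insert x X)"
        using cX by (metis ex_bij_betw_nat_finite atLeast0LessThan X(1) finite_insert)
      show ?thesis
      proof (intro exI[of _ "\<lambda>i. h (e i)"] conjI allI impI)
        fix i assume i: "i < k"
        then have ei: "e i \<in> insert x X" using e by (auto simp: bij_betw_def)
        from h[OF this] show "finite (h (e i))" "conn R (h (e i))" "h (e i) \<inter> A \<noteq> {}" "h (e i) \<inter> B \<noteq> {}" by auto
        fix j assume j: "j < k" "i \<noteq> j"
        then have "e j \<in> insert x X" "e i \<noteq> e j" using e i by (auto simp: bij_betw_def inj_on_def)
        then show "h (e i) \<inter> h (e j) = {}" using hd ei by blast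
      qed
    qed
  qed
qed

section \<open>Paths and cycles\<close>

definition is_path :: "'a rel \<Rightarrow> 'a list \<Rightarrow> bool" where
  "is_path R xs \<longleftrightarrow> xs \<noteq> [] \<and> distinct xs \<and> successively (\<lambda>x y. (x, y) \<in> R) xs"

definition is_cycle :: "'a rel \<Rightarrow> 'a list \<Rightarrow> bool" where
  "is_cycle R xs \<longleftrightarrow> 3 \<le> length xs \<and> is_path R xs \<and> (last xs, hd xs) \<in> R"

definition has_cycle :: "'a rel \<Rightarrow> 'a set \<Rightarrow> bool" where
  "has_cycle R S \<longleftrightarrow> (\<exists>xs. is_cycle R xs \<and> set xs \<subseteq> S)"

lemma has_cycle_mono: "has_cycle R S \<Longrightarrow> S \<subseteq> T \<Longrightarrow> has_cycle R T"
  by (auto simp: has_cycle_def)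

lemma is_path_append:
  assumes "xs \<noteq> []" "ys \<noteq> []"
  shows "is_path R (xs @ ys) \<longleftrightarrow>
    is_path R xs \<and> is_path R ys \<and> set xs \<inter> set ys = {} \<and> (last xs, hd ys) \<in> R"
  using assms by (auto simp: is_path_def successively_append_iff)

lemma is_path_Cons:
  "is_path R (x # xs) \<longleftrightarrow> xs = [] \<or> (x \<notin> set xs \<and> (x, hd xs) \<in> R \<and> is_path R xs)"
  by (cases xs) (auto simp: is_path_def)

lemma is_path_rev: "sym R \<Longrightarrow> is_path R (rev xs) \<longleftrightarrow> is_path R xs"
  by (auto simp: is_path_def successively_rev sym_def elim!: successively_mono)

lemma is_path_conn:
  assumes "sym R" "is_path R xs"
  shows "conn R (set xs)"
  using assms(2)
proof (induction xs)
  case (Cons x xs)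
  then show ?case
    using conn_insert[OF assms(1), of "set xs" x] assms(1)
    by (cases xs) (auto simp: is_path_Cons joined_def dest: symD)
qed (simp add: is_path_def)

text \<open>No edge inside \<open>S\<close> leaves the set of ends of paths from \<open>x\<close>: a
  neighbour already on the path is reached by truncating the path there.\<close>

lemma conn_path:
  assumes "conn R S" "x \<in> S" "y \<in> S"
  obtains xs where "is_path R xs" "hd xs = x" "last xs = y" "set xs \<subseteq> S"
proof -
  define K where "K = {z. \<exists>xs. is_path R xs \<and> hd xs = x \<and> last xs = z \<and> set xs \<subseteq> S}"
  have "x \<in> K" unfolding K_def using assms(2) by (intro CollectI exI[of _ "[x]"]) (auto simp: is_path_def)
  have "K \<subseteq> S" unfolding K_def is_path_def by auto
  have "K = S"
  proof (rule ccontr)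
    assume "K \<noteq> S"
    then have "joined R K (S - K)" using conn_joined[OF assms(1) \<open>K \<subseteq> S\<close>] \<open>x \<in> K\<close> by blast
    then obtain a b where ab: "a \<in> K" "b \<in> S - K" "(a, b) \<in> R" by (auto simp: joined_def)
    then obtain xs where xs: "is_path R xs" "hd xs = x" "last xs = a" "set xs \<subseteq> S" by (auto simp: K_def)
    show False
    proof (cases "b \<in> set xs")
      case True
      then obtain p q where pq: "xs = p @ b # q" by (meson split_list)
      then have "is_path R (p @ [b])" using xs(1) by (auto simp: is_path_def successively_append_iff)
      then have "b \<in> K" unfolding K_def using xs pq
        by (intro CollectI exI[of _ "p @ [b]"]) (auto simp: hd_append)
      then show False using ab by auto
    next
      case False
      then have "is_path R (xs @ [b])" using xs ab by (auto simp: is_path_def successively_append_iff)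
      then have "b \<in> K" unfolding K_def using xs ab
        by (intro CollectI exI[of _ "xs @ [b]"]) (auto simp: is_path_def hd_append)
      then show False using ab by auto
    qed
  qed
  then show ?thesis using assms(3) that by (auto simp: K_def)
qed

text \<open>A path in each set, closed by the two edges. These may share one end; their distinctness
  prevents the closed walk from having length two. Nearly all cycles below arise this way.\<close>

lemma has_cycle_two_edges:
  assumes "sym R" "conn R A" "conn R B" "A \<inter> B = {}"
    and "a \<in> A" "a' \<in> A" "b \<in> B" "b' \<in> B" "(a, b) \<in> R" "(a', b') \<in> R" "a \<noteq> a' \<or> b \<noteq> b'"
  shows "has_cycle R (A \<union> B)"
proof -
  obtain xs where xs: "is_path R xs" "hd xs = a'" "last xs = a" "set xs \<subseteq> A"
    using conn_path[OF assms(2,6,5)] by blast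
  obtain ys where ys: "is_path R ys" "hd ys = b" "last ys = b'" "set ys \<subseteq> B"
    using conn_path[OF assms(3,7,8)] by blast
  have ne: "xs \<noteq> []" "ys \<noteq> []" using xs ys by (auto simp: is_path_def)
  have p: "is_path R (xs @ ys)" using ne xs ys assms by (auto simp: is_path_append)
  have "\<not> (length xs = 1 \<and> length ys = 1)" using xs ys assms(11) by (auto simp: length_Suc_conv)
  moreover have "length xs \<ge> 1" "length ys \<ge> 1" using ne by (auto simp: Suc_le_eq)
  ultimately have "length xs + length ys \<ge> 3" by linarith
  then have "is_cycle R (xs @ ys)"
    using p ne xs ys assms(1,10) by (auto simp: is_cycle_def dest: symD)
  then show ?thesis using xs ys unfolding has_cycle_def by (intro exI[of _ "xs @ ys"]) auto
qed

lemma is_cycle_rotate: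
  assumes "is_cycle R (xs @ ys)" shows "is_cycle R (ys @ xs)"
  using assms by (cases "xs = []"; cases "ys = []") (auto simp: is_cycle_def is_path_append)

text \<open>After a rotation \<open>x\<close> comes first, and what follows is a path whose ends are
  the two neighbours.\<close>

lemma is_cycle_distinct_edges:
  assumes "sym R" "is_cycle R xs" "x \<in> set xs"
  obtains a b where "a \<in> set xs" "b \<in> set xs" "a \<noteq> b" "a \<noteq> x" "b \<noteq> x" "(x, a) \<in> R" "(x, b) \<in> R"
    "conn R (set xs - {x})"
proof -
  obtain p q where pq: "xs = p @ x # q" using assms(3) by (meson split_list)
  then have c: "is_cycle R (x # q @ p)" using is_cycle_rotate[of R p "x # q"] assms(2) by simp
  define ys where "ys = q @ p"
  have len: "length ys \<ge> 2" and path: "is_path R ys" and x: "x \<notin> set ys" "(x, hd ys) \<in> R" "(last ys, x) \<in> R"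
    using c by (auto simp: is_cycle_def is_path_Cons ys_def[symmetric] split: if_splits)
  have "hd ys \<noteq> last ys" using len path by (cases ys) (auto simp: is_path_def)
  moreover have "hd ys \<in> set ys" "last ys \<in> set ys" using path by (auto simp: is_path_def)
  moreover have "set xs - {x} = set ys" using x(1) pq by (auto simp: ys_def)
  ultimately show ?thesis
    using that[of "hd ys" "last ys"] x is_path_conn[OF assms(1) path] assms(1) by (auto dest: symD)
qed

text \<open>Cut directly behind the first and the second vertex of \<open>F\<close>; the third is
  left in the last segment.\<close>

lemma is_path_split_three:
  assumes "is_path R xs" "F \<subseteq> set xs" "card F = 3"
  obtains p q r a b c where "xs = p @ q @ r" "F = {a, b, c}" "a \<in> set p" "b \<in> set q" "c \<in> set r"
proof -
  have step: "\<exists>p a q. ys = (p @ [a]) @ q \<and> a \<in> H \<and> H - {a} \<subseteq> set q"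
    if H: "H \<subseteq> set ys" "H \<noteq> {}" for H :: "'a set" and ys
  proof -
    have "\<exists>z\<in>set ys. z \<in> H" using H by blast
    then obtain p a q where "ys = p @ a # q" "a \<in> H" "\<forall>z\<in>set p. z \<notin> H"
      using split_list_first_prop[of ys "\<lambda>z. z \<in> H"] by blast
    then show ?thesis using H by (intro exI[of _ p] exI[of _ a] exI[of _ q]) auto
  qed
  have fin: "finite F" using assms(3) card.infinite by fastforce
  obtain p a q' where 1: "xs = (p @ [a]) @ q'" "a \<in> F" "F - {a} \<subseteq> set q'"
    using step[of F xs] assms(2,3) by (metis card.empty zero_neq_numeral)
  then have c1: "card (F - {a}) = 2" using assms(3) fin by simp
  then have "F - {a} \<noteq> {}" by (metis card.empty zero_neq_numeral)
  then obtain q b r where 2: "q' = (q @ [b]) @ r" "b \<in> F - {a}" "F - {a} - {b} \<subseteq> set r"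
    using step[of "F - {a}" q'] 1 by blast
  then have "card (F - {a} - {b}) = 1" using c1 fin by simp
  then obtain c where c: "F - {a} - {b} = {c}" using card_1_singletonE by blast
  show ?thesis
  proof (rule that[of "p @ [a]" "q @ [b]" r a b c])
    show "xs = (p @ [a]) @ (q @ [b]) @ r" using 1 2 by simp
    show "F = {a, b, c}" using c 1(2) 2(2) by blast
    show "c \<in> set r" using c 2 by auto
  qed auto
qed

text \<open>The closing edge makes the three segments pairwise adjacent, a triangle after
  contraction. That the two ends of the path fall into different segments is what puts the root edge
  between two branch sets.\<close>

lemma is_path_partition:
  assumes "is_path R xs" "F \<subseteq> set xs" "card F = 3" "sym R" "(last xs, hd xs) \<in> R"
  obtains X where "\<And>f. f \<in> F \<Longrightarrow> conn R (X f) \<and> f \<in> X f \<and> X f \<subseteq> set xs"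
    "\<And>f g. f \<in> F \<Longrightarrow> g \<in> F \<Longrightarrow> f \<noteq> g \<Longrightarrow> X f \<inter> X g = {} \<and> joined R (X f) (X g)"
    "\<exists>f\<in>F. \<exists>g\<in>F. f \<noteq> g \<and> hd xs \<in> X f \<and> last xs \<in> X g"
proof -
  obtain p q r a b c where xs: "xs = p @ q @ r" and F: "F = {a, b, c}"
    and m: "a \<in> set p" "b \<in> set q" "c \<in> set r"
    using is_path_split_three[OF assms(1-3)] by metis
  have ne: "p \<noteq> []" "q \<noteq> []" "r \<noteq> []" using m by auto
  have P: "is_path R p" "is_path R q" "is_path R r" "set p \<inter> set q = {}" "set p \<inter> set r = {}" "set q \<inter> set r = {}"
    "(last p, hd q) \<in> R" "(last q, hd r) \<in> R"
    using assms(1) ne unfolding xs by (auto simp: is_path_append)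
  have ends: "hd xs = hd p" "last xs = last r" using ne xs by auto
  have J: "joined R (set p) (set q)" "joined R (set q) (set r)" "joined R (set r) (set p)"
    using P(7,8) assms(5) ne ends
    by (simp_all add: joinedI[of "last p" _ "hd q"] joinedI[of "last q" _ "hd r"] joinedI[of "last r" _ "hd p"])
  have J': "joined R (set q) (set p)" "joined R (set r) (set q)" "joined R (set p) (set r)"
    using J joined_sym[OF assms(4)] by blast+
  have d: "a \<noteq> b" "a \<noteq> c" "b \<noteq> c" using m P by auto
  define X where "X f = (if f = a then set p else if f = b then set q else set r)" for f
  have X: "X a = set p" "X b = set q" "X c = set r" using d by (auto simp: X_def)
  show ?thesis
  proof (rule that[of X])
    show "conn R (X f) \<and> f \<in> X f \<and> X f \<subseteq> set xs" if "f \<in> F" for f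
      using that m X is_path_conn[OF assms(4)] P(1-3) unfolding F xs by auto
    show "X f \<inter> X g = {} \<and> joined R (X f) (X g)" if "f \<in> F" "g \<in> F" "f \<noteq> g" for f g
      using that X P(4-6) J J' unfolding F by auto
    show "\<exists>f\<in>F. \<exists>g\<in>F. f \<noteq> g \<and> hd xs \<in> X f \<and> last xs \<in> X g"
      using X d ne ends unfolding F by (intro bexI[of _ a] bexI[of _ c]) auto
  qed
qed

text \<open>Take a minimal connection and fix a vertex in \<open>B\<close>. Some other vertex can be
  removed without disconnecting it; by minimality this removes the last vertex of \<open>A\<close>.
  The same holds with the sides exchanged.\<close>

lemma ex_linking_subset:
  assumes "finite Z" "sym R" "conn R Z" "Z \<inter> A \<noteq> {}" "Z \<inter> B \<noteq> {}"
  obtains Y a b where "Y \<subseteq> Z" "conn R Y" "Y \<inter> A = {a}" "Y \<inter> B = {b}"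
proof -
  define \<Y> where "\<Y> = {Y. Y \<subseteq> Z \<and> conn R Y \<and> Y \<inter> A \<noteq> {} \<and> Y \<inter> B \<noteq> {}}"
  have "finite \<Y>" using assms(1) unfolding \<Y>_def by (rule_tac finite_subset[of _ "Pow Z"]) auto
  moreover have "Z \<in> \<Y>" using assms by (simp add: \<Y>_def)
  ultimately obtain Y where Y: "Y \<in> \<Y>" "\<And>Y'. Y' \<in> \<Y> \<Longrightarrow> Y' \<subseteq> Y \<Longrightarrow> Y' = Y"
    using finite_has_minimal[of \<Y>] by (metis empty_iff)
  then have finY: "finite Y" and c: "conn R Y" and YZ: "Y \<subseteq> Z"
    using assms(1) finite_subset by (auto simp: \<Y>_def)
  have one: "\<exists>a. Y \<inter> C = {a}" if CD: "Y \<inter> C \<noteq> {}" "Y \<inter> D \<noteq> {}"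
    and min: "\<And>Y'. conn R Y' \<Longrightarrow> Y' \<subset> Y \<Longrightarrow> Y' \<inter> C \<noteq> {} \<Longrightarrow> Y' \<inter> D \<noteq> {} \<Longrightarrow> False" for C D
  proof -
    obtain d where d: "d \<in> Y \<inter> D" using CD by blast
    show ?thesis
    proof (cases "Y = {d}")
      case True
      then show ?thesis using CD by auto
    next
      case False
      then have "{d} \<subset> Y" using d by auto
      then obtain z where z: "z \<in> Y - {d}" "conn R (Y - {z})"
        using ex_noncut[OF finY c conn_singleton _ assms(2)] by metis
      then have "(Y - {z}) \<inter> C = {}" using min[of "Y - {z}"] d by blast
      then show ?thesis using CD by blast
    qed
  qed
  have min: "False" if "conn R Y'" "Y' \<subset> Y" "Y' \<inter> A \<noteq> {}" "Y' \<inter> B \<noteq> {}" for Y'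
    using Y(2)[of Y'] that YZ by (auto simp: \<Y>_def)
  have "\<exists>a. Y \<inter> A = {a}" using one[of A B] min Y(1) by (auto simp: \<Y>_def)
  moreover have "\<exists>a. Y \<inter> B = {a}" using one[of B A] min Y(1) by (auto simp: \<Y>_def)
  ultimately show ?thesis using that YZ c by blast
qed

section \<open>Rooted prism minors in 3-connected graphs\<close>

text \<open>The set reached from a vertex is left by no edge inside \<open>S\<close>, and conversely
  a walk cannot escape from a set that no edge leaves.\<close>

lemma connected_iff_conn:
  assumes "pair_graph G"
  shows "connected (with_proj G \<restriction> S) \<longleftrightarrow> conn (parcs G) S"
proof -
  let ?E = "parcs G" and ?r = "rtrancl_on S (parcs G \<inter> S \<times> S)"
  have sym: "sym ?E"
    using assms pair_sym_digraph.pair_sym_arcs[of G] by (auto simp: pair_graph_def pair_pseudo_graph_def symmetric_def)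
  have "parcs (mk_symmetric (with_proj G \<restriction> S)) = ?E \<inter> S \<times> S"
    using sym by (auto simp: parcs_mk_symmetric dest: symD)
  then have 1: "connected (with_proj G \<restriction> S) \<longleftrightarrow> S \<noteq> {} \<and> (\<forall>x\<in>S. \<forall>y\<in>S. (x, y) \<in> ?r)"
    by (simp add: connected_def strongly_connected_def reachable_def)
  show ?thesis
  proof
    assume "connected (with_proj G \<restriction> S)"
    then have ne: "S \<noteq> {}" and reach: "\<And>x y. x \<in> S \<Longrightarrow> y \<in> S \<Longrightarrow> (x, y) \<in> ?r" using 1 by auto
    have "joined ?E A (S - A)" if A: "A \<subseteq> S" "A \<noteq> {}" "A \<noteq> S" for A
    proof (rule ccontr)
      assume nj: "\<not> joined ?E A (S - A)"
      obtain x y where xy: "x \<in> A" "y \<in> S - A" using A by blast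
      then have "(x, y) \<in> ?r" using reach A by blast
      then have "y \<in> A" using xy(1)
        by (induction rule: rtrancl_on_induct) (use nj in \<open>auto simp: joined_def\<close>)
      then show False using xy by simp
    qed
    then show "conn ?E S" using ne by (simp add: conn_def)
  next
    assume c: "conn ?E S"
    have "(x, y) \<in> ?r" if xy: "x \<in> S" "y \<in> S" for x y
    proof -
      define K where "K = {z. (x, z) \<in> ?r}"
      have "K \<subseteq> S" by (auto simp: K_def dest: in_rtrancl_on_in_F)
      moreover have "x \<in> K" using xy by (simp add: K_def)
      moreover have "\<not> joined ?E K (S - K)"
        using \<open>K \<subseteq> S\<close> by (auto simp: joined_def K_def dest: rtrancl_on_into_rtrancl_on)
      ultimately show ?thesis using conn_component_eq[OF c, of K] xy by (auto simp: K_def)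
    qed
    then show "connected (with_proj G \<restriction> S)" using 1 c conn_nonempty by blast
  qed
qed

lemma all_less_6: "(\<forall>i<6. P i) \<longleftrightarrow> P 0 \<and> P 1 \<and> P 2 \<and> P 3 \<and> P 4 \<and> P (5::nat)"
proof -
  have "[0..<6] = [0, 1, 2, 3, 4, 5::nat]" by (simp add: upt_rec)
  moreover have "(\<forall>i<6. P i) \<longleftrightarrow> (\<forall>i\<in>set [0..<6]. P i)" by auto
  ultimately show ?thesis by simp
qed

locale rooted_graph =
  fixes G :: "'a pair_pre_digraph" and u v :: 'a
  assumes graph: "pair_graph G"
    and three_connected: "k_connected 3 G"
    and card_ge_6: "6 \<le> card (pverts G)"
    and root: "(u, v) \<in> parcs G"
begin

abbreviation "V \<equiv> pverts G"
abbreviation "E \<equiv> parcs G"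

lemma fin [simp]: "finite V" "finite E"
  using graph by (auto simp: pair_graph_def pair_pseudo_graph_def pair_fin_digraph_def pair_fin_digraph_axioms_def)

lemma finite_sub: "S \<subseteq> V \<Longrightarrow> finite S"
  using fin(1) finite_subset by blast

lemma symE: "sym E"
  using graph pair_sym_digraph.pair_sym_arcs[of G] by (auto simp: pair_graph_def pair_pseudo_graph_def symmetric_def)

lemma E_sym: "(x, y) \<in> E \<Longrightarrow> (y, x) \<in> E"
  using symE by (rule symD)

lemma E_irrefl [simp]: "(x, x) \<notin> E"
  using graph pair_loopfree_digraph.pair_no_loops[of G "(x, x)"] by (auto simp: pair_graph_def pair_digraph_def)

lemma E_neq: "(x, y) \<in> E \<Longrightarrow> x \<noteq> y"
  by auto

lemma E_verts: "(x, y) \<in> E \<Longrightarrow> x \<in> V" "(x, y) \<in> E \<Longrightarrow> y \<in> V"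
  using graph pair_wf_digraph.in_arcsD1[of G] pair_wf_digraph.in_arcsD2[of G]
  by (auto simp: pair_graph_def pair_digraph_def pair_loopfree_digraph_def)

lemma joined_commute: "joined E A B \<longleftrightarrow> joined E B A"
  using joined_sym[OF symE] .

lemma uv: "u \<in> V" "v \<in> V" "u \<noteq> v" "(v, u) \<in> E"
  using root E_verts E_sym E_neq by auto

text \<open>The one place where 3-connectivity is unfolded. \<open>F\<close> need not consist of
  vertices, hence the detour through \<open>F \<inter> V\<close>; \<open>y\<close> witnesses that
  something remains on the other side.\<close>

lemma joined_outside:
  assumes "S \<subseteq> V" "S \<noteq> {}" "S \<inter> F = {}" "finite F" "card F < 3" "y \<in> V" "y \<notin> S" "y \<notin> F"
  shows "joined E S (V - S - F)"
proof -
  have "card (F \<inter> V) \<le> card F" using assms(4) by (intro card_mono) auto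
  then have "\<not> vertex_cut G (F \<inter> V)" using three_connected assms(5) by (auto simp: k_connected_def)
  moreover have "V - F \<inter> V = V - F" by auto
  ultimately have "conn E (V - F)"
    using assms connected_iff_conn[OF graph] by (auto simp: vertex_cut_def del_verts_def)
  then have "joined E S (V - F - S)" using assms by (intro conn_joined) auto
  then show ?thesis by (rule joined_mono) auto
qed

lemma ex_neighbour:
  assumes "x \<in> V" "finite F" "card F < 3" "x \<notin> F"
  obtains y where "(x, y) \<in> E" "y \<notin> F"
proof -
  have "\<not> V \<subseteq> insert x F"
    using card_mono[of "insert x F" V] assms card_ge_6 by (auto simp: card_insert_if)
  then obtain z where "z \<in> V" "z \<notin> {x}" "z \<notin> F" by auto
  then have "joined E {x} (V - {x} - F)" using joined_outside[of "{x}" F z] assms by auto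
  then show ?thesis using that by (auto simp: joined_def)
qed

text \<open>Up to symmetry of the prism, the root edge is either the triangle edge from 0 to 1 or
  the matching edge from 0 to 3.\<close>

lemma prismI:
  fixes B :: "nat \<Rightarrow> 'a set"
  assumes B: "\<forall>i<6. B i \<subseteq> V \<and> conn E (B i)"
    and D: "\<forall>i<6. \<forall>j<6. i \<noteq> j \<longrightarrow> B i \<inter> B j = {}"
    and J: "joined E (B 0) (B 1)" "joined E (B 1) (B 2)" "joined E (B 0) (B 2)"
      "joined E (B 3) (B 4)" "joined E (B 4) (B 5)" "joined E (B 3) (B 5)"
      "joined E (B 0) (B 3)" "joined E (B 1) (B 4)" "joined E (B 2) (B 5)"
    and r: "u \<in> B 0" "v \<in> B 1 \<or> v \<in> B 3"
  shows "has_minor_using prism G u v"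
proof -
  have "minor_model prism G B"
    unfolding minor_model_def
  proof (intro conjI)
    show "\<forall>x\<in>pverts prism. B x \<subseteq> V \<and> connected (with_proj G \<restriction> B x)"
      using B connected_iff_conn[OF graph] by (auto simp: prism_def)
    show "\<forall>x\<in>pverts prism. \<forall>y\<in>pverts prism. x \<noteq> y \<longrightarrow> B x \<inter> B y = {}"
      using D by (auto simp: prism_def)
    have "joined E (B x) (B y)" if "(x, y) \<in> parcs prism" for x y
      using that J joined_commute by (auto simp: prism_def symcl_def)
    then show "\<forall>(x, y)\<in>parcs prism. \<exists>a\<in>B x. \<exists>b\<in>B y. (a, b) \<in> E"
      by (auto simp: joined_def)
  qed
  moreover have "(0, 1) \<in> parcs prism" "(0, 3) \<in> parcs prism" by (auto simp: prism_def symcl_def)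
  ultimately show ?thesis unfolding has_minor_using_def using r by blast
qed

text \<open>The shape of all explicitly constructed prisms: triangles \<open>B0\<close>,
  \<open>B1\<close>, \<open>B2\<close> and \<open>B3\<close>, \<open>B4\<close>, \<open>B5\<close>,
  with the root edge itself as the matching edge between \<open>B0\<close> and
  \<open>B3\<close>.\<close>

lemma prism_matching:
  assumes c: "conn E B0" "conn E B1" "conn E B2" "conn E B3" "conn E B4" "conn E B5"
    and s: "B0 \<union> B1 \<union> B2 \<union> B3 \<union> B4 \<union> B5 \<subseteq> V"
    and d: "B0 \<inter> (B1 \<union> B2 \<union> B3 \<union> B4 \<union> B5) = {}" "B1 \<inter> (B2 \<union> B3 \<union> B4 \<union> B5) = {}"
      "B2 \<inter> (B3 \<union> B4 \<union> B5) = {}" "B3 \<inter> (B4 \<union> B5) = {}" "B4 \<inter> B5 = {}"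
    and r: "u \<in> B0" "v \<in> B3"
    and j: "joined E B0 B1" "joined E B0 B2" "joined E B1 B2" "joined E B3 B4" "joined E B3 B5" "joined E B4 B5"
      "joined E B1 B4" "joined E B2 B5"
  shows "has_minor_using prism G u v"
proof (rule prismI[of "\<lambda>i. [B0, B1, B2, B3, B4, B5] ! i"])
  have "joined E B0 B3" using r root by (auto intro: joinedI)
  then show "joined E ([B0, B1, B2, B3, B4, B5] ! 0) ([B0, B1, B2, B3, B4, B5] ! 3)" by simp
  show "\<forall>i<6. [B0, B1, B2, B3, B4, B5] ! i \<subseteq> V \<and> conn E ([B0, B1, B2, B3, B4, B5] ! i)"
    using c s by (auto simp: all_less_6)
  show "\<forall>i<6. \<forall>j<6. i \<noteq> j \<longrightarrow> [B0, B1, B2, B3, B4, B5] ! i \<inter> [B0, B1, B2, B3, B4, B5] ! j = {}"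
    using d unfolding all_less_6 Int_Un_distrib Un_empty by (simp add: disjoint_iff) blast
qed (use j r in simp_all)

definition linking :: "'a set \<Rightarrow> bool" where
  "linking K \<longleftrightarrow> K \<subseteq> V - {u, v} \<and> conn E K \<and> joined E {u} K \<and> joined E {v} K"

text \<open>
  By Menger's theorem three disjoint connected sets link a cycle through \<open>uv\<close> to a cycle
  disjoint from it; cut the first cycle so that \<open>u\<close> and \<open>v\<close> fall into different pieces.
\<close>

lemma prism_cycle:
  assumes K: "linking K" and cyc: "has_cycle E (V - {u, v} - K)"
  shows "has_minor_using prism G u v"
proof -
  obtain a b where ab: "a \<in> K" "b \<in> K" "(u, a) \<in> E" "(b, v) \<in> E"
    using K E_sym by (auto simp: linking_def joined_def)
  have KV: "K \<subseteq> V - {u, v}" and cK: "conn E K" using K by (auto simp: linking_def)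
  obtain ks where ks: "is_path E ks" "hd ks = a" "last ks = b" "set ks \<subseteq> K"
    using conn_path[OF cK ab(1,2)] by blast
  define cs where "cs = u # ks @ [v]"
  have ne: "ks \<noteq> []" using ks by (auto simp: is_path_def)
  have "is_path E (ks @ [v])" using ks ne ab KV by (subst is_path_append) (auto simp: is_path_def)
  then have cs: "is_path E cs" unfolding cs_def using ks ne ab KV uv by (subst is_path_Cons) (auto simp: hd_append)
  have csV: "set cs \<subseteq> V" using ks KV uv by (auto simp: cs_def)
  obtain ds where ds: "is_cycle E ds" "set ds \<subseteq> V - {u, v} - K" using cyc by (auto simp: has_cycle_def)
  have dsp: "is_path E ds" "(last ds, hd ds) \<in> E" using ds by (auto simp: is_cycle_def)
  have disj: "set cs \<inter> set ds = {}" using ds(2) ks by (auto simp: cs_def)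
  have lens: "card (set cs) \<ge> 3" "card (set ds) \<ge> 3"
    using cs ds ne by (auto simp: is_cycle_def is_path_def distinct_card cs_def Suc_le_eq)
  \<comment> \<open>Fewer than three vertices neither cover one of the cycles nor disconnect
    \<open>G\<close>, so \<open>V - Y\<close> is a connection.\<close>
  have lnk: "\<forall>Y. finite Y \<longrightarrow> card Y < 3 \<longrightarrow>
    (\<exists>Z. finite Z \<and> conn E Z \<and> Z \<inter> Y = {} \<and> Z \<inter> set cs \<noteq> {} \<and> Z \<inter> set ds \<noteq> {})"
  proof (intro allI impI)
    fix Y :: "'a set" assume Y: "finite Y" "card Y < 3"
    have "card (set cs) > card Y" "card (set ds) > card Y" using Y lens by auto
    then have "\<not> set cs \<subseteq> Y" "\<not> set ds \<subseteq> Y" using Y card_mono by (metis not_le)+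
    then obtain x y where xy: "x \<in> set cs" "x \<notin> Y" "y \<in> set ds" "y \<notin> Y" by blast
    have "conn E (V - Y)"
      unfolding conn_def
    proof (intro conjI allI impI)
      show "V - Y \<noteq> {}" using xy csV by auto
      fix A assume "A \<subseteq> V - Y" "A \<noteq> {}" "A \<noteq> V - Y"
      moreover then obtain z where "z \<in> V - Y" "z \<notin> A" by blast
      ultimately have "joined E A (V - A - Y)" using Y by (intro joined_outside) auto
      then show "joined E A (V - Y - A)" by (rule joined_mono) auto
    qed
    then show "\<exists>Z. finite Z \<and> conn E Z \<and> Z \<inter> Y = {} \<and> Z \<inter> set cs \<noteq> {} \<and> Z \<inter> set ds \<noteq> {}"
      using xy csV ds(2) by (intro exI[of _ "V - Y"]) auto
  qed
  have "irrefl E" by (auto simp: irrefl_def)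
  from menger_conn[OF fin(2) symE this finite_set finite_set zero_less_numeral lnk]
  obtain f :: "nat \<Rightarrow> 'a set" where f:
    "\<forall>i<3. finite (f i) \<and> conn E (f i) \<and> f i \<inter> set cs \<noteq> {} \<and> f i \<inter> set ds \<noteq> {}"
    "\<forall>i<3. \<forall>j<3. i \<noteq> j \<longrightarrow> f i \<inter> f j = {}"
    by (elim exE conjE)
  have "\<forall>i<3. \<exists>Z a b. Z \<subseteq> f i \<and> conn E Z \<and> Z \<inter> set cs = {a} \<and> Z \<inter> set ds = {b}"
    using f(1) ex_linking_subset[OF _ symE] by metis
  then obtain Z' and c d :: "nat \<Rightarrow> 'a" where Z': "\<And>i. i < 3 \<Longrightarrow> Z' i \<subseteq> f i \<and> conn E (Z' i) \<and> Z' i \<inter> set cs = {c i} \<and> Z' i \<inter> set ds = {d i}"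
    by metis
  \<comment> \<open>Drop the end on the second cycle and keep the component of \<open>c i\<close>;
    it is still adjacent to \<open>d i\<close>, so the connector can be absorbed into the first
    cycle's side.\<close>
  have "\<exists>Z. Z \<subseteq> Z' i - {d i} \<and> conn E Z \<and> c i \<in> Z \<and> joined E Z {d i}" if "i < 3" for i
  proof -
    have *: "finite (Z' i - {d i})" "c i \<in> Z' i - {d i}" "d i \<in> Z' i"
      using f(1) Z'[OF that] disj that by (auto intro: finite_subset)
    obtain Z where Z: "c i \<in> Z" "Z \<subseteq> Z' i - {d i}" "conn E Z" "\<not> joined E Z (Z' i - {d i} - Z)"
      using ex_component[OF *(1,2) symE] by blast
    have "joined E Z (Z' i - Z)" using Z *(3) Z'[OF that] by (intro conn_joined) auto
    then have "joined E Z {d i}" using Z(4) by (auto simp: joined_def)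
    then show ?thesis using Z by blast
  qed
  then obtain Z where Z: "\<And>i. i < 3 \<Longrightarrow> Z i \<subseteq> Z' i - {d i} \<and> conn E (Z i) \<and> c i \<in> Z i \<and> joined E (Z i) {d i}"
    by metis
  have Zcd: "Z i \<inter> set cs = {c i}" "Z i \<inter> set ds = {}" if "i < 3" for i
    using Z[OF that] Z'[OF that] by blast+
  have Z'd: "Z' i \<inter> Z' j = {}" if "i < 3" "j < 3" "i \<noteq> j" for i j
    using f(2) Z' that by blast
  have Zd: "Z i \<inter> Z j = {}" if "i < 3" "j < 3" "i \<noteq> j" for i j
    using Z'd Z that by blast
  have cne: "c i \<noteq> c j" "d i \<noteq> d j" if "i < 3" "j < 3" "i \<noteq> j" for i j
    using Z'd Z' that by blast+
  have inj: "inj_on c {..<3}" "inj_on d {..<3}"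
    using cne by (auto intro!: inj_onI)
  define C where "C = c ` {..<3}"
  define D where "D = d ` {..<3}"
  have CD: "card C = 3" "card D = 3" "C \<subseteq> set cs" "D \<subseteq> set ds"
    using inj Z' by (auto simp: C_def D_def card_image)
  have hl: "hd cs = u" "last cs = v" by (simp_all add: cs_def)
  then have "(last cs, hd cs) \<in> E" using uv by simp
  from is_path_partition[OF cs CD(3,1) symE this, unfolded hl] obtain X where
    X: "\<And>f. f \<in> C \<Longrightarrow> conn E (X f) \<and> f \<in> X f \<and> X f \<subseteq> set cs"
      "\<And>f g. f \<in> C \<Longrightarrow> g \<in> C \<Longrightarrow> f \<noteq> g \<Longrightarrow> X f \<inter> X g = {} \<and> joined E (X f) (X g)"
      "\<exists>f\<in>C. \<exists>g\<in>C. f \<noteq> g \<and> u \<in> X f \<and> v \<in> X g" by metis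
  from is_path_partition[OF dsp(1) CD(4,2) symE dsp(2)] obtain Y where
    Y: "\<And>f. f \<in> D \<Longrightarrow> conn E (Y f) \<and> f \<in> Y f \<and> Y f \<subseteq> set ds"
      "\<And>f g. f \<in> D \<Longrightarrow> g \<in> D \<Longrightarrow> f \<noteq> g \<Longrightarrow> Y f \<inter> Y g = {} \<and> joined E (Y f) (Y g)" by metis
  obtain i j where ij: "i < 3" "j < 3" "c i \<noteq> c j" "u \<in> X (c i)" "v \<in> X (c j)"
    using X(3) by (auto simp: C_def)
  then have nij: "i \<noteq> j" by auto
  obtain k where k: "k < 3" "k \<noteq> i" "k \<noteq> j"
  proof -
    have "{..<3::nat} - {i, j} \<noteq> {}"
    proof
      assume "{..<3::nat} - {i, j} = {}"
      then have "{..<3} \<subseteq> {i, j}" by blast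
      from card_mono[OF _ this] show False by (simp add: card_insert_if split: if_splits)
    qed
    then show ?thesis using that by blast
  qed
  define A where "A n = X (c n) \<union> Z n" for n
  define B where "B n = Y (d n)" for n
  have cm: "c n \<in> C" "d n \<in> D" if "n < 3" for n using that by (auto simp: C_def D_def)
  have A: "A n \<subseteq> V - set ds" "conn E (A n)" "joined E (A n) (B n)" if "n < 3" for n
  proof -
    \<comment> \<open>The Menger sets are not known to consist of vertices; but a connected set is a
      singleton, here on the first cycle, or all its elements are ends of edges.\<close>
    have "Z n \<subseteq> V"
    proof
      fix z assume z: "z \<in> Z n"
      show "z \<in> V"
      proof (cases "Z n = {z}")
        case True
        then have "z = c n" using Z[OF that] by auto
        moreover have "c n \<in> set cs" using Z'[OF that] by auto
        ultimately show ?thesis using csV by auto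
      next
        case False
        then have "joined E {z} (Z n - {z})" using Z[OF that] z by (intro conn_joined) auto
        then show ?thesis using E_verts by (auto simp: joined_def)
      qed
    qed
    moreover have "X (c n) \<subseteq> set cs" using X(1)[OF cm(1)[OF that]] by simp
    ultimately show "A n \<subseteq> V - set ds"
      using Zcd(2)[OF that] csV disj by (auto simp: A_def)
    show "conn E (A n)"
      unfolding A_def using X(1)[OF cm(1)[OF that]] Z[OF that] by (intro conn_Un[OF symE]) auto
    show "joined E (A n) (B n)"
      using Z[OF that] Y(1)[OF cm(2)[OF that]] joined_mono[of E "Z n" "{d n}" "A n" "B n"] by (auto simp: A_def B_def)
  qed
  have B: "B n \<subseteq> set ds" "conn E (B n)" if "n < 3" for n
    using Y(1)[OF cm(2)[OF that]] by (auto simp: B_def)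
  have AA: "A m \<inter> A n = {}" "joined E (A m) (A n)" if "m < 3" "n < 3" "m \<noteq> n" for m n
  proof -
    note * = X(2)[OF cm(1)[OF that(1)] cm(1)[OF that(2)] cne(1)[OF that]]
    have zx: "Z n' \<inter> X (c m') = {}" if mn: "m' < 3" "n' < 3" "m' \<noteq> n'" for m' n'
    proof -
      have "Z n' \<inter> X (c m') \<subseteq> Z n' \<inter> set cs" using X(1)[OF cm(1)[OF mn(1)]] by auto
      then have "Z n' \<inter> X (c m') \<subseteq> {c n'}" using Zcd(1)[OF mn(2)] by simp
      moreover have "c n' \<notin> X (c m')"
        using X(2)[OF cm(1)[OF mn(1)] cm(1)[OF mn(2)] cne(1)[OF mn]] X(1)[OF cm(1)[OF mn(2)]] by auto
      ultimately show ?thesis by auto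
    qed
    show "A m \<inter> A n = {}"
      using * Zd[OF that] zx[OF that] zx[OF that(2,1) that(3)[symmetric]] by (auto simp: A_def)
    show "joined E (A m) (A n)" using * joined_mono[of E "X (c m)" "X (c n)"] by (auto simp: A_def)
  qed
  have BB: "B m \<inter> B n = {}" "joined E (B m) (B n)" if "m < 3" "n < 3" "m \<noteq> n" for m n
    using Y(2)[OF cm(2)[OF that(1)] cm(2)[OF that(2)] cne(2)[OF that]] by (auto simp: B_def)
  have AB: "A m \<inter> B n = {}" if "m < 3" "n < 3" for m n using A(1)[OF that(1)] B(1)[OF that(2)] by auto
  then have BA: "B n \<inter> A m = {}" if "m < 3" "n < 3" for m n using that by (metis Int_commute)
  \<comment> \<open>The indices \<open>i\<close> and \<open>j\<close> are those of the arcs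
    containing \<open>u\<close> and \<open>v\<close>, so the root edge becomes a triangle
    edge.\<close>
  define Bs where "Bs n = [A i, A j, A k, B i, B j, B k] ! n" for n
  have Bs: "Bs 0 = A i" "Bs 1 = A j" "Bs 2 = A k" "Bs 3 = B i" "Bs 4 = B j" "Bs 5 = B k"
    by (simp_all add: Bs_def)
  show ?thesis
  proof (rule prismI[of Bs])
    show "\<forall>i<6. Bs i \<subseteq> V \<and> conn E (Bs i)"
      unfolding all_less_6 Bs
      using A(1,2)[OF ij(1)] A(1,2)[OF ij(2)] A(1,2)[OF k(1)] B[OF ij(1)] B[OF ij(2)] B[OF k(1)] ds(2) by auto
    show "\<forall>i<6. \<forall>j<6. i \<noteq> j \<longrightarrow> Bs i \<inter> Bs j = {}"
      unfolding all_less_6 Bs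
      by (simp add: AA(1) BB(1) AB BA ij(1,2) k nij nij[symmetric] k(2,3)[symmetric])
    show "u \<in> Bs 0" "v \<in> Bs 1 \<or> v \<in> Bs 3" unfolding Bs A_def using ij(4,5) by auto
  qed (unfold Bs, fact AA(2)[OF ij(1,2) nij], fact AA(2)[OF ij(2) k(1) k(3)[symmetric]],
      fact AA(2)[OF ij(1) k(1) k(2)[symmetric]], fact BB(2)[OF ij(1,2) nij],
      fact BB(2)[OF ij(2) k(1) k(3)[symmetric]], fact BB(2)[OF ij(1) k(1) k(2)[symmetric]],
      fact A(3)[OF ij(1)], fact A(3)[OF ij(2)], fact A(3)[OF k(1)])
qed

end

section \<open>A cycle through the root edge with connected complement\<close>

lemma is_path_appendD:
  "is_path R (xs @ ys) \<Longrightarrow> xs \<noteq> [] \<Longrightarrow> is_path R xs"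
  "is_path R (xs @ ys) \<Longrightarrow> ys \<noteq> [] \<Longrightarrow> is_path R ys"
  by (auto simp: is_path_def successively_append_iff)

context rooted_graph
begin

lemma ex_third_neighbour:
  assumes "x \<in> V" "x \<noteq> a" "x \<noteq> b"
  obtains y where "(x, y) \<in> E" "y \<noteq> a" "y \<noteq> b"
proof -
  have "card {a, b} < 3" by (simp add: card_insert_if)
  then show ?thesis using ex_neighbour[of x "{a, b}"] assms that by auto
qed

lemma path_linking:
  assumes "is_path E ks" "set ks \<subseteq> V - {u, v}" "(u, hd ks) \<in> E" "(last ks, v) \<in> E"
  shows "linking (set ks)"
proof -
  have "ks \<noteq> []" using assms by (auto simp: is_path_def)
  then have "joined E {u} (set ks)" "joined E {v} (set ks)"
    using assms(3) E_sym[OF assms(4)] joinedI[of u "{u}" "hd ks"] joinedI[of v "{v}" "last ks"] by auto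
  then show ?thesis using assms(2) is_path_conn[OF symE assms(1)] by (simp add: linking_def)
qed

text \<open>Spare some \<open>w\<close> and take the component of a neighbour of \<open>u\<close> in
  \<open>V - {u, v, w}\<close>. It must see \<open>v\<close>, as \<open>{u, w}\<close> cannot
  separate it from \<open>v\<close>.\<close>

lemma ex_linking:
  obtains K y where "linking K" "y \<in> V - {u, v} - K"
proof -
  obtain x where x: "(u, x) \<in> E" "x \<notin> {v}" using ex_neighbour[of u "{v}"] uv by auto
  have "\<not> V \<subseteq> {u, v, x}"
    using card_mono[of "{u, v, x}" V] card_ge_6 by (auto simp: card_insert_if split: if_splits)
  then obtain w where w: "w \<in> V" "w \<notin> {u, v, x}" by auto
  have "x \<in> V - {u, v, w}" using x w E_verts E_neq by auto
  then obtain K where K: "x \<in> K" "K \<subseteq> V - {u, v, w}" "conn E K" "\<not> joined E K (V - {u, v, w} - K)"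
    using ex_component[of "V - {u, v, w}" x E] symE by auto
  have "joined E K (V - K - {u, w})"
    using K w uv by (intro joined_outside[of K "{u, w}" v]) (auto simp: card_insert_if)
  then have "joined E K {v}" using K(4) by (auto simp: joined_def)
  then have "joined E {v} K" by (simp only: joined_commute)
  moreover have "joined E {u} K" using x K by (auto intro: joinedI)
  ultimately have "linking K" using K by (auto simp: linking_def)
  then show ?thesis using that[of K w] w K by auto
qed

lemma ex_max_linking:
  obtains K Y where "linking K" "conn E Y" "Y \<subseteq> V - {u, v} - K"
    "\<forall>K' Y'. linking K' \<longrightarrow> conn E Y' \<longrightarrow> Y' \<subseteq> V - {u, v} - K' \<longrightarrow> card Y' \<le> card Y"
proof -
  let ?P = "\<lambda>Y. \<exists>K. linking K \<and> conn E Y \<and> Y \<subseteq> V - {u, v} - K"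
  obtain K y where "linking K" "y \<in> V - {u, v} - K" by (rule ex_linking)
  then have 1: "?P {y}" using conn_singleton by (intro exI[of _ K]) auto
  \<comment> \<open>The maximum principle used next asks for a strict bound, hence the
    successor.\<close>
  have "\<forall>Y. ?P Y \<longrightarrow> card Y < Suc (card V)"
  proof (intro allI impI)
    fix Y assume "?P Y"
    then have "card Y \<le> card V" by (intro card_mono) auto
    then show "card Y < Suc (card V)" by simp
  qed
  from ex_has_greatest_nat[of ?P "{y}" card "Suc (card V)", OF 1 this]
  obtain Y where Y: "?P Y \<and> (\<forall>Y'. ?P Y' \<longrightarrow> card Y' \<le> card Y)" ..
  from conjunct1[OF Y] obtain K where "linking K" "conn E Y" "Y \<subseteq> V - {u, v} - K" by (elim exE conjE)
  moreover have "\<forall>K' Y'. linking K' \<longrightarrow> conn E Y' \<longrightarrow> Y' \<subseteq> V - {u, v} - K' \<longrightarrow> card Y' \<le> card Y"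
    using conjunct2[OF Y] by blast
  ultimately show ?thesis by (rule that)
qed

text \<open>A detour through \<open>S\<close> replaces the middle part \<open>M\<close>. The initial
  and final parts lose \<open>u\<close> and \<open>v\<close> and may thereby become empty, which
  causes the case distinctions.\<close>

lemma reroute:
  assumes p: "is_path E (P @ M @ Q)" and ne: "P \<noteq> []" "Q \<noteq> []" and ends: "hd P = u" "last Q = v"
    and V: "set P \<union> set Q \<subseteq> V"
    and S: "conn E S" "S \<subseteq> V - {u, v}" "joined E S {last P}" "joined E S {hd Q}"
  shows "linking (S \<union> (set P - {u}) \<union> (set Q - {v}))"
proof -
  have d: "distinct P" "distinct Q" "set P \<inter> set Q = {}" using p by (auto simp: is_path_def)
  obtain P' where P': "P = u # P'" using ne ends by (cases P) auto
  obtain Q' where Q': "Q = Q' @ [v]" using ne ends by (cases Q rule: rev_cases) auto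
  have sets: "set P - {u} = set P'" "set Q - {v} = set Q'" using d P' Q' by auto
  have pP: "is_path E P" "is_path E Q"
    using p ne by (auto simp: is_path_def successively_append_iff)
  have "conn E (S \<union> set P') \<and> joined E {u} (S \<union> set P')"
  proof (cases "P' = []")
    case True
    then show ?thesis using S P' by (simp add: joined_commute[of "{u}"])
  next
    case False
    then have "is_path E P'" "(u, hd P') \<in> E" "last P = last P'" using pP P' by (auto simp: is_path_Cons)
    moreover then have "joined E S (set P')" using S(3) False joined_mono[of E S "{last P}" S "set P'"] by simp
    moreover have "joined E {u} (set P')"
      using \<open>(u, hd P') \<in> E\<close> False joinedI[of u "{u}" "hd P'"] by simp
    ultimately show ?thesis using conn_Un[OF symE S(1) is_path_conn[OF symE]] by simp
  qed
  then have 1: "conn E (S \<union> set P')" "joined E {u} (S \<union> set P')" by auto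
  have "conn E (S \<union> set P' \<union> set Q') \<and> joined E {v} (S \<union> set P' \<union> set Q')"
  proof (cases "Q' = []")
    case True
    then show ?thesis using S Q' 1 by (simp add: joined_commute[of "{v}"])
  next
    case False
    then have *: "is_path E Q'" "(last Q', v) \<in> E" "hd Q = hd Q'"
      using pP Q' by (auto simp: is_path_append)
    have "joined E S (set Q')" using S(4) False * joined_mono[of E S "{hd Q}" S "set Q'"] by simp
    moreover have "joined E {v} (set Q')"
      using E_sym[OF *(2)] False joinedI[of v "{v}" "last Q'"] by simp
    ultimately show ?thesis using conn_Un[OF symE 1(1) is_path_conn[OF symE *(1)]] by simp
  qed
  moreover have "set P' \<union> set Q' \<subseteq> V - {u, v}" using d V P' Q' by auto
  ultimately show ?thesis using 1 S sets by (auto simp: linking_def)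
qed

end

text \<open>The cycle consists of \<open>u\<close>, \<open>xs\<close>, \<open>v\<close> and the root
  edge; the three chord conditions together say that it is induced. Maximality of \<open>T\<close>
  is kept with respect to every linking set, so that later exchanges need not exhibit a
  cycle.\<close>

locale cycle_and_rest = rooted_graph +
  fixes xs :: "'a list" and T :: "'a set"
  assumes path: "is_path E (u # xs @ [v])"
    and nonempty: "xs \<noteq> []"
    and verts_eq: "V = T \<union> set (u # xs @ [v])"
    and disjoint: "T \<inter> set (u # xs @ [v]) = {}"
    and conn_T: "conn E T"
    and joined_T: "\<And>c. c \<in> set (u # xs @ [v]) \<Longrightarrow> joined E {c} T"
    and chord: "\<And>p a q b r. xs = p @ a # q @ b # r \<Longrightarrow> (a, b) \<in> E \<Longrightarrow> q = []"
    and chord_u: "\<And>p b r. xs = p @ b # r \<Longrightarrow> (u, b) \<in> E \<Longrightarrow> p = []"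
    and chord_v: "\<And>p b r. xs = p @ b # r \<Longrightarrow> (v, b) \<in> E \<Longrightarrow> r = []"
    and max_T: "\<And>K Y. linking K \<Longrightarrow> conn E Y \<Longrightarrow> Y \<subseteq> V - {u, v} - K \<Longrightarrow> card Y \<le> card T"

text \<open>
  If \<open>Y\<close> is a largest connected set avoiding some connection of \<open>u\<close> and \<open>v\<close>, then every connection
  avoiding \<open>Y\<close> uses all attachments of \<open>Y\<close>. Hence a component of the rest attaches to at most two
  vertices, which contradicts 3-connectivity.
\<close>

lemma (in rooted_graph) ex_cycle_and_rest:
  obtains xs T where "cycle_and_rest G u v xs T"
proof -
  obtain K Y where KY: "linking K" "conn E Y" "Y \<subseteq> V - {u, v} - K"
    and max: "\<forall>K' Y'. linking K' \<longrightarrow> conn E Y' \<longrightarrow> Y' \<subseteq> V - {u, v} - K' \<longrightarrow> card Y' \<le> card Y"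
    by (rule ex_max_linking)
  obtain a b where ab: "a \<in> K" "b \<in> K" "(u, a) \<in> E" "(b, v) \<in> E"
    using KY(1) E_sym by (auto simp: linking_def joined_def)
  have KV: "K \<subseteq> V - {u, v}" and cK: "conn E K" using KY(1) by (auto simp: linking_def)
  obtain xs where xs: "is_path E xs" "hd xs = a" "last xs = b" "set xs \<subseteq> K"
    using conn_path[OF cK ab(1,2)] by blast
  have ne: "xs \<noteq> []" using xs by (auto simp: is_path_def)
  have "is_path E (xs @ [v])" using xs ne ab KV by (subst is_path_append) (auto simp: is_path_def)
  then have cs: "is_path E (u # xs @ [v])"
    using xs ne ab KV uv by (subst is_path_Cons) (auto simp: hd_append)
  define F where "F = {f \<in> V - {u, v} - Y. joined E Y {f}}"
  \<comment> \<open>An attachment missed by \<open>K'\<close> could be added to \<open>Y\<close>,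
    against maximality.\<close>
  have through: "F \<subseteq> K'" if "linking K'" "K' \<inter> Y = {}" for K'
  proof
    fix f assume f: "f \<in> F"
    show "f \<in> K'"
    proof (rule ccontr)
      assume "f \<notin> K'"
      then have "card (insert f Y) \<le> card Y"
        using f KY that conn_insert[OF symE KY(2)] by (intro max[rule_format, OF that(1)]) (auto simp: F_def)
      moreover have "finite Y" "f \<notin> Y" using KY(3) finite_sub[of Y] f by (auto simp: F_def)
      ultimately show False by simp
    qed
  qed
  have "linking (set xs)" using xs ab KV by (intro path_linking) auto
  then have Fxs: "F \<subseteq> set xs" using through xs KY by blast
  have rest: "V - {u, v} - Y \<subseteq> F"
  proof (rule ccontr)
    let ?X = "V - {u, v} - Y - F"
    assume "\<not> V - {u, v} - Y \<subseteq> F"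
    then obtain z where "z \<in> ?X" by blast
    then obtain S where S: "z \<in> S" "S \<subseteq> ?X" "conn E S" "\<not> joined E S (?X - S)"
      using ex_component[of ?X z E] symE by auto
    have SY: "\<not> joined E S Y" using S(2) by (auto simp: F_def joined_def dest: E_sym)
    define N where "N = {c \<in> F \<union> {u, v}. joined E S {c}}"
    have Ncs: "N \<subseteq> set (u # xs @ [v])" using Fxs by (auto simp: N_def)
    have "\<not> card N < 3"
    proof
      assume "card N < 3"
      moreover obtain y where "y \<in> Y" using KY(2) conn_nonempty by blast
      ultimately have "joined E S (V - S - N)"
        using S KY(3) Ncs finite_subset[OF Ncs] Fxs xs(4) by (intro joined_outside[of S N y]) (auto simp: N_def)
      then obtain s c where "s \<in> S" "c \<in> V" "c \<notin> S" "c \<notin> N" "(s, c) \<in> E" by (auto simp: joined_def)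
      then show False using S(4) SY by (auto simp: N_def joined_def)
    qed
    then obtain N' where N': "N' \<subseteq> N" "card N' = 3"
      by (meson not_less obtain_subset_with_card_n)
    then have "N' \<subseteq> set (u # xs @ [v])" using Ncs by blast
    \<comment> \<open>Of three neighbours of \<open>S\<close> on the cycle, the middle one
      \<open>b'\<close> is bypassed by a detour from \<open>a'\<close> through \<open>S\<close> to
      \<open>c'\<close>. It is an inner vertex, hence an attachment of \<open>Y\<close> that the new
      connection misses.\<close>
    from is_path_split_three[OF cs this N'(2)] obtain p q r a' b' c' where
      pqr: "u # xs @ [v] = p @ q @ r" "N' = {a', b', c'}" "a' \<in> set p" "b' \<in> set q" "c' \<in> set r" by metis
    obtain p1 p2 where p: "p = (p1 @ [a']) @ p2" using pqr(3) by (metis append.assoc append_Cons append_Nil split_list)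
    obtain r1 r2 where r: "r = r1 @ c' # r2" using pqr(5) by (meson split_list)
    let ?P = "p1 @ [a']" and ?M = "p2 @ q @ r1" and ?Q = "c' # r2"
    have eq: "u # xs @ [v] = ?P @ ?M @ ?Q" using pqr(1) p r by simp
    have hl: "hd ?P = u" "last ?Q = v"
      using arg_cong[OF eq, of hd] arg_cong[OF eq, of last] by (simp_all add: hd_append)
    have d: "distinct (?P @ ?M @ ?Q)" using cs eq by (simp add: is_path_def)
    have "set (?P @ ?M @ ?Q) \<subseteq> V" using xs KV uv unfolding eq[symmetric] by auto
    then have "linking (S \<union> (set ?P - {u}) \<union> (set ?Q - {v}))"
      using S N' pqr(2) hl by (intro reroute[OF cs[unfolded eq]]) (auto simp: N_def)
    moreover have "(S \<union> (set ?P - {u}) \<union> (set ?Q - {v})) \<inter> Y = {}"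
    proof -
      have "set (u # xs @ [v]) - {u, v} \<subseteq> K" using xs by auto
      then have "set ?P - {u, v} \<subseteq> K" "set ?Q - {u, v} \<subseteq> K" unfolding eq by auto
      moreover have "u \<notin> Y" "v \<notin> Y" "Y \<inter> K = {}" using KY(3) by auto
      ultimately show ?thesis using S(2) by blast
    qed
    ultimately have "F \<subseteq> S \<union> (set ?P - {u}) \<union> (set ?Q - {v})" using through by blast
    moreover have "b' \<notin> set ?P" "b' \<notin> set ?Q" using d pqr(4) by auto
    moreover have "b' \<noteq> u" "b' \<noteq> v"
      using \<open>b' \<notin> set ?P\<close> \<open>b' \<notin> set ?Q\<close> hl by (metis hd_in_set append_is_Nil_conv not_Cons_self2, metis last_in_set list.distinct(1))
    moreover have "b' \<in> F \<union> {u, v}" using N' pqr(2) by (auto simp: N_def)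
    ultimately show False using S(2) by blast
  qed
  have "set xs \<subseteq> V - {u, v} - Y" using xs(4) KY(3) KV by blast
  moreover have "F \<subseteq> V - {u, v} - Y" by (auto simp: F_def)
  ultimately have F: "F = set xs" "F = V - {u, v} - Y" using Fxs rest by blast+
  \<comment> \<open>No connection uses fewer vertices of the path. Each chord would give a shortcut,
    so the cycle is induced.\<close>
  have sub: "set xs \<subseteq> K'" if "linking K'" "K' \<subseteq> set xs" for K'
    using through[OF that(1)] that(2) F by blast
  have dxs: "distinct xs" using xs by (auto simp: is_path_def)
  have xsV: "set xs \<subseteq> V - {u, v}" using xs KV by auto
  have hl: "(u, hd xs) \<in> E" "(last xs, v) \<in> E" using xs ab by auto
  have ch: "q = []" if e: "xs = p @ a # q @ b # r" "(a, b) \<in> E" for p a q b r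
  proof -
    have 1: "is_path E (p @ [a])" "is_path E (b # r)"
      using is_path_appendD(1)[of E "p @ [a]" "q @ b # r"] is_path_appendD(2)[of E "p @ a # q" "b # r"]
        xs(1) e(1) by simp_all
    then have "is_path E ((p @ [a]) @ b # r)"
      using e dxs by (subst is_path_append) auto
    moreover have "hd ((p @ [a]) @ b # r) = hd xs" "last ((p @ [a]) @ b # r) = last xs"
      unfolding e(1) by (auto simp: hd_append)
    ultimately have "linking (set ((p @ [a]) @ b # r))"
      using hl xsV by (intro path_linking) (auto simp: e(1))
    then have "set xs \<subseteq> set ((p @ [a]) @ b # r)" by (rule sub) (auto simp: e(1))
    then show "q = []" using dxs unfolding e(1) by (cases q) auto
  qed
  have chu: "p = []" if e: "xs = p @ b # r" "(u, b) \<in> E" for p b r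
  proof -
    have "is_path E (b # r)" using xs(1) unfolding e(1) by (auto dest: is_path_appendD)
    moreover have "last (b # r) = last xs" unfolding e(1) by simp
    ultimately have "linking (set (b # r))" using hl xsV e by (intro path_linking) auto
    then have "set xs \<subseteq> set (b # r)" by (rule sub) (auto simp: e(1))
    then show ?thesis using dxs unfolding e(1) by (cases p) auto
  qed
  have chv: "r = []" if e: "xs = p @ b # r" "(v, b) \<in> E" for p b r
  proof -
    have "is_path E (p @ [b])" using is_path_appendD(1)[of E "p @ [b]" r] xs(1) e(1) by simp
    moreover have "hd (p @ [b]) = hd xs" unfolding e(1) by (simp add: hd_append)
    ultimately have "linking (set (p @ [b]))" using hl xsV e E_sym by (intro path_linking) auto
    then have "set xs \<subseteq> set (p @ [b])" by (rule sub) (auto simp: e(1))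
    then show ?thesis using dxs unfolding e(1) by (cases r) auto
  qed
  \<comment> \<open>On the inner path \<open>u\<close> sees only its first vertex; since its degree
    is at least three, it has another neighbour in \<open>Y\<close>.\<close>
  have uY: "joined E {u} Y"
  proof -
    obtain y where y: "(u, y) \<in> E" "y \<noteq> v" "y \<noteq> hd xs"
      using ex_third_neighbour[of u v "hd xs"] uv hl E_neq by metis
    have "y \<notin> set xs"
    proof
      assume "y \<in> set xs"
      then obtain p r where pr: "xs = p @ y # r" by (meson split_list)
      then show False using chu[OF pr y(1)] y(3) by simp
    qed
    then have "y \<in> Y" using y F E_verts E_neq by auto
    then show ?thesis using y by (auto intro: joinedI)
  qed
  have vY: "joined E {v} Y"
  proof -
    obtain y where y: "(v, y) \<in> E" "y \<noteq> u" "y \<noteq> last xs"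
      using ex_third_neighbour[of v u "last xs"] uv hl E_neq by metis
    have "y \<notin> set xs"
    proof
      assume "y \<in> set xs"
      then obtain p r where pr: "xs = p @ y # r" by (meson split_list)
      then show False using chv[OF pr y(1)] y(3) by simp
    qed
    then have "y \<in> Y" using y F E_verts E_neq by auto
    then show ?thesis using y by (auto intro: joinedI)
  qed
  have "cycle_and_rest G u v xs Y"
  proof unfold_locales
    show "V = Y \<union> set (u # xs @ [v])" using F KY(3) uv xsV by auto
    show "Y \<inter> set (u # xs @ [v]) = {}" using F KY(3) uv by auto
    show "joined E {c} Y" if "c \<in> set (u # xs @ [v])" for c
    proof -
      have "joined E {c} Y" if "c \<in> F" using that by (simp add: F_def joined_commute[of "{c}"])
      then show ?thesis using that F(1) uY vY by auto
    qed
  qed (use cs ne KY(2) max ch chu chv in blast)+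
  then show ?thesis using that by blast
qed

section \<open>Leaves of the complement\<close>

lemma is_path_appendE:
  "is_path R (xs @ ys) \<Longrightarrow> xs \<noteq> [] \<Longrightarrow> ys \<noteq> [] \<Longrightarrow> (last xs, hd ys) \<in> R"
  by (simp add: is_path_append)

lemma (in rooted_graph) rooted_graph_swap: "rooted_graph G v u"
  by (rule rooted_graph.intro[OF graph three_connected card_ge_6 uv(4)])

lemma (in rooted_graph) linking_swap: "rooted_graph.linking G v u = linking"
  using rooted_graph.linking_def[OF rooted_graph_swap] by (auto simp: linking_def fun_eq_iff insert_commute)

locale no_prism = cycle_and_rest +
  assumes no_prism: "\<not> has_minor_using prism G u v"
    and cyclic: "has_cycle E (V - {u, v})"

context no_prism
begin

text \<open>Exchanging \<open>u\<close> and \<open>v\<close> reverses the path. Reinterpreting the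
  locale this way settles the symmetric halves of later case distinctions.\<close>

lemma mirror: "no_prism G v u (rev xs) T"
proof -
  interpret m: rooted_graph G v u by (rule rooted_graph_swap)
  have m: "m.linking = linking" by (rule linking_swap)
  show ?thesis
  proof unfold_locales
    show "is_path E (v # rev xs @ [u])" using is_path_rev[OF symE, of "u # xs @ [v]"] path by simp
    show "rev xs \<noteq> []" using nonempty by simp
    show "V = T \<union> set (v # rev xs @ [u])" "T \<inter> set (v # rev xs @ [u]) = {}" using verts_eq disjoint by auto
    show "joined E {c} T" if "c \<in> set (v # rev xs @ [u])" for c using joined_T that by auto
    show "q = []" if "rev xs = p @ a # q @ b # r" "(a, b) \<in> E" for p a q b r
    proof -
      have "xs = rev r @ b # rev q @ a # rev p" using arg_cong[OF that(1), of rev] by simp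
      from chord[OF this E_sym[OF that(2)]] show ?thesis by simp
    qed
    show "p = []" if "rev xs = p @ b # r" "(v, b) \<in> E" for p b r
    proof -
      have "xs = rev r @ b # rev p" using arg_cong[OF that(1), of rev] by simp
      from chord_v[OF this that(2)] show ?thesis by simp
    qed
    show "r = []" if "rev xs = p @ b # r" "(u, b) \<in> E" for p b r
    proof -
      have "xs = rev r @ b # rev p" using arg_cong[OF that(1), of rev] by simp
      from chord_u[OF this that(2)] show ?thesis by simp
    qed
    show "card Y \<le> card T" if "m.linking K" "conn E Y" "Y \<subseteq> V - {v, u} - K" for K Y
      using max_T[of K Y] that by (simp add: m insert_commute)
    show "\<not> has_minor_using prism G v u"
      using no_prism by (simp add: has_minor_using_def insert_commute)
    show "has_cycle E (V - {v, u})" using cyclic by (simp add: insert_commute)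
  qed (use conn_T in auto)
qed

lemma cycle_avoids: "linking K \<Longrightarrow> has_cycle E S \<Longrightarrow> S \<subseteq> V - {u, v} - K \<Longrightarrow> False"
  using prism_cycle[of K] has_cycle_mono no_prism by blast

text \<open>The standard contradiction: two edges between disjoint connected sets close a cycle off
  a linking set, which forces a prism with \<open>uv\<close> in a triangle.\<close>

lemma two_edges_avoid:
  assumes "linking K" "conn E A" "conn E B" "A \<inter> B = {}" "A \<union> B \<subseteq> V - {u, v} - K"
    and "a \<in> A" "a' \<in> A" "b \<in> B" "b' \<in> B" "(a, b) \<in> E" "(a', b') \<in> E" "a \<noteq> a' \<or> b \<noteq> b'"
  shows False
  using cycle_avoids[OF assms(1) has_cycle_two_edges[OF symE assms(2-4,6-12)] assms(5)] .

lemma vertex_partition: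
  "T \<subseteq> V - {u, v}" "set xs \<subseteq> V - {u, v}" "T \<inter> set xs = {}" "u \<notin> T" "v \<notin> T" "u \<notin> set xs" "v \<notin> set xs"
  "distinct xs" "V - {u, v} = T \<union> set xs" "V = {u, v} \<union> T \<union> set xs" "finite T"
  using verts_eq disjoint path finite_sub[of T] by (auto simp: is_path_def)

lemma path_xs: "is_path E xs" "(u, hd xs) \<in> E" "(last xs, v) \<in> E"
  using path nonempty by (auto simp: is_path_Cons is_path_append)

lemma linking_xs: "linking (set xs)"
  using path_xs vertex_partition by (intro path_linking)

lemma acyclic_T: "\<not> has_cycle E T"
  using cycle_avoids[OF linking_xs] vertex_partition by blast

lemma linking_in_T: "K \<subseteq> T \<Longrightarrow> conn E K \<Longrightarrow> joined E {u} K \<Longrightarrow> joined E {v} K \<Longrightarrow> linking K"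
  using vertex_partition by (auto simp: linking_def)

lemma conn_set: "is_path E (p @ q @ r) \<Longrightarrow> q \<noteq> [] \<Longrightarrow> conn E (set q)"
  using is_path_appendD[of E] is_path_conn[OF symE] by (metis append_is_Nil_conv)

lemma card_T: "card T + length xs + 2 = card V"
proof -
  have "card V = card T + card (set (u # xs @ [v]))"
    unfolding verts_eq using disjoint vertex_partition by (intro card_Un_disjoint) auto
  then show ?thesis using path distinct_card[of "u # xs @ [v]"] by (simp add: is_path_def)
qed

lemma two_in_path:
  assumes "a \<in> set xs" "b \<in> set xs" "a \<noteq> b"
  obtains p q r where "xs = p @ a # q @ b # r" | p q r where "xs = p @ b # q @ a # r"
proof -
  obtain p s where ps: "xs = p @ a # s" using assms(1) by (meson split_list)
  then consider "b \<in> set p" | "b \<in> set s" using assms by auto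
  then show ?thesis
  proof cases
    case 1
    then obtain p1 p2 where "p = p1 @ b # p2" by (meson split_list)
    then show ?thesis using that(2) ps by simp
  next
    case 2
    then obtain s1 s2 where "s = s1 @ b # s2" by (meson split_list)
    then show ?thesis using that(1) ps by simp
  qed
qed

text \<open>In a tree, the vertices whose removal keeps it connected are its leaves; this form
  avoids degrees. The empty set not being \<open>conn\<close>, a one-vertex tree has no leaf in this
  sense.\<close>

definition leaf :: "'a \<Rightarrow> bool" where
  "leaf l \<longleftrightarrow> l \<in> T \<and> conn E (T - {l})"

lemma leaf_in: "leaf l \<Longrightarrow> l \<in> T" "leaf l \<Longrightarrow> conn E (T - {l})"
  by (auto simp: leaf_def)

text \<open>A single vertex sees both \<open>u\<close> and \<open>v\<close>, so it is a linking set
  and \<open>set xs\<close> competes with \<open>T\<close>. By maximality the path has one inner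
  vertex, leaving only four vertices in all.\<close>

lemma two_le_card_T: "2 \<le> card T"
proof (rule ccontr)
  assume "\<not> 2 \<le> card T"
  moreover have "card T \<noteq> 0" using conn_T vertex_partition conn_nonempty by auto
  ultimately have c: "card T = 1" by simp
  then have "linking T"
    using joined_T conn_T by (intro linking_in_T) auto
  then have "card (set xs) \<le> card T"
    using max_T[of T "set xs"] vertex_partition is_path_conn[OF symE path_xs(1)] by auto
  then have "length xs \<le> 1" using c vertex_partition by (simp add: distinct_card)
  then show False using card_T card_ge_6 c by simp
qed

lemma ex_leaf:
  assumes "conn E P" "P \<subset> T"
  obtains l where "leaf l" "l \<notin> P"
  using ex_noncut[OF vertex_partition(11) conn_T assms symE] by (metis leaf_def DiffE)

lemma singleton_psubset:
  assumes "t \<in> T" shows "{t} \<subset> T"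
proof -
  have "T \<noteq> {t}" using two_le_card_T by auto
  then show ?thesis using assms by auto
qed

text \<open>The rest of \<open>T\<close> is connected, so two neighbours there would close a cycle
  in \<open>T\<close>.\<close>

lemma leaf_unique:
  assumes "leaf l" "a \<in> T" "b \<in> T" "(l, a) \<in> E" "(l, b) \<in> E"
  shows "a = b"
proof (rule ccontr)
  assume "a \<noteq> b"
  then have "has_cycle E ({l} \<union> (T - {l}))"
    using assms leaf_in[OF assms(1)] by (intro has_cycle_two_edges[OF symE, of _ _ l l a b]) auto
  then show False using acyclic_T leaf_in[OF assms(1)] by (simp add: insert_absorb)
qed

lemma leaf_joined:
  assumes "conn E A" "l \<in> A" "A \<noteq> {l}"
  shows "joined E {l} (A - {l})"
  using conn_joined[OF assms(1), of "{l}"] assms by auto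

text \<open>If removing \<open>l\<close> split \<open>A\<close>, both parts would contain a
  neighbour of \<open>l\<close>, contrary to uniqueness.\<close>

lemma leaf_remove:
  assumes "leaf l" "conn E A" "A \<subseteq> T" "l \<in> A" "A \<noteq> {l}"
  shows "conn E (A - {l})"
  unfolding conn_def
proof (intro conjI allI impI)
  show "A - {l} \<noteq> {}" using assms by auto
  fix D assume D: "D \<subseteq> A - {l}" "D \<noteq> {}" "D \<noteq> A - {l}"
  show "joined E D (A - {l} - D)"
  proof (rule ccontr)
    assume n: "\<not> joined E D (A - {l} - D)"
    let ?D = "A - {l} - D"
    have "joined E D (A - D)" using D by (intro conn_joined[OF assms(2)]) auto
    then obtain a a' where a: "a \<in> D" "a' \<in> A - D" "(a, a') \<in> E" by (auto simp: joined_def)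
    then have la: "(l, a) \<in> E" using n E_sym[OF a(3)] by (cases "a' = l") (auto simp: joined_def)
    have "joined E ?D (A - ?D)" using D assms by (intro conn_joined[OF assms(2)]) auto
    then obtain b b' where b: "b \<in> ?D" "b' \<in> A - ?D" "(b, b') \<in> E" by (auto simp: joined_def)
    then have lb: "(l, b) \<in> E" using n E_sym[OF b(3)] by (cases "b' = l") (auto simp: joined_def)
    show False using leaf_unique[OF assms(1) _ _ la lb] a b D assms(3) by auto
  qed
qed

lemma joined_minus_leaf:
  assumes "c \<in> set (u # xs @ [v])" "(c, l) \<notin> E"
  shows "joined E {c} (T - {l})"
  using joined_T[OF assms(1)] assms(2) by (auto simp: joined_def)

text \<open>Degree at least three with only one neighbour in \<open>T\<close> leaves at least two on
  the cycle; \<open>c\<close> is one that is to be avoided.\<close>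

lemma leaf_cycle_neighbour:
  assumes "leaf l"
  obtains y where "(l, y) \<in> E" "y \<in> set (u # xs @ [v])" "y \<noteq> c"
proof -
  have l: "l \<in> T" by (rule leaf_in(1)[OF assms])
  obtain t where t: "t \<in> T" "(l, t) \<in> E"
    using leaf_joined[OF conn_T l] singleton_psubset[OF l] by (auto simp: joined_def)
  have lV: "l \<in> V" using l vertex_partition by auto
  show ?thesis
  proof (cases "c = l")
    case True
    obtain y where y: "(l, y) \<in> E" "y \<noteq> t" using ex_third_neighbour[OF lV, of t t] E_neq[OF t(2)] by metis
    then have "y \<notin> T" using leaf_unique[OF assms t(1) _ t(2) y(1)] by auto
    then have "y \<in> set (u # xs @ [v])" using E_verts(2)[OF y(1)] verts_eq by auto
    then show ?thesis using that[of y] y(1) True E_neq[OF y(1)] by metis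
  next
    case False
    obtain y where y: "(l, y) \<in> E" "y \<noteq> t" "y \<noteq> c"
      using ex_third_neighbour[OF lV, of t c] E_neq[OF t(2)] False by metis
    then have "y \<notin> T" using leaf_unique[OF assms t(1) _ t(2) y(1)] by auto
    then have "y \<in> set (u # xs @ [v])" using E_verts(2)[OF y(1)] verts_eq by auto
    then show ?thesis using that[of y] y by metis
  qed
qed

text \<open>Otherwise the leaf has two inner neighbours. The rest of \<open>T\<close> still links
  \<open>u\<close> to \<open>v\<close>, while the leaf and the path segment between these neighbours
  contain a cycle.\<close>

lemma leaf_sees_root:
  assumes "leaf l"
  shows "(u, l) \<in> E \<or> (v, l) \<in> E"
proof (rule ccontr)
  assume n: "\<not> ((u, l) \<in> E \<or> (v, l) \<in> E)"
  obtain a where a: "(l, a) \<in> E" "a \<in> set (u # xs @ [v])" using leaf_cycle_neighbour[OF assms] by metis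
  obtain b where b: "(l, b) \<in> E" "b \<in> set (u # xs @ [v])" "b \<noteq> a" using leaf_cycle_neighbour[OF assms] by metis
  have "a \<in> set xs" "b \<in> set xs" using a b n E_sym by auto
  then obtain p q r a b where e: "xs = p @ (a # q @ [b]) @ r" and l: "(l, a) \<in> E" "(l, b) \<in> E"
    using a(1) b(1,3) by (metis two_in_path append.assoc append_Cons append_Nil)
  have "linking (T - {l})"
    using n joined_minus_leaf leaf_in[OF assms] by (intro linking_in_T) auto
  moreover have "conn E (set (a # q @ [b]))" using conn_set[of p "a # q @ [b]" r] path_xs e by simp
  moreover have "l \<in> T" by (rule leaf_in(1)[OF assms])
  moreover have "a \<noteq> b" "set (a # q @ [b]) \<subseteq> set xs" using vertex_partition(8) e by auto
  ultimately show False
    using l vertex_partition by (intro two_edges_avoid[of "T - {l}" "{l}" "set (a # q @ [b])" l l a b]) auto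
qed

text \<open>An edge from \<open>b\<close> to the rest of \<open>T\<close> gives a prism: one
  triangle is formed by the initial segment at \<open>u\<close>, the leaf and the segment from
  \<open>a\<close> up to \<open>b\<close>; the other by the final segment at \<open>v\<close>,
  \<open>T - {l}\<close> and \<open>b\<close>.\<close>

lemma leaf_blocks_later:
  assumes l: "leaf l" "(u, l) \<in> E" "(v, l) \<notin> E" and xs: "xs = p @ a # q @ b # r" and a: "(l, a) \<in> E"
  shows "\<not> joined E {b} (T - {l})"
proof
  assume b: "joined E {b} (T - {l})"
  have eq: "u # xs @ [v] = (u # p) @ (a # q) @ [b] @ (r @ [v])" using xs by simp
  have path': "is_path E ((u # p) @ (a # q) @ [b] @ (r @ [v]))" using path unfolding eq .
  have d: "distinct ((u # p) @ (a # q) @ [b] @ (r @ [v]))" using path' unfolding is_path_def by blast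
  have j: "(last (u # p), a) \<in> E" "(last (a # q), b) \<in> E" "(b, hd (r @ [v])) \<in> E"
    using is_path_appendE[of E "u # p" "(a # q) @ [b] @ (r @ [v])"]
      is_path_appendE[of E "(u # p) @ (a # q)" "[b] @ (r @ [v])"]
      is_path_appendE[of E "(u # p) @ (a # q) @ [b]" "r @ [v]"] path' by simp_all
  have c: "conn E (set (u # p))" "conn E (set (a # q))" "conn E (set (r @ [v]))"
    using conn_set[of "[]" "u # p" "(a # q) @ [b] @ (r @ [v])"] conn_set[of "u # p" "a # q" "[b] @ (r @ [v])"]
      conn_set[of "(u # p) @ (a # q) @ [b]" "r @ [v]" "[]"] path' by simp_all
  have T: "T \<inter> set ((u # p) @ (a # q) @ [b] @ (r @ [v])) = {}" "set ((u # p) @ (a # q) @ [b] @ (r @ [v])) \<subseteq> V"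
    using disjoint verts_eq unfolding eq by auto
  have "has_minor_using prism G u v"
  proof (rule prism_matching[of "set (u # p)" "{l}" "set (a # q)" "set (r @ [v])" "T - {l}" "{b}"])
    show "joined E (set (u # p)) {l}" using l by (auto intro: joinedI)
    show "joined E (set (u # p)) (set (a # q))" by (rule joinedI[OF _ _ j(1)]) simp_all
    show "joined E {l} (set (a # q))" using a by (auto intro: joinedI)
    show "joined E (set (r @ [v])) (T - {l})" using joined_minus_leaf[of v l] l by (auto elim: joined_mono)
    show "joined E (set (r @ [v])) {b}" by (rule joinedI[OF _ _ E_sym[OF j(3)]]) (simp_all del: set_append)
    show "joined E (T - {l}) {b}" using b joined_commute by blast
    show "joined E {l} (T - {l})" using leaf_joined[OF conn_T] leaf_in[OF l(1)] singleton_psubset by auto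
    show "joined E (set (a # q)) {b}" by (rule joinedI[OF _ _ j(2)]) simp_all
  qed (use c leaf_in[OF l(1)] d T vertex_partition in auto)
  then show False using no_prism by blast
qed

text \<open>Such an edge would link \<open>u\<close>, possibly through \<open>p\<close>, and
  \<open>T - {l}\<close> to \<open>v\<close>, while \<open>l\<close> and the segment from
  \<open>a\<close> to \<open>b\<close> contain a cycle off this connection.\<close>

lemma leaf_two_neighbours:
  assumes l: "leaf l" "(v, l) \<notin> E" and xs: "xs = p @ a # q @ b # r" and ab: "(l, a) \<in> E" "(l, b) \<in> E"
  shows "\<not> joined E (set (u # p)) (T - {l})"
proof
  assume j: "joined E (set (u # p)) (T - {l})"
  have cT: "conn E (T - {l})" "l \<in> T" using leaf_in[OF l(1)] by auto
  have v: "joined E {v} (T - {l})" using joined_minus_leaf l by auto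
  have eq: "xs = p @ (a # q @ [b]) @ r" using xs by simp
  have d: "distinct (p @ (a # q @ [b]) @ r)" "T \<inter> set (p @ (a # q @ [b]) @ r) = {}"
    "set (p @ (a # q @ [b]) @ r) \<subseteq> V - {u, v}" using vertex_partition eq by auto
  have cB: "conn E (set (a # q @ [b]))" using conn_set[of p "a # q @ [b]" r] path_xs eq by simp
  have "\<exists>K. linking K \<and> K \<subseteq> set p \<union> (T - {l})"
  proof (cases "joined E {u} (T - {l})")
    case True
    then show ?thesis using cT v by (intro exI[of _ "T - {l}"]) (auto intro: linking_in_T)
  next
    case False
    then have jp: "joined E (set p) (T - {l})" using j by (auto simp: joined_def)
    then have pne: "p \<noteq> []" by auto
    then have "is_path E p" "hd xs = hd p" using path_xs(1) is_path_appendD(1) eq by (auto simp: hd_append)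
    then have "conn E (set p \<union> (T - {l}))" using conn_Un[OF symE is_path_conn[OF symE] cT(1)] jp by blast
    moreover have "joined E {u} (set p)" using path_xs(2) \<open>hd xs = hd p\<close> pne by (intro joinedI[of u _ "hd p"]) auto
    ultimately have "linking (set p \<union> (T - {l}))" using v d vertex_partition by (auto simp: linking_def)
    then show ?thesis by blast
  qed
  then obtain K where K: "linking K" "K \<subseteq> set p \<union> (T - {l})" by blast
  have "K \<inter> ({l} \<union> set (a # q @ [b])) = {}" using K(2) d cT by auto
  then show False
    using K ab d cB cT vertex_partition by (intro two_edges_avoid[OF K(1), of "{l}" "set (a # q @ [b])" l l a b]) auto
qed

text \<open>The leaf alone links \<open>u\<close> to \<open>v\<close>, so \<open>w\<close> together
  with the rest of \<open>T\<close> must be acyclic.\<close>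

lemma single_inner_unique:
  assumes w: "xs = [w]" and l: "leaf l" "(u, l) \<in> E" "(v, l) \<in> E"
    and ab: "a \<in> T - {l}" "b \<in> T - {l}" "(w, a) \<in> E" "(w, b) \<in> E"
  shows "a = b"
proof (rule ccontr)
  assume "a \<noteq> b"
  have "linking {l}" using l leaf_in[OF l(1)] vertex_partition by (intro linking_in_T) auto
  then show False
    using ab \<open>a \<noteq> b\<close> leaf_in[OF l(1)] vertex_partition w
    by (intro two_edges_avoid[of "{l}" "{w}" "T - {l}" w w a b]) auto
qed

text \<open>A cycle off \<open>u\<close> and \<open>v\<close> passes through \<open>w\<close>, since
  \<open>T\<close> is acyclic. Of its two neighbours there only one can differ from
  \<open>l\<close>.\<close>

lemma single_inner_adjacent:
  assumes w: "xs = [w]" and l: "leaf l" "(u, l) \<in> E" "(v, l) \<in> E"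
  shows "(w, l) \<in> E" "\<exists>t\<in>T - {l}. (w, t) \<in> E"
proof -
  obtain cs where cs: "is_cycle E cs" "set cs \<subseteq> V - {u, v}" using cyclic by (auto simp: has_cycle_def)
  have "w \<in> set cs"
  proof (rule ccontr)
    assume "w \<notin> set cs"
    then have "set cs \<subseteq> T" using cs(2) vertex_partition w by auto
    then show False using cs(1) acyclic_T by (auto simp: has_cycle_def)
  qed
  then obtain a b where ab: "a \<in> set cs" "b \<in> set cs" "a \<noteq> b" "a \<noteq> w" "b \<noteq> w" "(w, a) \<in> E" "(w, b) \<in> E"
    using is_cycle_distinct_edges[OF symE cs(1)] by metis
  then have T: "a \<in> T" "b \<in> T" using cs(2) vertex_partition w by auto
  have "a = l \<or> b = l" using single_inner_unique[OF w l, of a b] T ab by auto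
  then show "(w, l) \<in> E" "\<exists>t\<in>T - {l}. (w, t) \<in> E" using ab T by auto
qed

lemma two_leaves_rest:
  assumes "leaf l" "leaf l'" "l \<noteq> l'" "3 \<le> card T"
  shows "conn E (T - {l, l'})" "joined E {l} (T - {l, l'})" "joined E {l'} (T - {l, l'})"
proof -
  have ne: "T - {l, l'} \<noteq> {}"
    using assms(4) card_mono[of "{l, l'}" T] by (auto simp: card_insert_if split: if_splits)
  have eq: "T - {l} - {l'} = T - {l, l'}" "T - {l'} - {l} = T - {l, l'}" by auto
  show "conn E (T - {l, l'})"
    using leaf_remove[OF assms(2) leaf_in(2)[OF assms(1)]] leaf_in(1)[OF assms(2)] assms(3) ne
    by (auto simp: eq[symmetric])
  show "joined E {l} (T - {l, l'})"
    using leaf_joined[OF leaf_in(2)[OF assms(2)], of l] leaf_in(1)[OF assms(1)] assms(3) ne eq(2) by auto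
  show "joined E {l'} (T - {l, l'})"
    using leaf_joined[OF leaf_in(2)[OF assms(1)], of l'] leaf_in(1)[OF assms(2)] assms(3) ne eq(1) by auto
qed

text \<open>The pair \<open>{l, l2}\<close> does not separate the rest of the tree from the cycle,
  and \<open>w\<close> does not see that rest, so \<open>u\<close> or \<open>v\<close> does; each
  case yields an explicit prism.\<close>

lemma leaf_not_both_aux:
  assumes w: "xs = [w]" and l: "leaf l" "(u, l) \<in> E" "(v, l) \<in> E" and l2: "leaf l2" "l2 \<noteq> l" "(u, l2) \<in> E"
    and only: "\<And>t. t \<in> T \<Longrightarrow> (w, t) \<in> E \<longleftrightarrow> t = l \<or> t = l2"
  shows False
proof -
  have c3: "3 \<le> card T" using card_T card_ge_6 w by simp
  let ?M = "T - {l, l2}"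
  note M = two_leaves_rest[OF l(1) l2(1) l2(2)[symmetric] c3]
  have lT: "l \<in> T" "l2 \<in> T" "(w, l) \<in> E" "(w, l2) \<in> E" using leaf_in(1) l l2 only by auto
  have Mw: "\<not> joined E ?M {w}" using only E_sym by (auto simp: joined_def)
  have "joined E ?M (V - ?M - {l, l2})"
    using vertex_partition w conn_nonempty[OF M(1)] lT by (intro joined_outside[of ?M "{l, l2}" w]) (auto simp: card_insert_if)
  moreover have "V - ?M - {l, l2} = {u, v, w}" using vertex_partition w lT by auto
  ultimately consider "joined E {u} ?M" | "joined E {v} ?M"
    using Mw joined_commute by auto
  then have "has_minor_using prism G u v"
  proof cases
    case 1
    show ?thesis
      by (rule prism_matching[of "{u}" "{l2}" ?M "{v}" "{w}" "{l}"])
        (use 1 M l l2 lT vertex_partition w E_sym uv path_xs joined_commute in auto)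
  next
    case 2
    show ?thesis
      by (rule prism_matching[of "{u}" "{w}" "{l2}" "{v}" "{l}" ?M])
        (use 2 M l l2 lT vertex_partition w E_sym uv path_xs joined_commute in auto)
  qed
  then show False using no_prism by blast
qed

lemma leaf_not_both:
  assumes l: "leaf l" "(u, l) \<in> E"
  shows "(v, l) \<notin> E"
proof
  assume lv: "(v, l) \<in> E"
  have lT: "l \<in> T" using leaf_in(1)[OF l(1)] .
  have link: "linking {l}" using l lv lT by (intro linking_in_T) auto
  have cT: "conn E (T - {l})" using leaf_in(2)[OF l(1)] .
  show False
  proof (cases "length xs = 1")
    case True
    then obtain w where w: "xs = [w]" by (auto simp: length_Suc_conv)
    note wl = single_inner_adjacent[OF w l lv]
    obtain t where t: "t \<in> T - {l}" "(w, t) \<in> E" using wl(2) by blast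
    obtain l2 where l2: "leaf l2" "l2 \<noteq> l"
      using ex_leaf[OF conn_singleton singleton_psubset[OF lT]] by blast
    \<comment> \<open>If \<open>w\<close> did not see \<open>l2\<close>, the leaf \<open>l2\<close>
      would see both \<open>u\<close> and \<open>v\<close>; uniqueness applied with
      \<open>l2\<close> in place of \<open>l\<close> would then identify \<open>t\<close> with
      \<open>l\<close>.\<close>
    have "t = l2 \<and> (w, l2) \<in> E"
    proof (cases "(w, l2) \<in> E")
      case True
      then show ?thesis using single_inner_unique[OF w l lv, of t l2] t l2 leaf_in(1)[OF l2(1)] by auto
    next
      case False
      have "(u, l2) \<in> E \<and> (v, l2) \<in> E"
      proof -
        have "(u, l2) \<in> E" using leaf_cycle_neighbour[OF l2(1), of v] False w E_sym by (metis append_Cons append_Nil set_ConsD singletonD set_simps(1) empty_iff)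
        moreover have "(v, l2) \<in> E" using leaf_cycle_neighbour[OF l2(1), of u] False w E_sym by (metis append_Cons append_Nil set_ConsD singletonD set_simps(1) empty_iff)
        ultimately show ?thesis by blast
      qed
      then show ?thesis using single_inner_unique[OF w l2(1), of l t] wl(1) t l2 lT False by auto
    qed
    then have "\<And>t'. t' \<in> T \<Longrightarrow> (w, t') \<in> E \<longleftrightarrow> t' = l \<or> t' = l2"
      using single_inner_unique[OF w l lv, of _ l2] wl(1) t by blast
    note only = this
    show False
    proof (cases "(u, l2) \<in> E")
      case True
      then show False using leaf_not_both_aux[OF w l lv l2 _ only] by blast
    next
      case False
      then have vl2: "(v, l2) \<in> E" using leaf_sees_root[OF l2(1)] by blast
      interpret m: no_prism G v u "rev xs" T by (rule mirror)
      show False using m.leaf_not_both_aux[of w l l2] w l lv l2 vl2 only by (auto simp: m.leaf_def leaf_def)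
    qed
  next
    case False
    then have len: "2 \<le> length xs" using nonempty by (cases xs) (auto simp: Suc_le_eq)
    have disj: "set xs \<inter> (T - {l}) = {}" "set xs \<union> (T - {l}) \<subseteq> V - {u, v} - {l}" using vertex_partition lT by auto
    show False
    proof (cases "joined E (set xs) (T - {l})")
      case True
      \<comment> \<open>The exchange against maximality: the single leaf becomes the connection, and
        the whole path joins the rest of \<open>T\<close>. This gains at least one vertex because
        the path has at least two.\<close>
      have "card (set xs \<union> (T - {l})) \<le> card T"
        using conn_Un[OF symE is_path_conn[OF symE path_xs(1)] cT] True disj(2) by (intro max_T[OF link]) auto
      moreover have "card (set xs \<union> (T - {l})) = length xs + (card T - 1)"
        using disj(1) vertex_partition lT by (subst card_Un_disjoint) (auto simp: distinct_card)
      ultimately show False using len two_le_card_T by simp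
    next
      case False
      \<comment> \<open>Every path vertex has a neighbour in \<open>T\<close>, which now can only be
        \<open>l\<close>; so \<open>l\<close> and the path contain a cycle.\<close>
      have xl: "(c, l) \<in> E" if "c \<in> set xs" for c
        using joined_minus_leaf[of c l] that False by (auto simp: joined_def)
      have hd: "hd xs \<in> set xs" "hd xs \<in> V" using nonempty vertex_partition by auto
      have nT: "\<not> joined E (T - {l}) (set xs)" using False joined_commute by blast
      \<comment> \<open>Neither \<open>{l, u}\<close> nor \<open>{l, v}\<close> separates the rest
        of \<open>T\<close> from the path, so that rest sees both ends and is a linking set off the
        cycle.\<close>
      have j: "joined E {b} (T - {l})" if ab: "{a, b} = {u, v}" for a b
      proof -
        have "joined E (T - {l}) (V - (T - {l}) - {l, a})"
          using conn_nonempty[OF cT] vertex_partition ab hd lT by (intro joined_outside[of "T - {l}" "{l, a}" "hd xs"]) (auto simp: card_insert_if doubleton_eq_iff)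
        moreover have "V - (T - {l}) - {l, a} \<subseteq> set xs \<union> {b}" using vertex_partition ab lT by (auto simp: doubleton_eq_iff)
        ultimately have "joined E (T - {l}) (set xs \<union> {b})" by (rule joined_mono[OF _ order_refl])
        then have "joined E (T - {l}) {b}" using nT by (simp only: joined_Un simp_thms)
        then show ?thesis by (simp only: joined_commute)
      qed
      have "linking (T - {l})" using j[of v u] j[of u v] cT by (intro linking_in_T) auto
      moreover have "hd xs \<noteq> last xs" using len vertex_partition(8) by (cases xs) auto
      moreover have "last xs \<in> set xs" using nonempty by simp
      ultimately show False
        using xl hd E_sym vertex_partition lT is_path_conn[OF symE path_xs(1)]
        by (intro two_edges_avoid[of "T - {l}" "{l}" "set xs" l l "hd xs" "last xs"]) auto
    qed
  qed
qed

end

text \<open>Edges inside the triple are left unrestricted, which treats the four families with a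
  part of size three at once.\<close>

definition K3_like :: "'a pair_pre_digraph \<Rightarrow> bool" where
  "K3_like G \<longleftrightarrow> (\<exists>X \<subseteq> pverts G. card X = 3 \<and> (\<forall>x\<in>X. \<forall>y\<in>pverts G - X. (x, y) \<in> parcs G) \<and>
     (\<forall>y\<in>pverts G - X. \<forall>z\<in>pverts G - X. (y, z) \<notin> parcs G))"

text \<open>The exception with \<open>p\<close> and \<open>r\<close> empty is the pair of first and
  last rim vertices, whose edge closes the rim.\<close>

definition wheel_like :: "'a pair_pre_digraph \<Rightarrow> bool" where
  "wheel_like G \<longleftrightarrow> (\<exists>h cs. pverts G = insert h (set cs) \<and> h \<notin> set cs \<and> is_cycle (parcs G) cs \<and>
     (\<forall>c\<in>set cs. (h, c) \<in> parcs G) \<and>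
     (\<forall>p a q b r. cs = p @ a # q @ b # r \<longrightarrow> (a, b) \<in> parcs G \<longrightarrow> q = [] \<or> p = [] \<and> r = []))"

context no_prism
begin

text \<open>A part of \<open>T - Q\<close> not containing \<open>z\<close> has a leaving edge in
  \<open>T\<close>, which cannot end in the component \<open>Q\<close>; a part containing
  \<open>z\<close> is handled through its complement.\<close>

lemma conn_outside_component:
  assumes "z \<in> T" "Q \<subseteq> T - {z}" "Q \<noteq> {}" "\<not> joined E Q (T - {z} - Q)"
  shows "conn E (T - Q)"
  unfolding conn_def
proof (intro conjI allI impI)
  show "T - Q \<noteq> {}" using assms by auto
  fix D assume D: "D \<subseteq> T - Q" "D \<noteq> {}" "D \<noteq> T - Q"
  have key: "joined E D' (T - Q - D')" if D': "D' \<subseteq> T - Q" "D' \<noteq> {}" "z \<notin> D'" for D'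
  proof -
    have "joined E D' (T - D')" using D' assms by (intro conn_joined[OF conn_T]) auto
    moreover have "\<not> joined E D' Q"
    proof
      assume "joined E D' Q"
      then have "joined E Q D'" by (simp only: joined_commute)
      then have "joined E Q (T - {z} - Q)" by (rule joined_mono) (use D' in auto)
      then show False using assms by blast
    qed
    ultimately show ?thesis by (auto simp: joined_def)
  qed
  show "joined E D (T - Q - D)"
  proof (cases "z \<in> D")
    case False
    then show ?thesis using key D by blast
  next
    case True
    have "joined E (T - Q - D) (T - Q - (T - Q - D))" using key[of "T - Q - D"] D True by auto
    moreover have "T - Q - (T - Q - D) = D" using D by auto
    ultimately show ?thesis using joined_commute by auto
  qed
qed

text \<open>The only tree neighbour of \<open>l\<close> lies in \<open>A\<close>, so an edge from
  \<open>A\<close> to \<open>B\<close> starts elsewhere.\<close>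

lemma joined_minus_leaf_set:
  assumes "leaf l" "conn E A" "A \<subseteq> T" "l \<in> A" "A \<noteq> {l}" "joined E A B" "B \<subseteq> T - A"
  shows "joined E (A - {l}) B"
proof -
  obtain a b where ab: "a \<in> A" "b \<in> B" "(a, b) \<in> E" using assms(6) by (auto simp: joined_def)
  obtain c where c: "c \<in> A - {l}" "(l, c) \<in> E" using leaf_joined[OF assms(2,4,5)] by (auto simp: joined_def)
  have "a \<noteq> l" using leaf_unique[OF assms(1), of b c] ab c assms by auto
  then show ?thesis using ab by (auto intro: joinedI)
qed

section \<open>All leaves of the tree are adjacent to the same end of the root edge\<close>

context
  assumes leaf_u: "\<And>l. leaf l \<Longrightarrow> (u, l) \<in> E"
begin

lemma leaf_not_v: "leaf l \<Longrightarrow> (v, l) \<notin> E"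
  using leaf_u leaf_not_both by blast

lemma u_rest: "leaf l \<Longrightarrow> joined E {u} (T - {l})"
proof -
  assume l: "leaf l"
  obtain l2 where "leaf l2" "l2 \<noteq> l"
    using ex_leaf[OF conn_singleton singleton_psubset[OF leaf_in(1)[OF l]]] by blast
  then show ?thesis using leaf_u leaf_in by (auto intro: joinedI)
qed

text \<open>A leaf seeing an earlier vertex also sees the next one, which the rest of
  \<open>T\<close> cannot reach. Two inner neighbours then contradict that \<open>u\<close> sees the
  rest of \<open>T\<close> in another leaf.\<close>

lemma leaf_inner:
  assumes l: "leaf l" and a: "a \<in> set xs"
  shows "(l, a) \<in> E \<longleftrightarrow> a = last xs"
proof -
  have 1: "c = last xs" if c: "c \<in> set xs" "(l, c) \<in> E" for c
  proof -
    obtain p r where xs: "xs = p @ c # r" using c(1) by (meson split_list)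
    show ?thesis
    proof (cases r)
      case Nil
      then show ?thesis using xs by simp
    next
      case (Cons b r')
      then have xs': "xs = p @ c # [] @ b # r'" using xs by simp
      have "\<not> joined E {b} (T - {l})"
        using leaf_blocks_later[OF l leaf_u[OF l] leaf_not_v[OF l] xs' c(2)] .
      then have "(l, b) \<in> E" using joined_minus_leaf[of b l] xs' E_sym by auto
      then have "\<not> joined E (set (u # p)) (T - {l})"
        using leaf_two_neighbours[OF l leaf_not_v[OF l] xs' c(2)] by blast
      then show ?thesis using u_rest[OF l] by (auto simp: joined_def)
    qed
  qed
  obtain y where y: "(l, y) \<in> E" "y \<in> set (u # xs @ [v])" "y \<noteq> u" using leaf_cycle_neighbour[OF l] by metis
  then have "y \<in> set xs" using leaf_not_v[OF l] E_sym by auto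
  then show ?thesis using 1 y a by blast
qed

text \<open>The part of size three consists of \<open>u\<close>, the last inner vertex
  \<open>c\<close> and the only neighbour \<open>z\<close> of \<open>v\<close> in \<open>T\<close>.
  The tree is a star with centre \<open>z\<close>, and at most one inner vertex precedes
  \<open>c\<close>.\<close>

lemma only_leaves_at_u: "K3_like G"
proof -
  define c where "c = last xs"
  define ys where "ys = butlast xs"
  have xs: "xs = ys @ [c]" using nonempty by (simp add: c_def ys_def)
  have cxs: "c \<in> set xs" and cy: "c \<notin> set ys" using xs vertex_partition(8) by auto
  have lc: "(l, c) \<in> E" "(c, l) \<in> E" if "leaf l" for l using leaf_inner[OF that cxs] E_sym by (auto simp: c_def)
  have ly: "(l, y) \<notin> E" "(y, l) \<notin> E" if "leaf l" "y \<in> set ys" for l y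
    using leaf_inner[OF that(1), of y, folded c_def] that(2) cy xs E_sym by auto
  have cv: "(c, v) \<in> E" "(v, c) \<in> E" using path_xs(3) E_sym by (auto simp: c_def)
  have cT: "c \<notin> T" "c \<noteq> u" "c \<noteq> v" "c \<in> V" using cxs vertex_partition by auto
  have TV: "T \<subseteq> V" "u \<notin> T" "v \<notin> T" using vertex_partition by auto
  obtain z where z: "z \<in> T" "(v, z) \<in> E" using joined_T[of v] by (auto simp: joined_def)
  have leafT: "l \<in> T" "l \<noteq> z" if "leaf l" for l using leaf_in(1)[OF that] leaf_not_v[OF that] z by auto
  \<comment> \<open>Two neighbours of \<open>v\<close> split \<open>T\<close> into halves with a
    leaf of \<open>T\<close> in each. The triangles of the prism are \<open>u\<close>,
    \<open>l1\<close>, \<open>{l2, c}\<close> and \<open>v\<close> with both halves without their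
    leaves.\<close>
  have zunique: "z' = z" if z': "z' \<in> T" "(v, z') \<in> E" for z'
  proof (rule ccontr)
    assume "z' \<noteq> z"
    obtain A B where AB: "z' \<in> A" "z \<in> B" "A \<inter> B = {}" "A \<union> B = T" "conn E A" "conn E B" "joined E A B"
      using ex_split[OF vertex_partition(11) conn_T z'(1) z(1) \<open>z' \<noteq> z\<close> symE] by metis
    obtain l1 where l1: "leaf l1" "l1 \<notin> B" using ex_leaf[OF AB(6)] AB by blast
    obtain l2 where l2: "leaf l2" "l2 \<notin> A" using ex_leaf[OF AB(5)] AB by blast
    have l1A: "l1 \<in> A" "A \<noteq> {l1}" "z' \<in> A - {l1}" using l1 leaf_in(1)[OF l1(1)] AB z' leaf_not_v[OF l1(1)] by auto
    have l2B: "l2 \<in> B" "B \<noteq> {l2}" "z \<in> B - {l2}" using l2 leaf_in(1)[OF l2(1)] AB z leaf_not_v[OF l2(1)] by auto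
    have sub: "A \<subseteq> T" "B \<subseteq> T" using AB by auto
    have "joined E (A - {l1}) B" by (rule joined_minus_leaf_set[OF l1(1) AB(5) sub(1) l1A(1,2) AB(7)]) (use AB in auto)
    then have "joined E B (A - {l1})" by (simp only: joined_commute)
    then have "joined E (B - {l2}) (A - {l1})"
      by (rule joined_minus_leaf_set[OF l2(1) AB(6) sub(2) l2B(1,2)]) (use AB in auto)
    then have J: "joined E (A - {l1}) (B - {l2})" by (simp only: joined_commute)
    have "has_minor_using prism G u v"
    proof (rule prism_matching[of "{u}" "{l1}" "{l2, c}" "{v}" "A - {l1}" "B - {l2}"])
      show "conn E {l2, c}" using conn_insert[OF symE, of "{c}" l2] lc[OF l2(1)] by simp
      show "conn E (A - {l1})" "conn E (B - {l2})"
        using leaf_remove l1 l2 l1A l2B AB sub by auto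
      show "joined E {u} {l2, c}" using leaf_u[OF l2(1)] by auto
      show "joined E {l1} {l2, c}" using lc[OF l1(1)] by auto
      show "joined E {v} (A - {l1})" "joined E {v} (B - {l2})" using z z' l1A l2B by (auto intro: joinedI)
      show "joined E {l1} (A - {l1})" using leaf_joined[OF AB(5) l1A(1,2)] .
      show "joined E {l2, c} (B - {l2})" using leaf_joined[OF AB(6) l2B(1,2)] by auto
      show "{l1} \<inter> ({l2, c} \<union> {v} \<union> (A - {l1}) \<union> (B - {l2})) = {}" "{l2, c} \<inter> ({v} \<union> (A - {l1}) \<union> (B - {l2})) = {}"
        using AB(3) sub l1A(1) l2B(1) cT vertex_partition(4,5) by auto
    qed (use leaf_u[OF l1(1)] J AB(3) sub TV cT uv leafT[OF l1(1)] leafT[OF l2(1)] in auto)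
    then show False using no_prism by blast
  qed
  \<comment> \<open>The triangles are the initial segment, \<open>l1\<close>,
    \<open>A - {l1}\<close> and \<open>v\<close>, \<open>c\<close>, \<open>B\<close>; the matching
    uses \<open>l1\<close> with \<open>c\<close> and the edge between the halves.\<close>
  have yunique: "x = z" if y: "y \<in> set ys" and x: "x \<in> T" "(y, x) \<in> E" for x y
  proof (rule ccontr)
    assume "x \<noteq> z"
    obtain A B where AB: "x \<in> A" "z \<in> B" "A \<inter> B = {}" "A \<union> B = T" "conn E A" "conn E B" "joined E A B"
      using ex_split[OF vertex_partition(11) conn_T x(1) z(1) \<open>x \<noteq> z\<close> symE] by metis
    obtain l1 where l1: "leaf l1" "l1 \<notin> B" using ex_leaf[OF AB(6)] AB by blast
    obtain l2 where l2: "leaf l2" "l2 \<notin> A" using ex_leaf[OF AB(5)] AB by blast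
    have l1A: "l1 \<in> A" "A \<noteq> {l1}" "x \<in> A - {l1}" using l1 leaf_in(1)[OF l1(1)] AB x ly(2)[OF l1(1) y] by auto
    have l2B: "l2 \<in> B" using l2 leaf_in(1)[OF l2(1)] AB by auto
    have sub: "A \<subseteq> T" "B \<subseteq> T" using AB by auto
    have J: "joined E (A - {l1}) B" by (rule joined_minus_leaf_set[OF l1(1) AB(5) sub(1) l1A(1,2) AB(7)]) (use AB in auto)
    have p: "is_path E ((u # ys) @ [c] @ [v])" using path xs by simp
    then have cu: "conn E (set (u # ys))" using conn_set[of "[]" "u # ys" "[c] @ [v]"] by simp
    have uc: "(last (u # ys), c) \<in> E" using is_path_appendE[OF p] by simp
    have ysd: "set ys \<inter> T = {}" "u \<notin> set ys" "v \<notin> set ys" "set ys \<subseteq> V" using vertex_partition xs by auto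
    have "has_minor_using prism G u v"
    proof (rule prism_matching[of "set (u # ys)" "{l1}" "A - {l1}" "{v}" "{c}" B])
      show "conn E (set (u # ys))" by (rule cu)
      show "conn E (A - {l1})" using leaf_remove l1 l1A AB sub by auto
      show "joined E (set (u # ys)) {l1}" using leaf_u[OF l1(1)] by (auto intro: joinedI)
      show "joined E (set (u # ys)) (A - {l1})" using x y l1A by (auto intro: joinedI)
      show "joined E {l1} (A - {l1})" using leaf_joined[OF AB(5) l1A(1,2)] .
      show "joined E {v} B" using z AB by (auto intro: joinedI)
      show "joined E {c} B" using lc(2)[OF l2(1)] l2B by (auto intro: joinedI)
          show "set (u # ys) \<union> {l1} \<union> (A - {l1}) \<union> {v} \<union> {c} \<union> B \<subseteq> V"
        using ysd sub TV cT(4) uv l1A(1) by auto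
      show "set (u # ys) \<inter> ({l1} \<union> (A - {l1}) \<union> {v} \<union> {c} \<union> B) = {}"
        using ysd(1-3) sub TV cT(2) cy uv(3) l1A(1) by auto
      show "{l1} \<inter> ((A - {l1}) \<union> {v} \<union> {c} \<union> B) = {}" "(A - {l1}) \<inter> ({v} \<union> {c} \<union> B) = {}"
        "{v} \<inter> ({c} \<union> B) = {}" "{c} \<inter> B = {}"
        using AB(3) sub TV cT l1A(1) by auto
    qed (use lc[OF l1(1)] cv J AB(6) uc in \<open>auto intro: joinedI\<close>)
    then show False using no_prism by blast
  qed
  have zy: "(z, y) \<in> E" "(y, z) \<in> E" if y: "y \<in> set ys" for y
  proof -
    have "joined E {y} T" using y xs by (intro joined_T) simp
    then obtain t where "t \<in> T" "(y, t) \<in> E" by (auto simp: joined_def)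
    then show "(y, z) \<in> E" using yunique[OF y] by blast
    then show "(z, y) \<in> E" by (rule E_sym)
  qed
  \<comment> \<open>Two such vertices, consecutive on the path, form a triangle with
    \<open>z\<close> that is disjoint from the connection \<open>{l, c}\<close>.\<close>
  have len: "length ys \<le> 1"
  proof (rule ccontr)
    assume "\<not> length ys \<le> 1"
    then obtain y1 y2 ys' where ys: "ys = y1 # y2 # ys'" by (cases ys; cases "tl ys") auto
    obtain l where l: "leaf l" using ex_leaf[OF conn_singleton singleton_psubset[OF z(1)]] by blast
    have "is_path E ([] @ [y1, y2] @ (ys' @ [c]))" using path_xs(1) xs ys by simp
    then have c2: "conn E {y1, y2}" using conn_set[of "[]" "[y1, y2]" "ys' @ [c]"] by simp
    have "linking {l, c}"
      using conn_insert[OF symE, of "{c}" l] lc[OF l] leaf_u[OF l] cv cT leafT[OF l] vertex_partition by (auto simp: linking_def)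
    moreover have "y1 \<noteq> y2" "y1 \<in> set xs" "y2 \<in> set xs" "y1 \<noteq> c" "y2 \<noteq> c" using vertex_partition(8) xs ys by auto
    ultimately show False
      using zy[of y1] zy[of y2] ys c2 z leafT[OF l] cT vertex_partition
      by (intro two_edges_avoid[of "{l, c}" "{z}" "{y1, y2}" z z y1 y2]) auto
  qed
  \<comment> \<open>The components of \<open>T - {z}\<close> are shown to be singletons, which makes
    \<open>T\<close> a star.\<close>
  have single: "leaf q \<and> (q, z) \<in> E" if q: "q \<in> T - {z}" for q
  proof -
    obtain Q where Q: "q \<in> Q" "Q \<subseteq> T - {z}" "conn E Q" "\<not> joined E Q (T - {z} - Q)"
      using ex_component[of "T - {z}" q E] q vertex_partition symE by auto
    have cQ: "conn E (T - Q)" using conn_outside_component[OF z(1) Q(2) _ Q(4)] Q(1) by blast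
    obtain l' where l': "leaf l'" "l' \<in> T - Q"
      using ex_leaf[OF Q(3)] leaf_in Q(2) z(1) by (metis DiffI Diff_iff insertI1 psubsetI subsetD subsetI)
    have zQ: "z \<in> T - Q" using z Q by auto
    have JQ: "joined E Q (T - Q)" using Q z by (intro conn_joined[OF conn_T]) auto
    then have JQz: "joined E Q {z}" using Q(4) by (auto simp: joined_def)
    have "Q = {q}"
    proof (rule ccontr)
      assume nq: "Q \<noteq> {q}"
      have TQ: "T - Q \<subset> T" using Q by auto
      obtain l where l: "leaf l" "l \<in> Q" using ex_leaf[OF cQ TQ] leaf_in(1) by blast
      have QT: "Q \<subseteq> T" and lQ: "Q \<noteq> {l}" using Q nq by auto
      have cl: "conn E (Q - {l})" using leaf_remove[OF l(1) Q(3) QT l(2) lQ] .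
      have Jz: "joined E (Q - {l}) {z}" by (rule joined_minus_leaf_set[OF l(1) Q(3) QT l(2) lQ JQz]) (use zQ in auto)
      \<comment> \<open>\<open>{l, z}\<close> is no cut, so the component without its leaf has
        another neighbour, and only \<open>u\<close> and \<open>c\<close> remain possible. The
        former gives a prism, the latter a cycle through \<open>c\<close> inside the component, off
        the connection \<open>T - Q\<close>.\<close>
      have "joined E (Q - {l}) (V - (Q - {l}) - {l, z})"
        using conn_nonempty[OF cl] QT TV uv zQ by (intro joined_outside[of "Q - {l}" "{l, z}" v]) (auto simp: card_insert_if leafT[OF l(1)] z(1))
      then obtain s t where st': "s \<in> Q - {l}" "t \<in> V - (Q - {l}) - {l, z}" "(s, t) \<in> E"
        unfolding joined_def by blast
      then have st: "s \<in> Q - {l}" "(s, t) \<in> E" "t \<in> V" "t \<notin> Q" "t \<noteq> z" by auto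
      have "t \<notin> T" using st Q(4) by (auto simp: joined_def)
      moreover have "t \<noteq> v" using zunique[of s] st Q(2) E_sym by auto
      moreover have "t \<notin> set ys" using yunique[of t s] st Q(2) E_sym by auto
      ultimately consider "t = u" | "t = c" using st(3) vertex_partition(10) xs by auto
      then show False
      proof cases
        case 1
        have "has_minor_using prism G u v"
        proof (rule prism_matching[of "{u}" "{l}" "Q - {l}" "{v}" "{c}" "T - Q"])
          show "joined E {u} (Q - {l})" using st 1 E_sym by (auto intro: joinedI)
          show "joined E {l} (Q - {l})" using leaf_joined[OF Q(3) l(2) lQ] .
          show "joined E {v} (T - Q)" using z zQ by (auto intro: joinedI)
          show "joined E {c} (T - Q)" using lc(2)[OF l'(1)] l' by (auto intro: joinedI)
          show "joined E (Q - {l}) (T - Q)" using joined_mono[OF Jz order_refl, of "T - Q"] zQ by simp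
        qed (use lc[OF l(1)] leaf_u[OF l(1)] cv cQ cl QT l TV cT uv leafT[OF l(1)] in auto)
        then show False using no_prism by blast
      next
        case 2
        have "linking (T - Q)"
          using cQ leaf_u[OF l'(1)] l' z zQ by (intro linking_in_T) (auto intro: joinedI)
        then show False
          using st(1,2) 2 lc[OF l(1)] E_sym Q QT l cT vertex_partition
          by (intro two_edges_avoid[of "T - Q" "{c}" Q c c l s]) auto
      qed
    qed
    then have "leaf q" using cQ q by (auto simp: leaf_def)
    moreover have "(q, z) \<in> E" using JQz \<open>Q = {q}\<close> by simp
    ultimately show ?thesis by blast
  qed
  have vT: "(v, t) \<in> E \<longleftrightarrow> t = z" if "t \<in> T" for t using zunique[OF that] z by auto
  have vys: "(v, y) \<notin> E" if y: "y \<in> set ys" for y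
  proof
    assume "(v, y) \<in> E"
    moreover obtain p r where "ys = p @ y # r" using y by (meson split_list)
    ultimately show False using chord_v[of p y "r @ [c]"] xs by simp
  qed
  have TT: "(s, t) \<notin> E" if "s \<in> T - {z}" "t \<in> T - {z}" for s t
    using leaf_unique[of s t z] single[OF that(1)] that z by auto
  have Yeq: "V - {u, c, z} = {v} \<union> set ys \<union> (T - {z})"
    using vertex_partition xs cT cy uv z by auto
  show ?thesis
    unfolding K3_like_def
  proof (intro exI[of _ "{u, c, z}"] conjI ballI)
    show "{u, c, z} \<subseteq> V" using uv cT z vertex_partition by auto
    show "card {u, c, z} = 3" using cT z vertex_partition by (auto simp: card_insert_if)
  next
    fix a b assume a: "a \<in> {u, c, z}" and "b \<in> V - {u, c, z}"
    then consider "b = v" | "b \<in> set ys" | "b \<in> T - {z}" unfolding Yeq by blast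
    then show "(a, b) \<in> E"
    proof cases
      case 1
      then show ?thesis using a root cv z E_sym by auto
    next
      case 2
      then have ys: "ys = [b]" using len by (cases ys) auto
      then have "(u, b) \<in> E" "(b, c) \<in> E" using path_xs xs by (auto simp: is_path_def)
      then show ?thesis using a zy[OF 2] E_sym by auto
    next
      case 3
      then show ?thesis using single[OF 3] a leaf_u lc E_sym by auto
    qed
  next
    fix a b assume ab: "a \<in> V - {u, c, z}" "b \<in> V - {u, c, z}"
    have ysys: "(a, b) \<notin> E" if "a \<in> set ys" "b \<in> set ys"
      using that len E_irrefl by (cases ys) auto
    have ysT: "(a, b) \<notin> E \<and> (b, a) \<notin> E" if "a \<in> set ys" "b \<in> T - {z}" for a b
      using yunique[OF that(1)] that E_sym by auto
    have vY: "(v, b) \<notin> E \<and> (b, v) \<notin> E" if "b \<in> {v} \<union> set ys \<union> (T - {z})" for b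
      using that vT vys E_sym by auto
    show "(a, b) \<notin> E"
      using ab ysys ysT[of a b] ysT[of b a] vY[of a] vY[of b] TT[of a b] unfolding Yeq by auto
  qed
qed

end

end

lemma K3_likeI:
  assumes "pverts G = X \<union> Y" "X \<inter> Y = {}" "card X = 3" "\<forall>x\<in>X. \<forall>y\<in>Y. (x, y) \<in> parcs G"
    "\<forall>y\<in>Y. \<forall>z\<in>Y. (y, z) \<notin> parcs G"
  shows "K3_like G"
proof -
  have "pverts G - X = Y" using assms(1,2) by blast
  then show ?thesis unfolding K3_like_def using assms by (intro exI[of _ X]) auto
qed

section \<open>Leaves at both ends of the root edge\<close>

context no_prism
begin

text \<open>An edge from \<open>v\<close> to the rest \<open>M\<close> of the tree gives the
  triangles \<open>u\<close>, \<open>w\<close>, \<open>l\<close> and \<open>v\<close>,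
  \<open>l'\<close>, \<open>M\<close>, matched by \<open>w\<close> with \<open>l'\<close> and
  \<open>l\<close> with \<open>M\<close>.\<close>

lemma single_inner_wheel_aux:
  assumes w: "xs = [w]" and l: "leaf l" "(u, l) \<in> E" "(w, l) \<in> E" and l': "leaf l'" "(v, l') \<in> E" "(w, l') \<in> E"
    and ne: "l \<noteq> l'"
  shows "\<not> joined E {v} (T - {l, l'})"
proof
  assume v: "joined E {v} (T - {l, l'})"
  have c3: "3 \<le> card T" using card_T card_ge_6 w by simp
  note M = two_leaves_rest[OF l(1) l'(1) ne c3]
  have TV: "T \<subseteq> V" "u \<notin> T" "v \<notin> T" "w \<notin> T" "w \<in> V" "w \<noteq> u" "w \<noteq> v" using vertex_partition w by auto
  have lT: "l \<in> T" "l' \<in> T" using leaf_in(1) l(1) l'(1) by auto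
  have "has_minor_using prism G u v"
  proof (rule prism_matching[of "{u}" "{w}" "{l}" "{v}" "{l'}" "T - {l, l'}"])
    show "joined E {u} {w}" using path_xs w by simp
  qed (use v M l l' lT ne TV uv in auto)
  then show False using no_prism by blast
qed

text \<open>The hub is \<open>w\<close>. Apart from \<open>l\<close> and \<open>l'\<close> no tree
  vertex sees \<open>u\<close> or \<open>v\<close>, so the tree has no third leaf and is a path that
  closes through \<open>v\<close> and \<open>u\<close> to the rim.\<close>

lemma single_inner_wheel:
  assumes w: "xs = [w]" and l: "leaf l" "(u, l) \<in> E" and l': "leaf l'" "(v, l') \<in> E"
  shows "wheel_like G"
proof -
  have nl: "(v, l) \<notin> E" "(u, l') \<notin> E" using leaf_not_both l l' by auto
  then have ne: "l \<noteq> l'" using l by auto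
  have inner: "(w, l) \<in> E" if lf: "leaf l" for l
  proof -
    obtain a where a: "(l, a) \<in> E" "a \<in> set (u # xs @ [v])" "a \<noteq> u" using leaf_cycle_neighbour[OF lf] by metis
    obtain b where b: "(l, b) \<in> E" "b \<in> set (u # xs @ [v])" "b \<noteq> v" using leaf_cycle_neighbour[OF lf] by metis
    have "\<not> ((l, u) \<in> E \<and> (l, v) \<in> E)" using leaf_not_both[OF lf] E_sym by blast
    then have "(l, w) \<in> E" using a b w by auto
    then show ?thesis by (rule E_sym)
  qed
  let ?M = "T - {l, l'}"
  have vM: "\<not> joined E {v} ?M"
    using single_inner_wheel_aux[OF w l inner[OF l(1)] l' inner[OF l'(1)] ne] .
  interpret m: no_prism G v u "rev xs" T by (rule mirror)
  have "\<not> joined E {u} (T - {l', l})"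
    using m.single_inner_wheel_aux[of w l' l] w l l' inner ne by (simp add: m.leaf_def leaf_def)
  then have uM: "\<not> joined E {u} ?M" by (simp add: insert_commute)
  have leaves: "t = l \<or> t = l'" if "leaf t" for t
    using leaf_sees_root[OF that] leaf_in(1)[OF that] uM vM by (auto simp: joined_def)
  have lT: "l \<in> T" "l' \<in> T" using leaf_in(1) l(1) l'(1) by auto
  obtain ts where ts: "is_path E ts" "hd ts = l" "last ts = l'" "set ts \<subseteq> T"
    using conn_path[OF conn_T lT] by metis
  have tne: "ts \<noteq> []" using ts by (auto simp: is_path_def)
  have tsT: "set ts = T"
  proof (rule ccontr)
    assume "set ts \<noteq> T"
    then obtain t where "leaf t" "t \<notin> set ts" using ex_leaf[OF is_path_conn[OF symE ts(1)]] ts(4) by blast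
    then show False using leaves ts(2,3) tne by (metis hd_in_set last_in_set)
  qed
  have chordless: "q = []" if e: "ts = p @ a # q @ b # r" "(a, b) \<in> E" for p a q b r
  proof (rule ccontr)
    assume "q \<noteq> []"
    have "ts = p @ (a # q @ [b]) @ r" using e by simp
    then have "is_path E (a # q @ [b])"
      using is_path_appendD(2)[of E p "(a # q @ [b]) @ r"] is_path_appendD(1)[of E "a # q @ [b]" r] ts(1) by simp
    then have "is_cycle E (a # q @ [b])" using \<open>q \<noteq> []\<close> E_sym[OF e(2)] by (cases q) (auto simp: is_cycle_def)
    moreover have "set (a # q @ [b]) \<subseteq> T" using ts(4) e(1) by auto
    ultimately show False using acyclic_T unfolding has_cycle_def by blast
  qed
  have V: "V = {u, v, w} \<union> T" using vertex_partition w by auto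
  \<comment> \<open>An inner vertex of the path has a third neighbour, which is not in the chordless
    path and is neither \<open>u\<close> nor \<open>v\<close>.\<close>
  have wT: "(w, t) \<in> E" if t: "t \<in> T" for t
  proof (cases "t = l \<or> t = l'")
    case True
    then show ?thesis using inner l l' by auto
  next
    case False
    obtain p r where pr: "ts = p @ t # r" using t tsT by (meson split_list)
    have "p \<noteq> []" "r \<noteq> []" using False pr ts(2,3) by auto
    then obtain p' a b r' where p: "p = p' @ [a]" and r: "r = b # r'" by (metis rev_exhaust list.exhaust)
    have d: "distinct ts" using ts(1) by (simp add: is_path_def)
    then have tab: "t \<noteq> a" "t \<noteq> b" using pr p r by auto
    have tV: "t \<in> V" using t V by auto
    obtain y where y: "(t, y) \<in> E" "y \<noteq> a" "y \<noteq> b" using ex_third_neighbour[OF tV tab] by metis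
    have "y \<notin> set p"
    proof
      assume "y \<in> set p"
      then obtain p1 p2 where "p' = p1 @ y # p2" using p y(2) by (auto dest!: split_list)
      then have "ts = p1 @ y # (p2 @ [a]) @ t # r" using pr p by simp
      then show False using chordless[OF _ E_sym[OF y(1)]] by blast
    qed
    moreover have "y \<notin> set r"
    proof
      assume "y \<in> set r"
      then obtain r1 r2 where "r' = r1 @ y # r2" using r y(3) by (auto dest!: split_list)
      then have "ts = p @ t # (b # r1) @ y # r2" using pr r by simp
      then show False using chordless[OF _ y(1)] by blast
    qed
    moreover have "y \<noteq> t" using E_neq[OF y(1)] by blast
    ultimately have "y \<notin> T" using tsT pr by auto
    moreover have "y \<noteq> u" "y \<noteq> v" using uM vM False t y(1) E_sym by (auto simp: joined_def)
    moreover have "y \<in> V" using E_verts[OF y(1)] by blast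
    ultimately have "y = w" using V by auto
    then show ?thesis using E_sym[OF y(1)] by simp
  qed
  have uT: "(u, t) \<in> E \<longleftrightarrow> t = l" if "t \<in> T" for t using that uM nl l(2) by (auto simp: joined_def)
  have vT: "(v, t) \<in> E \<longleftrightarrow> t = l'" if "t \<in> T" for t using that vM nl l'(2) by (auto simp: joined_def)
  have uvT: "u \<notin> T" "v \<notin> T" "w \<notin> T" "w \<noteq> u" "w \<noteq> v" using vertex_partition w by auto
  have "is_path E (ts @ [v])"
    using ts tne l' uvT E_sym by (subst is_path_append) (auto simp: is_path_def)
  then have path: "is_path E (u # ts @ [v])" using ts(2) tne l uvT uv tsT by (simp add: is_path_Cons hd_append)
  have len: "length ts \<ge> 1" using tne by (cases ts) auto
  show ?thesis
    unfolding wheel_like_def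
  proof (intro exI[of _ w] exI[of _ "u # ts @ [v]"] conjI ballI allI impI)
    show "V = insert w (set (u # ts @ [v]))" using V tsT by auto
    show "w \<notin> set (u # ts @ [v])" using uvT tsT by auto
    show "is_cycle E (u # ts @ [v])" using path uv len by (auto simp: is_cycle_def)
    show "(w, c) \<in> E" if "c \<in> set (u # ts @ [v])" for c
      using that wT tsT path_xs w E_sym by auto
    fix p a q b r assume e: "u # ts @ [v] = p @ a # q @ b # r" and ab: "(a, b) \<in> E"
    have d: "distinct (u # ts @ [v])" using path by (simp add: is_path_def)
    \<comment> \<open>A chord can start at \<open>u\<close>, end at \<open>v\<close>, or lie in
      \<open>ts\<close>; both \<open>u\<close> and \<open>v\<close> have a single neighbour in the
      tree, an end of \<open>ts\<close>. With both lists empty the edge is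
      \<open>uv\<close>.\<close>
    consider "p = []" "r = []" | "p = []" "r \<noteq> []" | "p \<noteq> []" "r = []" | "p \<noteq> []" "r \<noteq> []" by blast
    then show "q = [] \<or> p = [] \<and> r = []"
    proof cases
      case 2
      then obtain r' where r: "r = r' @ [v]" "ts = q @ b # r'" "a = u"
        using e by (cases r rule: rev_cases) auto
      then have "b = l" using uT[of b] ab tsT by auto
      then have "q = []" using r(2) ts(2) d by (cases q) auto
      then show ?thesis by blast
    next
      case 3
      then obtain p' where p: "p = u # p'" "ts = p' @ a # q" "b = v"
        using e by (cases p) (auto simp: append_eq_append_conv2 Cons_eq_append_conv)
      then have "a = l'" using vT[of a] E_sym[OF ab] tsT by auto
      then have "q = []" using p(2) ts(3) d by (cases q rule: rev_cases) auto
      then show ?thesis by blast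
    next
      case 4
      obtain p' where p: "p = u # p'" using e 4 by (cases p) auto
      obtain r' where r: "r = r' @ [v]" using e 4 by (cases r rule: rev_cases) auto
      have "ts = p' @ a # q @ b # r'" using e p r by simp
      then show ?thesis using chordless ab by blast
    qed blast
  qed
qed

text \<open>If the leaf sees an earlier inner vertex, the rest of \<open>T\<close> cannot reach the
  last one; its neighbour in \<open>T\<close> must be the leaf.\<close>

lemma leaf_at_last:
  assumes l: "leaf l" "(u, l) \<in> E"
  shows "(l, last xs) \<in> E"
proof -
  have nl: "(v, l) \<notin> E" using leaf_not_both l by blast
  obtain c where c: "(l, c) \<in> E" "c \<in> set (u # xs @ [v])" "c \<noteq> u" using leaf_cycle_neighbour[OF l(1)] by metis
  then have "c \<in> set xs" using nl E_sym by auto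
  then obtain p r where xs: "xs = p @ c # r" by (meson split_list)
  show ?thesis
  proof (cases r rule: rev_cases)
    case Nil
    then show ?thesis using c xs by simp
  next
    case (snoc r' b)
    then have xs': "xs = p @ c # r' @ b # []" using xs by simp
    have "\<not> joined E {b} (T - {l})" by (rule leaf_blocks_later[OF l nl xs' c(1)])
    then have "(b, l) \<in> E" using joined_minus_leaf[of b l] xs' by auto
    then show ?thesis using xs' E_sym by simp
  qed
qed

text \<open>\<open>{hd xs, l'}\<close> links \<open>u\<close> to \<open>v\<close>. Off it lie the
  remaining path and \<open>T - {l'}\<close>, already joined by the edge from \<open>l\<close> to
  \<open>last xs\<close>; a second edge would close a cycle.\<close>

lemma later_in_path_only:
  assumes l: "leaf l" "(u, l) \<in> E" and l': "leaf l'" "(v, l') \<in> E"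
    and hd: "(l', hd xs) \<in> E" and xs: "xs = hd xs # ys" "ys \<noteq> []" and c: "c \<in> set ys" "t \<in> T - {l'}" "(c, t) \<in> E"
  shows "c = last xs" "t = l"
proof -
  have nl: "(v, l) \<notin> E" "(u, l') \<notin> E" using leaf_not_both l l' by auto
  then have ne: "l \<noteq> l'" using l by auto
  have T: "T \<subseteq> V" "u \<notin> T" "v \<notin> T" "T \<inter> set xs = {}" "set xs \<subseteq> V - {u, v}" "distinct xs" using vertex_partition by auto
  have lT: "l \<in> T" "l' \<in> T" using leaf_in(1) l(1) l'(1) by auto
  have hx: "hd xs \<in> set xs" "hd xs \<notin> set ys" "set ys \<subseteq> set xs" "last xs \<in> set ys" "last xs = last ys"
    using xs T(6) by (metis list.set_intros(1), metis distinct.simps(2), metis set_subset_Cons, metis last_ConsR last_in_set, metis last_ConsR)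
  have link: "linking {hd xs, l'}"
    using conn_insert[OF symE conn_singleton, of l' "hd xs"] hd l' path_xs T lT hx by (auto simp: linking_def)
  have cys: "conn E (set ys)" using path_xs(1) xs is_path_conn[OF symE] by (metis is_path_Cons)
  have "c = last xs \<and> t = l"
  proof (rule ccontr)
    assume "\<not> (c = last xs \<and> t = l)"
    then show False
      using link cys leaf_in(2)[OF l'(1)] c E_sym leaf_at_last[OF l] hx T lT ne
      by (intro two_edges_avoid[of "{hd xs, l'}" "T - {l'}" "set ys" l t "last xs" c]) auto
  qed
  then show "c = last xs" "t = l" by auto
qed

text \<open>An edge from \<open>u\<close> to the rest \<open>M\<close> of the tree gives the
  triangles \<open>u\<close>, \<open>l\<close>, \<open>M\<close> and \<open>v\<close>,
  \<open>{x, y}\<close>, \<open>l'\<close>.\<close>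

lemma two_inner_aux:
  assumes xs: "xs = [x, y]" and l: "leaf l" "(u, l) \<in> E" "(l, y) \<in> E" and l': "leaf l'" "(v, l') \<in> E" "(l', x) \<in> E"
    and ne: "l \<noteq> l'" and c3: "3 \<le> card T"
  shows "\<not> joined E {u} (T - {l, l'})"
proof
  assume u: "joined E {u} (T - {l, l'})"
  note M = two_leaves_rest[OF l(1) l'(1) ne c3]
  have TV: "T \<subseteq> V" "u \<notin> T" "v \<notin> T" "x \<notin> T" "y \<notin> T" "x \<in> V" "y \<in> V" "x \<noteq> y" "x \<noteq> u" "x \<noteq> v" "y \<noteq> u" "y \<noteq> v"
    using vertex_partition xs by auto
  have xy: "(x, y) \<in> E" "(v, y) \<in> E" using path_xs xs E_sym by (auto simp: is_path_def)
  have lT: "l \<in> T" "l' \<in> T" using leaf_in(1) l(1) l'(1) by auto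
  have c: "conn E {x, y}" using conn_insert[OF symE conn_singleton, of y x] E_sym[OF xy(1)] by simp
  have J: "joined E {v} {x, y}" "joined E {x, y} {l'}" "joined E {l} {x, y}"
    using xy l l' E_sym by auto
  have "joined E (T - {l, l'}) {l'}" using M(3) by (simp only: joined_commute)
  then have "has_minor_using prism G u v"
    by (intro prism_matching[of "{u}" "{l}" "T - {l, l'}" "{v}" "{x, y}" "{l'}"])
      (use u M c J l l' lT ne TV uv in \<open>auto simp del: joined_insert\<close>)
  then show False using no_prism by blast
qed

lemma two_leaf_types:
  assumes l: "leaf l" "(u, l) \<in> E" and l': "leaf l'" "(v, l') \<in> E"
  shows "wheel_like G \<or> K3_like G"
proof (cases "length xs = 1")
  case True
  then obtain w where "xs = [w]" by (auto simp: length_Suc_conv)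
  then show ?thesis using single_inner_wheel l l' by blast
next
  case False
  interpret m: no_prism G v u "rev xs" T by (rule mirror)
  have nl: "(v, l) \<notin> E" "(u, l') \<notin> E" using leaf_not_both l l' by auto
  then have ne: "l \<noteq> l'" using l by auto
  have ml: "m.leaf l" "m.leaf l'" using l l' by (auto simp: m.leaf_def leaf_def)
  obtain x ys where xys: "xs = x # ys" "ys \<noteq> []" using False nonempty by (cases xs) (auto simp: length_Suc_conv)
  have ly: "(l, last xs) \<in> E" using leaf_at_last[OF l] .
  have l'x: "(l', x) \<in> E" using m.leaf_at_last[OF ml(2) l'(2)] xys by simp
  have later: "c = last xs \<and> t = l" if "c \<in> set ys" "t \<in> T - {l'}" "(c, t) \<in> E" for c t
    using later_in_path_only[OF l l' _ _ _ that] l'x xys by simp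
  obtain zs y where ys: "ys = zs @ [y]" using xys(2) by (cases ys rule: rev_cases) auto
  have xs': "xs = x # zs @ [y]" using xys ys by simp
  have earlier: "c = x \<and> t = l'" if c: "c \<in> set (x # zs)" "t \<in> T - {l}" "(c, t) \<in> E" for c t
  proof -
    have 1: "rev xs = hd (rev xs) # rev (x # zs)" "rev (x # zs) \<noteq> []" "(l, hd (rev xs)) \<in> E" "last (rev xs) = x"
      using ly xs' by simp_all
    have 2: "c \<in> set (rev (x # zs))" using c(1) by simp
    show ?thesis using m.later_in_path_only[OF ml(2) l'(2) ml(1) l(2) 1(3,1,2) 2 c(2,3)] 1(4) by blast
  qed
  \<comment> \<open>A vertex strictly between the ends has a neighbour in \<open>T\<close>. It is
    not \<open>l'\<close> by \<open>earlier\<close> and nothing else by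
    \<open>later\<close>.\<close>
  have "zs = []"
  proof (rule ccontr)
    assume "zs \<noteq> []"
    then obtain c where c: "c \<in> set zs" by (cases zs) auto
    then have "joined E {c} T" using xs' by (intro joined_T) auto
    then obtain t where t: "t \<in> T" "(c, t) \<in> E" by (auto simp: joined_def)
    have cxy: "c \<noteq> x" "c \<noteq> y" using vertex_partition(8) xs' c by auto
    show False
    proof (cases "t = l'")
      case True
      then show False using earlier[of c t] c t ne cxy by auto
    next
      case False
      have "last xs = y" "c \<in> set ys" using xs' ys c by auto
      then show False using later[of c t] False t cxy by auto
    qed
  qed
  then have xs: "xs = [x, y]" and ysy: "ys = [y]" using xs' ys by auto
  have lT: "l \<in> T" "l' \<in> T" using leaf_in(1) l(1) l'(1) by auto
  have TV: "T \<subseteq> V" "u \<notin> T" "v \<notin> T" "x \<notin> T" "y \<notin> T" "x \<in> V" "y \<in> V" "x \<noteq> y" "x \<noteq> u" "x \<noteq> v" "y \<noteq> u" "y \<noteq> v"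
    and Veq: "V = {u, v, x, y} \<union> T"
    using vertex_partition xs by auto
  have xy: "(x, y) \<in> E" "(y, v) \<in> E" "(u, x) \<in> E" "(l, y) \<in> E" "(l', x) \<in> E"
    using path_xs xs ly l'x by (auto simp: is_path_def)
  \<comment> \<open>Any further tree vertices would see none of \<open>u\<close>, \<open>v\<close>,
    \<open>x\<close>, \<open>y\<close>, so \<open>{l, l'}\<close> would cut them off.\<close>
  have "T = {l, l'}"
  proof (rule ccontr)
    assume "T \<noteq> {l, l'}"
    then have "{l, l'} \<subset> T" using lT by auto
    then have "card {l, l'} < card T" using vertex_partition(11) by (simp add: psubset_card_mono)
    then have c3: "3 \<le> card T" using ne by simp
    note M = two_leaves_rest[OF l(1) l'(1) ne c3]
    have "\<not> joined E {u} (T - {l, l'})" by (rule two_inner_aux[OF xs l xy(4) l' xy(5) ne c3])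
    moreover have "\<not> joined E {v} (T - {l', l})"
      using m.two_inner_aux[OF _ ml(2) l'(2) xy(5) ml(1) l(2) xy(4) ne[symmetric] c3] xs by simp
    moreover have "\<not> joined E {x} (T - {l, l'})" using earlier[of x] by (auto simp: joined_def)
    moreover have "\<not> joined E {y} (T - {l, l'})" using later[of y] ysy by (auto simp: joined_def)
    ultimately have n: "\<not> joined E (T - {l, l'}) {u}" "\<not> joined E (T - {l, l'}) {v}"
      "\<not> joined E (T - {l, l'}) {x}" "\<not> joined E (T - {l, l'}) {y}"
      using joined_commute by (auto simp: insert_commute)
    have "joined E (T - {l, l'}) (V - (T - {l, l'}) - {l, l'})"
      using conn_nonempty[OF M(1)] TV uv lT by (intro joined_outside[of "T - {l, l'}" "{l, l'}" u]) (auto simp: card_insert_if)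
    then obtain s t where st: "s \<in> T - {l, l'}" "t \<in> V" "t \<notin> T" "(s, t) \<in> E"
      using lT unfolding joined_def by blast
    then have "t \<in> {u, v, x, y}" using Veq by blast
    then show False using n st unfolding joined_def by blast
  qed
  note T = this
  have ll: "(l, l') \<in> E" using leaf_joined[OF conn_T lT(1)] ne by (auto simp: T joined_def)
  have nE: "(u, y) \<notin> E" "(v, x) \<notin> E"
    using chord_u[of "[x]" y "[]"] chord_v[of "[]" x "[y]"] xs by auto
  \<comment> \<open>These are the only undetermined edges, and both together would put an edge into
    each part of the bipartition below.\<close>
  have nE': "(x, l) \<notin> E \<or> (y, l') \<notin> E"
  proof (rule ccontr)
    assume a: "\<not> ((x, l) \<notin> E \<or> (y, l') \<notin> E)"
    have "\<not> joined E {y} (T - {l})"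
      using leaf_blocks_later[OF l nl(1), of "[]" x "[]" y "[]"] xs a E_sym by auto
    then show False using a lT ne by (auto simp: joined_def)
  qed
  have Vs: "V = {u, v, x, y, l, l'}" using Veq T by auto
  have d: "u \<noteq> l" "u \<noteq> l'" "v \<noteq> l" "v \<noteq> l'" "x \<noteq> l" "x \<noteq> l'" "y \<noteq> l" "y \<noteq> l'"
    using TV lT by auto
  note dist = TV(8-12) d d[symmetric] ne ne[symmetric] uv(3) uv(3)[symmetric] TV(8-12)[symmetric]
  note adj = root xy ll l(2) l'(2) root[THEN E_sym] xy[THEN E_sym] ll[THEN E_sym] l(2)[THEN E_sym] l'(2)[THEN E_sym]
  have nsym: "(y, u) \<notin> E" "(x, v) \<notin> E" "(l, v) \<notin> E" "(l', u) \<notin> E" using nE nl E_sym by blast+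
  \<comment> \<open>The nine forced edges form \<open>K_{3,3}\<close>. The part containing a
    possible tenth edge is taken as the part of size three in which edges are allowed.\<close>
  have "K3_like G"
  proof (cases "(x, l) \<in> E")
    case True
    then have n: "(y, l') \<notin> E" "(l', y) \<notin> E" using nE' E_sym by blast+
    show ?thesis
    proof (rule K3_likeI[of G "{v, x, l}" "{u, y, l'}"])
      show "V = {v, x, l} \<union> {u, y, l'}" using Vs by blast
    qed (simp_all add: adj dist n nE nl nsym)
  next
    case False
    then have n: "(x, l) \<notin> E" "(l, x) \<notin> E" using E_sym by blast+
    show ?thesis
    proof (rule K3_likeI[of G "{u, y, l'}" "{v, x, l}"])
      show "V = {u, y, l'} \<union> {v, x, l}" using Vs by blast
    qed (simp_all add: adj dist n nE nl nsym)
  qed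
  then show ?thesis by blast
qed

theorem wheel_or_K3: "wheel_like G \<or> K3_like G"
proof -
  interpret m: no_prism G v u "rev xs" T by (rule mirror)
  show ?thesis
  proof (cases "\<forall>l. leaf l \<longrightarrow> (u, l) \<in> E")
    case True
    then show ?thesis using only_leaves_at_u by blast
  next
    case False
    then obtain l' where l': "leaf l'" "(v, l') \<in> E" using leaf_sees_root by blast
    show ?thesis
    proof (cases "\<forall>l. leaf l \<longrightarrow> (v, l) \<in> E")
      case True
      have "K3_like G" by (rule m.only_leaves_at_u) (use True in \<open>auto simp: m.leaf_def leaf_def\<close>)
      then show ?thesis ..
    next
      case False
      then obtain l where "leaf l" "(u, l) \<in> E" using leaf_sees_root by blast
      then show ?thesis using two_leaf_types l' by blast
    qed
  qed
qed

end

section \<open>Isomorphisms\<close>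

text \<open>The map goes from the model into \<open>G\<close>, because the model's vertices are
  numbers and this amounts to an enumeration; the library isomorphism is its inverse.\<close>

lemma graph_isoI:
  assumes "pair_graph G" "bij_betw g (pverts H) (pverts G)" "parcs H \<subseteq> pverts H \<times> pverts H"
    and iff: "\<And>x y. x \<in> pverts H \<Longrightarrow> y \<in> pverts H \<Longrightarrow> (g x, g y) \<in> parcs G \<longleftrightarrow> (x, y) \<in> parcs H"
  shows "graph_iso G H"
proof -
  interpret pair_graph G by fact
  define f where "f = the_inv_into (pverts H) g"
  have inj: "inj_on g (pverts H)" and img: "g ` pverts H = pverts G" using assms(2) by (auto simp: bij_betw_def)
  have fg: "f (g x) = x" if "x \<in> pverts H" for x using that inj by (simp add: f_def the_inv_into_f_f)
  have fV: "f ` pverts G = pverts H" using fg unfolding img[symmetric] by force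
  have fi: "inj_on f (pverts G)" using fg unfolding img[symmetric] by (auto intro!: inj_onI)
  define m where "m = \<lparr>iso_verts = f, iso_arcs = map_prod f f, iso_head = snd, iso_tail = fst\<rparr>"
  have EV: "parcs G \<subseteq> pverts G \<times> pverts G" using wellformed' by auto
  have arcs: "map_prod f f ` parcs G = parcs H"
  proof (intro equalityI subsetI)
    fix e assume "e \<in> map_prod f f ` parcs G"
    then obtain a b where ab: "(a, b) \<in> parcs G" "e = (f a, f b)" by auto
    then obtain x y where "a = g x" "b = g y" "x \<in> pverts H" "y \<in> pverts H" using EV img by blast
    then show "e \<in> parcs H" using ab iff fg by auto
  next
    fix e assume e: "e \<in> parcs H"
    then obtain x y where xy: "e = (x, y)" "x \<in> pverts H" "y \<in> pverts H" using assms(3) by auto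
    then have "(g x, g y) \<in> parcs G" using iff e by auto
    then show "e \<in> map_prod f f ` parcs G" using xy fg by (intro image_eqI[of _ _ "(g x, g y)"]) auto
  qed
  have "inj_on (map_prod f f) (parcs G)"
    using map_prod_inj_on[OF fi fi] EV by (rule inj_on_subset)
  then have "pre_digraph.digraph_isomorphism (with_proj G) m"
    using fi by (auto simp: pre_digraph.digraph_isomorphism_def m_def intro: wf_digraph_axioms)
  moreover have "with_proj H = app_iso m (with_proj G)"
    using arcs fV by (simp add: app_iso_def m_def with_proj_def)
  ultimately show ?thesis by (auto simp: graph_iso_def digraph_iso_def)
qed

lemma graph_isoE:
  assumes "graph_iso G H"
  obtains f where "bij_betw f (pverts G) (pverts H)" "\<And>x y. (x, y) \<in> parcs G \<Longrightarrow> (f x, f y) \<in> parcs H"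
proof -
  obtain m where m: "pre_digraph.digraph_isomorphism (with_proj G) m" "with_proj H = app_iso m (with_proj G)"
    using assms by (auto simp: graph_iso_def digraph_iso_def)
  have eqs: "pverts H = iso_verts m ` pverts G" "parcs H = iso_arcs m ` parcs G" "fst = iso_tail m" "snd = iso_head m"
    using arg_cong[OF m(2), of verts] arg_cong[OF m(2), of arcs] arg_cong[OF m(2), of tail] arg_cong[OF m(2), of head] by simp_all
  show ?thesis
  proof (rule that[of "iso_verts m"])
    show "bij_betw (iso_verts m) (pverts G) (pverts H)"
      using m(1) eqs(1) by (auto simp: bij_betw_def pre_digraph.digraph_isomorphism_def)
    fix x y assume e: "(x, y) \<in> parcs G"
    then have "iso_verts m x = fst (iso_arcs m (x, y))" "iso_verts m y = snd (iso_arcs m (x, y))"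
      using m(1) by (auto simp: pre_digraph.digraph_isomorphism_def eqs(3,4))
    then have "(iso_verts m x, iso_verts m y) = iso_arcs m (x, y)" by (simp add: prod_eq_iff)
    then show "(iso_verts m x, iso_verts m y) \<in> parcs H" using e eqs(2) by auto
  qed
qed

lemma is_cycle_map:
  assumes "is_cycle R xs" "inj_on f (set xs)" "\<And>x y. (x, y) \<in> R \<Longrightarrow> (f x, f y) \<in> R'"
  shows "is_cycle R' (map f xs)"
proof -
  have "xs \<noteq> []" using assms(1) by (auto simp: is_cycle_def)
  then show ?thesis
    using assms by (auto simp: is_cycle_def is_path_def distinct_map successively_map hd_map last_map elim!: successively_mono)
qed

section \<open>Disjoint cycles in wheels, in complete bipartite graphs with extra edges, and in
  graphs with a prism minor\<close>

definition two_disjoint_cycles :: "'a pair_pre_digraph \<Rightarrow> bool" where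
  "two_disjoint_cycles G \<longleftrightarrow> (\<exists>xs ys. is_cycle (parcs G) xs \<and> is_cycle (parcs G) ys \<and>
     set xs \<subseteq> pverts G \<and> set ys \<subseteq> pverts G \<and> set xs \<inter> set ys = {})"

lemma two_disjoint_cycles_iso:
  assumes "graph_iso G H" "two_disjoint_cycles G"
  shows "two_disjoint_cycles H"
proof -
  obtain f where f: "bij_betw f (pverts G) (pverts H)" "\<And>x y. (x, y) \<in> parcs G \<Longrightarrow> (f x, f y) \<in> parcs H"
    using graph_isoE[OF assms(1)] by blast
  obtain xs ys where c: "is_cycle (parcs G) xs" "is_cycle (parcs G) ys"
    "set xs \<subseteq> pverts G" "set ys \<subseteq> pverts G" "set xs \<inter> set ys = {}"
    using assms(2) by (auto simp: two_disjoint_cycles_def)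
  have inj: "inj_on f (pverts G)" and img: "f ` pverts G = pverts H" using f(1) by (auto simp: bij_betw_def)
  have "is_cycle (parcs H) (map f xs)" "is_cycle (parcs H) (map f ys)"
    using is_cycle_map[OF c(1) inj_on_subset[OF inj c(3)] f(2)] is_cycle_map[OF c(2) inj_on_subset[OF inj c(4)] f(2)] by auto
  moreover have "f ` set xs \<inter> f ` set ys = {}" using inj_on_image_Int[OF inj c(3,4)] c(5) by simp
  moreover have "f ` set xs \<subseteq> pverts H" "f ` set ys \<subseteq> pverts H" using img c(3,4) by auto
  ultimately show ?thesis unfolding two_disjoint_cycles_def by (intro exI[of _ "map f xs"] exI[of _ "map f ys"]) auto
qed

lemma sym_symcl: "sym (symcl R)"
  by (auto simp: sym_def symcl_def)

lemma cycle_two_neighbours: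
  assumes "is_cycle (symcl R) xs" "x \<in> set xs"
  obtains a b where "a \<in> set xs" "b \<in> set xs" "a \<noteq> b" "(x, a) \<in> symcl R" "(x, b) \<in> symcl R"
  using is_cycle_distinct_edges[OF sym_symcl assms] by metis

lemma wheel_adj:
  assumes "i \<noteq> 0" "j \<noteq> 0" "(i, j) \<in> parcs (wheel n)"
  shows "j = i + 1 \<and> i < n \<or> i = j + 1 \<and> j < n \<or> i = n \<and> j = 1 \<or> i = 1 \<and> j = n"
  using assms by (auto simp: wheel_def symcl_def)

text \<open>A vertex of a cycle off the hub has both rim neighbours on the cycle, so the cycle is
  closed under taking successors and runs through the whole rim.\<close>

lemma wheel_cycle_rim:
  assumes n: "3 \<le> n" and c: "is_cycle (parcs (wheel n)) xs" "set xs \<subseteq> pverts (wheel n)" "0 \<notin> set xs"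
  shows "{1..n} \<subseteq> set xs"
proof -
  have nbr: "(if x = n then 1 else x + 1) \<in> set xs" if x: "x \<in> set xs" for x
  proof -
    have c': "is_cycle (symcl ({(0, i) | i. 1 \<le> i \<and> i \<le> n} \<union> {(i, i + 1) | i. 1 \<le> i \<and> i < n} \<union> {(n, 1)})) xs"
      using c(1) by (simp add: wheel_def)
    obtain a b where ab: "a \<in> set xs" "b \<in> set xs" "a \<noteq> b" "(x, a) \<in> parcs (wheel n)" "(x, b) \<in> parcs (wheel n)"
      using cycle_two_neighbours[OF c' x] by (auto simp: wheel_def)
    have "x \<noteq> 0" "a \<noteq> 0" "b \<noteq> 0" using c(3) ab x by metis+
    then show ?thesis using wheel_adj[of x a n] wheel_adj[of x b n] ab n by (auto split: if_splits)
  qed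
  obtain x0 where x0: "x0 \<in> set xs" using c(1) by (cases xs) (auto simp: is_cycle_def)
  then have "x0 \<in> {1..n}" using c(2,3) by (cases "x0 = 0") (auto simp: wheel_def)
  have up: "y \<in> set xs" if "x \<in> set xs" "x \<le> y" "y \<le> n" for x y
    using that(2,3,1)
  proof (induction rule: dec_induct)
    case (step m)
    then show ?case using nbr[of m] by auto
  qed
  have "n \<in> set xs" using up[OF x0, of n] \<open>x0 \<in> {1..n}\<close> by auto
  then have "1 \<in> set xs" using nbr[of n] by simp
  then show ?thesis using up[of 1] by auto
qed

lemma not_two_disjoint_cycles_wheel: "3 \<le> n \<Longrightarrow> \<not> two_disjoint_cycles (wheel n)"
proof
  assume n: "3 \<le> n" and "two_disjoint_cycles (wheel n)"
  then obtain xs ys where c: "is_cycle (parcs (wheel n)) xs" "is_cycle (parcs (wheel n)) ys"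
    "set xs \<subseteq> pverts (wheel n)" "set ys \<subseteq> pverts (wheel n)" "set xs \<inter> set ys = {}"
    by (auto simp: two_disjoint_cycles_def)
  have main: False if c: "is_cycle (parcs (wheel n)) xs" "is_cycle (parcs (wheel n)) ys"
    "set xs \<subseteq> pverts (wheel n)" "set ys \<subseteq> pverts (wheel n)" "set xs \<inter> set ys = {}" "0 \<notin> set xs" for xs ys
  proof -
    have "set ys \<subseteq> {0}"
    proof
      fix y assume y: "y \<in> set ys"
      then have "y \<notin> {1..n}" using wheel_cycle_rim[OF n c(1,3,6)] c(5) by blast
      moreover have "y \<le> n" using y c(4) by (auto simp: wheel_def)
      ultimately show "y \<in> {0}" by simp
    qed
    then have "card (set ys) \<le> 1" using card_mono[of "{0::nat}" "set ys"] by simp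
    then show False using c(2) by (auto simp: is_cycle_def is_path_def distinct_card)
  qed
  show False
  proof (cases "0 \<in> set xs")
    case True
    then show False using main[of ys xs] c by blast
  next
    case False
    then show False using main[of xs ys] c by blast
  qed
qed

text \<open>A cycle vertex in the large part has two cycle neighbours among the three special
  vertices; a cycle without such a vertex lies inside the triple. Two disjoint cycles would thus
  need four special vertices.\<close>

lemma K3_plus_cycle:
  assumes "E0 \<subseteq> {0..<3} \<times> {0..<3}" "is_cycle (parcs (K3_plus E0 n)) xs"
  shows "2 \<le> card (set xs \<inter> {0..<3})"
proof (rule ccontr)
  assume "\<not> 2 \<le> card (set xs \<inter> {0..<3})"
  note small = this
  have one: "a = b" if "a \<in> set xs" "b \<in> set xs" "a < 3" "b < 3" for a b
  proof (rule ccontr)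
    assume "a \<noteq> b"
    moreover have "card {a, b} \<le> card (set xs \<inter> {0..<3})" using that by (intro card_mono) auto
    ultimately show False using small by simp
  qed
  have nb: "\<exists>a b. a \<in> set xs \<and> b \<in> set xs \<and> a \<noteq> b \<and> (x, a) \<in> parcs (K3_plus E0 n) \<and> (x, b) \<in> parcs (K3_plus E0 n)"
    if x: "x \<in> set xs" for x
  proof -
    have "is_cycle (symcl ({0..<3} \<times> {3..<n + 3} \<union> E0)) xs" using assms(2) by (simp add: K3_plus_def)
    from cycle_two_neighbours[OF this x] obtain a b where "a \<in> set xs" "b \<in> set xs" "a \<noteq> b"
      "(x, a) \<in> symcl ({0..<3} \<times> {3..<n + 3} \<union> E0)" "(x, b) \<in> symcl ({0..<3} \<times> {3..<n + 3} \<union> E0)" .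
    then show ?thesis by (intro exI[of _ a] exI[of _ b]) (simp add: K3_plus_def)
  qed
  have big: "x < 3" if x: "x \<in> set xs" for x
  proof (rule ccontr)
    assume "\<not> x < 3"
    obtain a b where ab: "a \<in> set xs" "b \<in> set xs" "a \<noteq> b" "(x, a) \<in> parcs (K3_plus E0 n)" "(x, b) \<in> parcs (K3_plus E0 n)"
      using nb[OF x] by blast
    then have "a < 3" "b < 3" using \<open>\<not> x < 3\<close> assms(1) by (auto simp: K3_plus_def symcl_def)
    then show False using one ab by blast
  qed
  obtain x where "x \<in> set xs" using assms(2) by (cases xs) (auto simp: is_cycle_def)
  then show False using nb[of x] one big by blast
qed

lemma not_two_disjoint_cycles_K3_plus:
  assumes "E0 \<subseteq> {0..<3} \<times> {0..<3}"
  shows "\<not> two_disjoint_cycles (K3_plus E0 n)"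
proof
  assume "two_disjoint_cycles (K3_plus E0 n)"
  then obtain xs ys where c: "is_cycle (parcs (K3_plus E0 n)) xs" "is_cycle (parcs (K3_plus E0 n)) ys" "set xs \<inter> set ys = {}"
    by (auto simp: two_disjoint_cycles_def)
  have "card (set xs \<inter> {0..<3}) + card (set ys \<inter> {0..<3}) = card ((set xs \<inter> {0..<3}) \<union> (set ys \<inter> {0..<3}))"
    using c(3) by (intro card_Un_disjoint[symmetric]) auto
  also have "\<dots> \<le> card {0..<3::nat}" by (intro card_mono) auto
  finally show False using K3_plus_cycle[OF assms c(1)] K3_plus_cycle[OF assms c(2)] by simp
qed

context rooted_graph
begin

lemma triangle_has_cycle:
  assumes "conn E A" "conn E B" "conn E C" "A \<inter> B = {}" "A \<inter> C = {}" "B \<inter> C = {}"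
    "joined E A B" "joined E A C" "joined E B C"
  shows "has_cycle E (A \<union> (B \<union> C))"
proof -
  obtain a b a' c where "a \<in> A" "b \<in> B" "(a, b) \<in> E" "a' \<in> A" "c \<in> C" "(a', c) \<in> E"
    using assms(7,8) by (auto simp: joined_def)
  then show ?thesis
    using assms by (intro has_cycle_two_edges[OF symE, of A "B \<union> C" a a' b c] conn_Un[OF symE]) auto
qed

lemma square_has_cycle:
  assumes "conn E A" "conn E B" "conn E C" "conn E D" "(A \<union> B) \<inter> (C \<union> D) = {}" "A \<inter> B = {}"
    "joined E A B" "joined E C D" "joined E A C" "joined E B D"
  shows "has_cycle E ((A \<union> B) \<union> (C \<union> D))"
proof -
  obtain a b c d where "a \<in> A" "c \<in> C" "(a, c) \<in> E" "b \<in> B" "d \<in> D" "(b, d) \<in> E"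
    using assms(9,10) by (auto simp: joined_def)
  then show ?thesis
    using assms by (intro has_cycle_two_edges[OF symE, of "A \<union> B" "C \<union> D" a b c d] conn_Un[OF symE]) auto
qed

text \<open>The root ends lie in two different branch sets, so the other four avoid both. They
  contain the opposite triangle if the root is a triangle edge, and a quadrilateral if it is a
  matching edge. The two triangles give the disjoint cycles.\<close>

lemma prism_cycles:
  assumes "has_minor_using prism G u v"
  shows "has_cycle E (V - {u, v})" "two_disjoint_cycles G"
proof -
  obtain B x y where B: "minor_model prism G B" and xy: "(x, y) \<in> parcs prism" "B x \<inter> {u, v} \<noteq> {}" "B y \<inter> {u, v} \<noteq> {}"
    using assms by (auto simp: has_minor_using_def)
  have c: "conn E (B i)" "B i \<subseteq> V" if "i < 6" for i
    using B that connected_iff_conn[OF graph] by (auto simp: minor_model_def prism_def)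
  have d: "B i \<inter> B j = {}" if "i < 6" "j < 6" "i \<noteq> j" for i j
    using B that by (auto simp: minor_model_def prism_def)
  have j: "joined E (B i) (B k)" if "(i, k) \<in> parcs prism" for i k
    using B that by (auto simp: minor_model_def joined_def)
  have J: "joined E (B 0) (B 1)" "joined E (B 0) (B 2)" "joined E (B 1) (B 2)" "joined E (B 3) (B 4)"
    "joined E (B 3) (B 5)" "joined E (B 4) (B 5)" "joined E (B 0) (B 3)" "joined E (B 1) (B 4)" "joined E (B 2) (B 5)"
    by (rule j; simp add: prism_def symcl_def)+
  have t1: "has_cycle E (B 0 \<union> (B 1 \<union> B 2))" using J c d by (intro triangle_has_cycle) auto
  have t2: "has_cycle E (B 3 \<union> (B 4 \<union> B 5))" using J c d by (intro triangle_has_cycle) auto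
  have q: "has_cycle E ((B 1 \<union> B 2) \<union> (B 4 \<union> B 5))" "has_cycle E ((B 0 \<union> B 2) \<union> (B 3 \<union> B 5))"
    "has_cycle E ((B 0 \<union> B 1) \<union> (B 3 \<union> B 4))"
    using J c d by (intro square_has_cycle; simp add: Int_Un_distrib Int_Un_distrib2)+
  have sub: "B i \<subseteq> V - {u, v}" if "i < 6" "i \<noteq> x" "i \<noteq> y" for i
  proof -
    have "x < 6" "y < 6" "x \<noteq> y" using xy(1) by (auto simp: prism_def symcl_def)
    then have "B x \<inter> B y = {}" "B i \<inter> B x = {}" "B i \<inter> B y = {}" using d that by auto
    then show ?thesis using xy(2,3) c(2)[OF that(1)] by blast
  qed
  have "\<exists>S. has_cycle E S \<and> S \<subseteq> V - {u, v}"
  proof -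
    have "(x, y) \<in> {(0, 1), (1, 2), (0, 2), (1, 0), (2, 1), (2, 0)} \<or> (x, y) \<in> {(3, 4), (4, 5), (3, 5), (4, 3), (5, 4), (5, 3)}
      \<or> (x, y) \<in> {(0, 3), (3, 0)} \<or> (x, y) \<in> {(1, 4), (4, 1)} \<or> (x, y) \<in> {(2, 5), (5, 2)}"
      using xy(1) by (auto simp: prism_def symcl_def)
    then show ?thesis
      apply (elim disjE)
      subgoal by (rule exI[of _ "B 3 \<union> (B 4 \<union> B 5)"]) (use t2 sub[of 3] sub[of 4] sub[of 5] in auto)
      subgoal by (rule exI[of _ "B 0 \<union> (B 1 \<union> B 2)"]) (use t1 sub[of 0] sub[of 1] sub[of 2] in auto)
      subgoal by (rule exI[of _ "(B 1 \<union> B 2) \<union> (B 4 \<union> B 5)"]) (use q sub[of 1] sub[of 2] sub[of 4] sub[of 5] in auto)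
      subgoal by (rule exI[of _ "(B 0 \<union> B 2) \<union> (B 3 \<union> B 5)"]) (use q sub[of 0] sub[of 2] sub[of 3] sub[of 5] in auto)
      subgoal by (rule exI[of _ "(B 0 \<union> B 1) \<union> (B 3 \<union> B 4)"]) (use q sub[of 0] sub[of 1] sub[of 3] sub[of 4] in auto)
      done
  qed
  then show "has_cycle E (V - {u, v})" using has_cycle_mono by blast
  obtain xs where xs: "is_cycle E xs" "set xs \<subseteq> B 0 \<union> (B 1 \<union> B 2)" using t1 unfolding has_cycle_def by blast
  obtain ys where ys: "is_cycle E ys" "set ys \<subseteq> B 3 \<union> (B 4 \<union> B 5)" using t2 unfolding has_cycle_def by blast
  have D: "(B 0 \<union> (B 1 \<union> B 2)) \<inter> (B 3 \<union> (B 4 \<union> B 5)) = {}"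
    by (simp add: Int_Un_distrib Int_Un_distrib2 d)
  have S: "B 0 \<union> (B 1 \<union> B 2) \<subseteq> V" "B 3 \<union> (B 4 \<union> B 5) \<subseteq> V" using c(2) by auto
  have "set xs \<inter> set ys = {}" using D xs(2) ys(2) by (metis Int_mono subset_empty)
  then show "two_disjoint_cycles G" unfolding two_disjoint_cycles_def
    using xs(1) ys(1) subset_trans[OF xs(2) S(1)] subset_trans[OF ys(2) S(2)] by blast
qed

end

section \<open>Isomorphisms onto the named graphs\<close>

lemma symcl_iff: "(x, y) \<in> symcl R \<longleftrightarrow> (x, y) \<in> R \<or> (y, x) \<in> R"
  by (auto simp: symcl_def)

lemma K3_plus_isoI:
  assumes G: "pair_graph G" and V: "pverts G = {a, b, c} \<union> Y" "{a, b, c} \<inter> Y = {}" "distinct [a, b, c]"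
    and Y: "finite Y" "card Y = n"
    and XY: "\<forall>x\<in>{a, b, c}. \<forall>y\<in>Y. (x, y) \<in> parcs G" and YY: "\<forall>y\<in>Y. \<forall>z\<in>Y. (y, z) \<notin> parcs G"
    and E0: "E0 \<subseteq> {(0, 1), (1, 2), (0, 2)}"
    and iff: "(a, b) \<in> parcs G \<longleftrightarrow> (0, 1) \<in> E0" "(b, c) \<in> parcs G \<longleftrightarrow> (1, 2) \<in> E0" "(a, c) \<in> parcs G \<longleftrightarrow> (0, 2) \<in> E0"
  shows "graph_iso G (K3_plus E0 n)"
proof -
  interpret pair_graph G by fact
  have sym: "(y, x) \<in> parcs G \<longleftrightarrow> (x, y) \<in> parcs G" for x y
    using pair_sym_arcs by (auto simp: symmetric_def dest: symD)
  have irr: "(x, x) \<notin> parcs G" for x using pair_no_loops[of "(x, x)"] by auto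
  obtain e where e: "bij_betw e {0..<n} Y" using ex_bij_betw_nat_finite[OF Y(1)] Y(2) by auto
  \<comment> \<open>The model's large part starts at 3, hence the shift of the enumeration of
    \<open>Y\<close>.\<close>
  define g where "g i = (if i = 0 then a else if i = 1 then b else if i = 2 then c else e (i - 3))" for i :: nat
  have g012: "g 0 = a" "g 1 = b" "g 2 = c" "g (Suc 0) = b" by (auto simp: g_def)
  have gY: "g i \<in> Y" if "i \<in> {3..<n + 3}" for i
  proof -
    have "i - 3 \<in> {0..<n}" using that by auto
    then show ?thesis using that e by (auto simp: g_def bij_betw_def)
  qed
  have split: "{0..<n + 3} = {0, 1, 2} \<union> {3..<n + 3::nat}" by auto
  have "bij_betw (\<lambda>i. i - 3) {3..<n + 3} {0..<n}"
    by (rule bij_betw_byWitness[of _ "\<lambda>i. i + 3"]) auto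
  then have "bij_betw (e \<circ> (\<lambda>i. i - 3)) {3..<n + 3} Y" using e by (rule bij_betw_trans)
  moreover have "bij_betw g {3..<n + 3} Y \<longleftrightarrow> bij_betw (e \<circ> (\<lambda>i. i - 3)) {3..<n + 3} Y"
    by (rule bij_betw_cong) (auto simp: g_def)
  ultimately have b1: "bij_betw g {3..<n + 3} Y" by simp
  have b2: "bij_betw g {0, 1, 2} {a, b, c}" using V(3) by (auto simp: bij_betw_def g_def inj_on_def)
  have bij: "bij_betw g {0..<n + 3} (pverts G)"
    unfolding split V(1) using bij_betw_combine[OF b2 b1 V(2)] .
  show ?thesis
  proof (rule graph_isoI[OF G, of g])
    show "bij_betw g (pverts (K3_plus E0 n)) (pverts G)" using bij by (simp add: K3_plus_def)
    show "parcs (K3_plus E0 n) \<subseteq> pverts (K3_plus E0 n) \<times> pverts (K3_plus E0 n)"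
      using E0 by (auto simp: K3_plus_def symcl_def)
    fix x y assume "x \<in> pverts (K3_plus E0 n)" "y \<in> pverts (K3_plus E0 n)"
    then have xy: "x \<in> {0, 1, 2} \<union> {3..<n + 3}" "y \<in> {0, 1, 2} \<union> {3..<n + 3}"
      by (auto simp: K3_plus_def)
    have small: "g i \<in> {a, b, c}" if "i \<in> {0, 1, 2}" for i using that g012 by auto
    have E0': "i < 3 \<and> j < 3" if "(i, j) \<in> E0" for i j using that E0 by auto
    consider "x \<in> {0, 1, 2}" "y \<in> {0, 1, 2}" | "x \<in> {0, 1, 2}" "y \<in> {3..<n + 3}"
      | "x \<in> {3..<n + 3}" "y \<in> {0, 1, 2}" | "x \<in> {3..<n + 3}" "y \<in> {3..<n + 3}" using xy by blast
    then show "(g x, g y) \<in> parcs G \<longleftrightarrow> (x, y) \<in> parcs (K3_plus E0 n)"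
    proof cases
      case 1
      then have "(x, y) \<in> parcs (K3_plus E0 n) \<longleftrightarrow> (x, y) \<in> E0 \<or> (y, x) \<in> E0"
        by (auto simp: K3_plus_def symcl_iff)
      moreover have "(i, j) \<in> E0 \<longleftrightarrow> i = 0 \<and> j = 1 \<and> (a, b) \<in> parcs G \<or> i = 1 \<and> j = 2 \<and> (b, c) \<in> parcs G \<or>
          i = 0 \<and> j = 2 \<and> (a, c) \<in> parcs G" for i j using E0 iff by blast
      ultimately show ?thesis
        using 1 irr[of a] irr[of b] irr[of c] sym[of a b] sym[of b c] sym[of a c] g012 by (elim insertE) simp_all
    next
      case 2
      then show ?thesis using XY small[of x] gY[of y] by (auto simp: K3_plus_def symcl_iff)
    next
      case 3
      then have "(g y, g x) \<in> parcs G" using XY small[of y] gY[of x] by blast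
      then have "(g x, g y) \<in> parcs G" by (simp only: sym)
      then show ?thesis using 3 by (auto simp: K3_plus_def symcl_iff)
    next
      case 4
      have "(g x, g y) \<notin> parcs G" using YY gY 4 by blast
      moreover have "(x, y) \<notin> parcs (K3_plus E0 n)" using 4 E0' by (auto simp: K3_plus_def symcl_iff dest: E0')
      ultimately show ?thesis by blast
    qed
  qed
qed

lemma K3_like_iso:
  assumes G: "pair_graph G" and K: "K3_like G" and card: "6 \<le> card (pverts G)"
  shows "\<exists>n\<ge>3. graph_iso G (K3 n) \<or> graph_iso G (K3' n) \<or> graph_iso G (K3'' n) \<or> graph_iso G (K3''' n)"
proof -
  interpret pair_graph G by fact
  have sym: "(y, x) \<in> parcs G \<longleftrightarrow> (x, y) \<in> parcs G" for x y
    using pair_sym_arcs by (auto simp: symmetric_def dest: symD)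
  obtain X where X: "X \<subseteq> pverts G" "card X = 3" "\<forall>x\<in>X. \<forall>y\<in>pverts G - X. (x, y) \<in> parcs G"
    "\<forall>y\<in>pverts G - X. \<forall>z\<in>pverts G - X. (y, z) \<notin> parcs G" using K by (auto simp: K3_like_def)
  define Y where "Y = pverts G - X"
  have n: "3 \<le> card Y" "finite Y" using X card card_Diff_subset[of X "pverts G"] finite_subset[OF X(1) pair_finite_verts]
    pair_finite_verts by (auto simp: Y_def)
  have iso: "graph_iso G (K3_plus E0 (card Y))"
    if "X = {a, b, c}" "distinct [a, b, c]" "E0 \<subseteq> {(0, 1), (1, 2), (0, 2)}"
      "(a, b) \<in> parcs G \<longleftrightarrow> (0, 1) \<in> E0" "(b, c) \<in> parcs G \<longleftrightarrow> (1, 2) \<in> E0" "(a, c) \<in> parcs G \<longleftrightarrow> (0, 2) \<in> E0"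
    for a b c E0
  proof (rule K3_plus_isoI[OF G _ _ that(2) n(2) refl _ _ that(3-6)])
    show "pverts G = {a, b, c} \<union> Y" "{a, b, c} \<inter> Y = {}" using X(1) that(1) by (auto simp: Y_def)
    show "\<forall>x\<in>{a, b, c}. \<forall>y\<in>Y. (x, y) \<in> parcs G" using X(3) that(1) unfolding Y_def by simp
    show "\<forall>y\<in>Y. \<forall>z\<in>Y. (y, z) \<notin> parcs G" using X(4) unfolding Y_def .
  qed
  obtain a b c where abc: "X = {a, b, c}" "a \<noteq> b" "a \<noteq> c" "b \<noteq> c"
    using X(2) by (auto simp: card_3_iff)
  have perms: "{b, c, a} = {a, b, c}" "{c, a, b} = {a, b, c}" "{b, a, c} = {a, b, c}" "{a, c, b} = {a, b, c}" by auto
  have ex: "\<exists>a b c. X = {a, b, c} \<and> distinct [a, b, c] \<and>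
     ((a, b) \<notin> parcs G \<and> (b, c) \<notin> parcs G \<and> (a, c) \<notin> parcs G \<or>
      (a, b) \<in> parcs G \<and> (b, c) \<notin> parcs G \<and> (a, c) \<notin> parcs G \<or>
      (a, b) \<in> parcs G \<and> (b, c) \<in> parcs G \<and> (a, c) \<notin> parcs G \<or>
      (a, b) \<in> parcs G \<and> (b, c) \<in> parcs G \<and> (a, c) \<in> parcs G)" (is "\<exists>a b c. ?P a b c")
  proof -
    \<comment> \<open>Reordering the triple moves a single edge to \<open>ab\<close>, or the common
      end of two edges to the middle position \<open>b\<close>.\<close>
    have "?P a b c \<or> ?P b c a \<or> ?P c a b \<or> ?P b a c \<or> ?P a c b"
      using abc sym[of a b] sym[of a c] sym[of b c] perms by (simp only: distinct.simps set_simps) auto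
    then show ?thesis by blast
  qed
  then obtain a b c where P: "?P a b c" by (elim exE)
  then have X3: "X = {a, b, c}" "distinct [a, b, c]" by blast+
  from P have "graph_iso G (K3 (card Y)) \<or> graph_iso G (K3' (card Y)) \<or> graph_iso G (K3'' (card Y)) \<or> graph_iso G (K3''' (card Y))"
    using iso[OF X3, of "{}"] iso[OF X3, of "{(0, 1)}"] iso[OF X3, of "{(0, 1), (1, 2)}"]
      iso[OF X3, of "{(0, 1), (1, 2), (0, 2)}"]
    unfolding K3_def K3'_def K3''_def K3'''_def by auto
  then show ?thesis using n(1) by blast
qed

lemma wheel_like_iso:
  assumes G: "pair_graph G" and W: "wheel_like G"
  shows "\<exists>n\<ge>3. graph_iso G (wheel n)"
proof -
  interpret pair_graph G by fact
  have sym: "(y, x) \<in> parcs G \<longleftrightarrow> (x, y) \<in> parcs G" for x y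
    using pair_sym_arcs by (auto simp: symmetric_def dest: symD)
  have irr: "(x, x) \<notin> parcs G" for x using pair_no_loops[of "(x, x)"] by auto
  obtain h cs where V: "pverts G = insert h (set cs)" "h \<notin> set cs" and c: "is_cycle (parcs G) cs"
    and spokes: "\<forall>c\<in>set cs. (h, c) \<in> parcs G"
    and chord: "\<And>p a q b r. cs = p @ a # q @ b # r \<Longrightarrow> (a, b) \<in> parcs G \<Longrightarrow> q = [] \<or> p = [] \<and> r = []"
    using W by (auto simp: wheel_like_def)
  define n where "n = length cs"
  have n: "3 \<le> n" and d: "distinct cs" and succ: "successively (\<lambda>x y. (x, y) \<in> parcs G) cs" and lh: "(last cs, hd cs) \<in> parcs G"
    using c by (auto simp: n_def is_cycle_def is_path_def)
  have ne: "cs \<noteq> []" using n by (auto simp: n_def)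
  define g where "g i = (case i of 0 \<Rightarrow> h | Suc j \<Rightarrow> cs ! j)" for i
  have g: "g 0 = h" "g (Suc j) = cs ! j" for j by (simp_all add: g_def)
  \<comment> \<open>The list is indexed from 0, so the closing edge joins 0 and
    \<open>n - 1\<close>; in the wheel, where the hub is 0, all rim indices are one higher.\<close>
  have lt: "(cs ! i, cs ! j) \<in> parcs G \<longleftrightarrow> j = Suc i \<or> i = 0 \<and> j = n - 1" if ij: "i < j" "j < n" for i j
  proof
    assume e: "(cs ! i, cs ! j) \<in> parcs G"
    define r where "r = drop (Suc j) cs"
    define q where "q = take (j - Suc i) (drop (Suc i) cs)"
    have "drop (Suc i) cs = q @ drop (j - Suc i) (drop (Suc i) cs)"
      unfolding q_def by (rule append_take_drop_id[symmetric])
    moreover have "drop (j - Suc i) (drop (Suc i) cs) = drop j cs" using ij by simp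
    moreover have "drop j cs = cs ! j # r" using ij by (simp add: r_def n_def Cons_nth_drop_Suc)
    ultimately have "cs = take i cs @ cs ! i # q @ cs ! j # r" using ij by (metis id_take_nth_drop n_def order.strict_trans)
    from chord[OF this e] show "j = Suc i \<or> i = 0 \<and> j = n - 1"
      using ij ne by (auto simp: q_def r_def n_def)
  next
    assume "j = Suc i \<or> i = 0 \<and> j = n - 1"
    then show "(cs ! i, cs ! j) \<in> parcs G"
    proof
      assume "j = Suc i"
      then show ?thesis using successively_nth[OF succ, of i] ij by (simp add: n_def)
    next
      assume "i = 0 \<and> j = n - 1"
      then have "(cs ! j, cs ! i) \<in> parcs G" using lh ne by (simp add: hd_conv_nth last_conv_nth n_def)
      then show ?thesis by (simp only: sym)
    qed
  qed
  have rim: "(i, j) \<in> parcs (wheel n) \<longleftrightarrow> j = Suc i \<or> i = 1 \<and> j = n" if "i < j" "0 < i" "j \<le> n" for i j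
    using that n by (auto simp: wheel_def symcl_def)
  have wsym: "(j, i) \<in> parcs (wheel n) \<longleftrightarrow> (i, j) \<in> parcs (wheel n)" for i j
    unfolding wheel_def by (simp only: pair_pre_digraph.select_convs symcl_iff) blast
  have hub: "(0, j) \<in> parcs (wheel n) \<longleftrightarrow> 0 < j \<and> j \<le> n" for j
    using n by (auto simp: wheel_def symcl_def)
  have wirr: "(i, i) \<notin> parcs (wheel n)" for i using n by (auto simp: wheel_def symcl_def)
  have lt': "(g i, g j) \<in> parcs G \<longleftrightarrow> (i, j) \<in> parcs (wheel n)" if ij: "i < j" "j \<le> n" for i j
  proof (cases i)
    case 0
    obtain j' where "j = Suc j'" using ij by (cases j) auto
    then show ?thesis using 0 ij spokes hub[of j] g by (simp add: n_def)
  next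
    case (Suc i')
    obtain j' where j: "j = Suc j'" using ij by (cases j) auto
    have "(cs ! i', cs ! j') \<in> parcs G \<longleftrightarrow> j' = Suc i' \<or> i' = 0 \<and> j' = n - 1" using lt[of i' j'] ij Suc j by auto
    then show ?thesis using rim[of i j] ij Suc j g n by auto
  qed
  have "graph_iso G (wheel n)"
  proof (rule graph_isoI[OF G, of g])
    show "bij_betw g (pverts (wheel n)) (pverts G)"
    proof -
      have "g ` {0..n} = insert h (set cs)"
      proof -
        have "{0..n} = insert 0 (Suc ` {..<n})" by (auto simp: image_Suc_lessThan)
        then have "g ` {0..n} = insert h ((\<lambda>j. cs ! j) ` {..<n})" using g by (simp add: image_image)
        then show ?thesis by (auto simp: set_conv_nth n_def)
      qed
      moreover have "card {0..n} = card (insert h (set cs))" using V(2) d by (simp add: distinct_card n_def)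
      ultimately show ?thesis unfolding V(1) using eq_card_imp_inj_on[of "{0..n}" g]
        by (auto simp: bij_betw_def wheel_def)
    qed
    show "parcs (wheel n) \<subseteq> pverts (wheel n) \<times> pverts (wheel n)" using n by (auto simp: wheel_def symcl_def)
    fix x y assume "x \<in> pverts (wheel n)" "y \<in> pverts (wheel n)"
    then have xy: "x \<le> n" "y \<le> n" by (auto simp: wheel_def)
    show "(g x, g y) \<in> parcs G \<longleftrightarrow> (x, y) \<in> parcs (wheel n)"
    proof (cases x y rule: linorder_cases)
      case less
      then show ?thesis using lt'[of x y] xy by simp
    next
      case equal
      then show ?thesis using irr wirr by simp
    next
      case greater
      then show ?thesis using lt'[of y x] xy sym wsym by blast
    qed
  qed
  then show ?thesis using n by blast
qed

section \<open>Components of the graph without a separating triple\<close>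

lemma strongly_connected_iff_conn:
  assumes "pair_graph G"
  shows "strongly_connected (with_proj G \<restriction> S) \<longleftrightarrow> conn (parcs G) S"
proof -
  have sym: "sym (parcs G)"
    using assms pair_sym_digraph.pair_sym_arcs[of G] by (auto simp: pair_graph_def pair_pseudo_graph_def symmetric_def)
  have 1: "parcs (mk_symmetric (with_proj G \<restriction> S)) = parcs G \<inter> S \<times> S"
    using sym by (auto simp: parcs_mk_symmetric dest: symD)
  have 2: "arcs_ends (with_proj G \<restriction> S) = parcs G \<inter> S \<times> S"
    by (auto simp: arcs_ends_conv)
  have "strongly_connected (with_proj G \<restriction> S) \<longleftrightarrow> connected (with_proj G \<restriction> S)"
    by (simp add: connected_def strongly_connected_def reachable_def 1 2)
  then show ?thesis using connected_iff_conn[OF assms] by simp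
qed

lemma induced_subgraph_iff:
  assumes "pair_graph G"
  shows "induced_subgraph H (with_proj G \<restriction> X) \<longleftrightarrow> verts H \<subseteq> X \<and> H = with_proj G \<restriction> verts H"
proof
  assume H: "induced_subgraph H (with_proj G \<restriction> X)"
  then have "verts H \<subseteq> X" "tail H = fst" "head H = snd" "arcs H = {e \<in> parcs G. fst e \<in> verts H \<and> snd e \<in> verts H}"
    by (auto simp: induced_subgraph_def subgraph_def compatible_def)
  then show "verts H \<subseteq> X \<and> H = with_proj G \<restriction> verts H" by (simp add: induce_subgraph_def)
next
  interpret pair_graph G by fact
  have wf: "wf_digraph (with_proj G \<restriction> Y)" for Y by (rule wellformed_induce_subgraph)
  assume *: "verts H \<subseteq> X \<and> H = with_proj G \<restriction> verts H"
  then have a: "arcs H = {e \<in> parcs G. fst e \<in> verts H \<and> snd e \<in> verts H}" "tail H = fst" "head H = snd"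
    using arg_cong[OF conjunct2[OF *], of arcs] arg_cong[OF conjunct2[OF *], of tail]
      arg_cong[OF conjunct2[OF *], of head] by simp_all
  have "wf_digraph H" using wf[of "verts H"] * by simp
  then show "induced_subgraph H (with_proj G \<restriction> X)"
    using * a wf[of X] by (auto simp: induced_subgraph_def subgraph_def compatible_def)
qed

text \<open>Maximality of an induced connected subgraph means that no edge leaves its vertex set
  inside \<open>X\<close>: a larger connected set would contain such an edge, and such an edge
  allows an extension.\<close>

lemma components_iff:
  assumes "pair_graph G"
  shows "K \<in> components (with_proj G \<restriction> X) \<longleftrightarrow>
    (\<exists>S\<subseteq>X. conn (parcs G) S \<and> \<not> joined (parcs G) S (X - S) \<and> K = with_proj G \<restriction> S)"
proof
  let ?E = "parcs G"
  have sym: "sym ?E"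
    using assms pair_sym_digraph.pair_sym_arcs[of G] by (auto simp: pair_graph_def pair_pseudo_graph_def symmetric_def)
  note sc = strongly_connected_iff_conn[OF assms] and ind = induced_subgraph_iff[OF assms]
  {
    assume "K \<in> components (with_proj G \<restriction> X)"
    then have K: "induced_subgraph K (with_proj G \<restriction> X)" "strongly_connected K"
      and max: "\<And>H. induced_subgraph H (with_proj G \<restriction> X) \<Longrightarrow> strongly_connected H \<Longrightarrow> \<not> verts K \<subset> verts H"
      by (auto simp: components_def pre_digraph.sccs_def)
    define S where "S = verts K"
    have S: "S \<subseteq> X" "K = with_proj G \<restriction> S" using K(1) unfolding ind S_def by auto
    have c: "conn ?E S" using K(2) S(2) sc by simp
    have "\<not> joined ?E S (X - S)"
    proof
      assume "joined ?E S (X - S)"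
      then obtain y where y: "y \<in> X - S" "joined ?E S {y}" by (auto simp: joined_def)
      then have c': "conn ?E (insert y S)" using conn_insert[OF sym c] by blast
      have "induced_subgraph (with_proj G \<restriction> insert y S) (with_proj G \<restriction> X)"
        using S(1) y by (simp add: ind)
      then show False using max[of "with_proj G \<restriction> insert y S"] c' sc S_def y by auto
    qed
    then show "\<exists>S\<subseteq>X. conn ?E S \<and> \<not> joined ?E S (X - S) \<and> K = with_proj G \<restriction> S" using S c by blast
  next
    assume "\<exists>S\<subseteq>X. conn ?E S \<and> \<not> joined ?E S (X - S) \<and> K = with_proj G \<restriction> S"
    then obtain S where S: "S \<subseteq> X" "conn ?E S" "\<not> joined ?E S (X - S)" "K = with_proj G \<restriction> S" by blast
    have "\<not> S \<subset> verts H" if H: "induced_subgraph H (with_proj G \<restriction> X)" "strongly_connected H" for H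
    proof
      assume lt: "S \<subset> verts H"
      have "verts H \<subseteq> X" "H = with_proj G \<restriction> verts H" using H(1) unfolding ind by auto
      then have "conn ?E (verts H)" using H(2) sc by metis
      then have "joined ?E S (verts H - S)" using lt conn_nonempty[OF S(2)] by (intro conn_joined) auto
      then have "joined ?E S (X - S)" by (rule joined_mono) (use \<open>verts H \<subseteq> X\<close> in auto)
      then show False using S(3) by blast
    qed
    moreover have "induced_subgraph K (with_proj G \<restriction> X)" using S by (simp add: ind)
    moreover have "strongly_connected K" using S sc by simp
    ultimately show "K \<in> components (with_proj G \<restriction> X)"
      using S(4) by (auto simp: components_def pre_digraph.sccs_def)
  }
qed

lemma pcas_path:
  assumes "pcas a p b" "p \<noteq> []" "set p \<subseteq> R"
  shows "hd (map fst p) = a \<and> (last (map fst p), b) \<in> R \<and> successively (\<lambda>x y. (x, y) \<in> R) (map fst p) \<and>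
    pawalk_verts a p = map fst p @ [b]"
  using assms
proof (induction p arbitrary: a)
  case (Cons e p)
  show ?case
  proof (cases p)
    case Nil
    then show ?thesis using Cons.prems by auto
  next
    case (Cons e' p')
    then have "hd (map fst p) = snd e \<and> (last (map fst p), b) \<in> R \<and> successively (\<lambda>x y. (x, y) \<in> R) (map fst p) \<and>
      pawalk_verts (snd e) p = map fst p @ [b]"
      using Cons.IH[of "snd e"] Cons.prems by simp
    then show ?thesis using Cons Cons.prems(1,3) by (cases e) auto
  qed
qed simp

lemma path_pcas:
  assumes "successively (\<lambda>x y. (x, y) \<in> R) xs" "xs \<noteq> []" "(last xs, b) \<in> R"
  shows "\<exists>p. pcas (hd xs) p b \<and> map fst p = xs \<and> set p \<subseteq> R \<inter> set xs \<times> insert b (set xs)"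
  using assms
proof (induction xs)
  case (Cons x xs)
  show ?case
  proof (cases xs)
    case Nil
    then show ?thesis using Cons.prems by (intro exI[of _ "[(x, b)]"]) auto
  next
    case ys: (Cons y ys)
    have 1: "successively (\<lambda>x y. (x, y) \<in> R) xs" "xs \<noteq> []" "(last xs, b) \<in> R" "(x, y) \<in> R"
      using Cons.prems ys by (simp_all split: if_splits)
    obtain p where p: "pcas (hd xs) p b" "map fst p = xs" "set p \<subseteq> R \<inter> set xs \<times> insert b (set xs)"
      using Cons.IH[OF 1(1-3)] by blast
    have "set p \<subseteq> R \<inter> set (x # xs) \<times> insert b (set (x # xs))" using p(3) by auto
    then show ?thesis using p(1,2) ys 1(4) by (intro exI[of _ "(x, y) # p"]) simp
  qed
qed simp

lemma undirected_tree_iff: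
  assumes "pair_graph G"
  shows "undirected_tree (with_proj G \<restriction> S) \<longleftrightarrow> conn (parcs G) S \<and> \<not> has_cycle (parcs G) S"
proof -
  let ?D = "with_proj G \<restriction> S"
  have cas: "pre_digraph.cas ?D = pcas"
    using compatible_cas[OF compatible_induce_subgraph, of "with_proj G" S] cas_with_proj_eq by simp
  have av: "pre_digraph.awalk_verts ?D = pawalk_verts"
    using compatible_awalk_verts[OF compatible_induce_subgraph, of "with_proj G" S] awalk_verts_with_proj_eq by simp
  \<comment> \<open>The vertex sequence of a closed walk repeats its start at the end, so
    distinctness concerns the tail only.\<close>
  have cyc: "pre_digraph.cycle ?D p \<longleftrightarrow>
      (\<exists>a\<in>S. set p \<subseteq> parcs G \<inter> S \<times> S \<and> pcas a p a \<and> distinct (tl (pawalk_verts a p)) \<and> p \<noteq> [])" for p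
  proof -
    have "{e \<in> parcs G. fst e \<in> S \<and> snd e \<in> S} = parcs G \<inter> S \<times> S" by auto
    then show ?thesis by (simp add: pre_digraph.cycle_def pre_digraph.awalk_def cas av Bex_def conj_assoc) blast
  qed
  have "(\<exists>p. pre_digraph.cycle ?D p \<and> 3 \<le> length p) \<longleftrightarrow> has_cycle (parcs G) S"
  proof
    assume "\<exists>p. pre_digraph.cycle ?D p \<and> 3 \<le> length p"
    then obtain p a where p: "set p \<subseteq> parcs G \<inter> S \<times> S" "pcas a p a" "distinct (tl (pawalk_verts a p))" "p \<noteq> []" "3 \<le> length p"
      unfolding cyc by blast
    note q = pcas_path[OF p(2,4), of "parcs G"]
    have q: "hd (map fst p) = a" "(last (map fst p), a) \<in> parcs G" "successively (\<lambda>x y. (x, y) \<in> parcs G) (map fst p)"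
      "pawalk_verts a p = map fst p @ [a]" using q p(1) by auto
    obtain e p' where e: "p = e # p'" using p(4) by (cases p) auto
    have "distinct (map fst p' @ [a])" using p(3) q(4) e by simp
    then have "distinct (map fst p)" using q(1) e by auto
    then have "is_cycle (parcs G) (map fst p)" using p(4,5) q by (simp add: is_cycle_def is_path_def)
    moreover have "set (map fst p) \<subseteq> S" using p(1) by auto
    ultimately show "has_cycle (parcs G) S" unfolding has_cycle_def by blast
  next
    assume "has_cycle (parcs G) S"
    then obtain xs where xs: "is_cycle (parcs G) xs" "set xs \<subseteq> S" by (auto simp: has_cycle_def)
    then have ne: "xs \<noteq> []" and d: "distinct xs" "successively (\<lambda>x y. (x, y) \<in> parcs G) xs" "(last xs, hd xs) \<in> parcs G" "3 \<le> length xs"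
      by (auto simp: is_cycle_def is_path_def)
    obtain p where p: "pcas (hd xs) p (hd xs)" "map fst p = xs" "set p \<subseteq> parcs G \<inter> set xs \<times> insert (hd xs) (set xs)"
      using path_pcas[OF d(2) ne d(3)] by blast
    have pne: "p \<noteq> []" using p(2) ne by auto
    have hS: "hd xs \<in> S" using ne xs(2) by auto
    have "pawalk_verts (hd xs) p = xs @ [hd xs]" using pcas_path[OF p(1) pne, of "parcs G"] p by auto
    then have "distinct (tl (pawalk_verts (hd xs) p))" using d(1) ne by (cases xs) auto
    moreover have "set p \<subseteq> parcs G \<inter> S \<times> S" using p(3) xs(2) hS by blast
    moreover have "length p = length xs" using p(2) by auto
    ultimately show "\<exists>p. pre_digraph.cycle ?D p \<and> 3 \<le> length p"
      unfolding cyc using p(1) pne hS d(4) by (intro exI[of _ p] conjI bexI[of _ "hd xs"]) auto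
  qed
  then show ?thesis using connected_iff_conn[OF assms] by (simp add: undirected_tree_def)
qed

section \<open>Condition (b) means that no cycle avoids the root ends\<close>

context rooted_graph
begin

definition tree_cut :: "'a \<Rightarrow> bool" where
  "tree_cut w \<longleftrightarrow> w \<in> V \<and> vertex_cut G {u, v, w} \<and>
     (\<forall>K\<in>components (del_verts G {u, v, w}). undirected_tree K \<and> (\<exists>!x. x \<in> verts K \<and> (w, x) \<in> E))"

text \<open>A cycle off \<open>w\<close> would lie in a single component. A cycle through
  \<open>w\<close> leaves a connected remainder, so a single component would contain two neighbours
  of \<open>w\<close>.\<close>

lemma tree_cut_acyclic:
  assumes "tree_cut w"
  shows "\<not> has_cycle E (V - {u, v})"
proof
  assume "has_cycle E (V - {u, v})"
  then obtain xs where xs: "is_cycle E xs" "set xs \<subseteq> V - {u, v}" by (auto simp: has_cycle_def)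
  let ?X = "V - {u, v, w}"
  have comp: "\<not> has_cycle E S \<and> (\<exists>!x. x \<in> S \<and> (w, x) \<in> E)"
    if S: "S \<subseteq> ?X" "conn E S" "\<not> joined E S (?X - S)" for S
  proof -
    have "with_proj G \<restriction> S \<in> components (del_verts G {u, v, w})"
      unfolding del_verts_def components_iff[OF graph] using S by blast
    then have "undirected_tree (with_proj G \<restriction> S) \<and> (\<exists>!x. x \<in> verts (with_proj G \<restriction> S) \<and> (w, x) \<in> E)"
      using assms unfolding tree_cut_def by blast
    then show ?thesis using undirected_tree_iff[OF graph] by simp
  qed
  have inside: "\<exists>S. C \<subseteq> S \<and> S \<subseteq> ?X \<and> conn E S \<and> \<not> joined E S (?X - S)" if C: "conn E C" "C \<subseteq> ?X" for C
  proof -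
    obtain x where x: "x \<in> C" using conn_nonempty[OF C(1)] by blast
    have "finite ?X" "x \<in> ?X" using x C(2) by auto
    then obtain S where S: "x \<in> S" "S \<subseteq> ?X" "conn E S" "\<not> joined E S (?X - S)"
      using ex_component[OF _ _ symE] by metis
    have "C \<inter> S = C"
    proof (rule conn_component_eq[OF C(1)])
      show "\<not> joined E (C \<inter> S) (C - C \<inter> S)" using S(4) C(2) by (auto simp: joined_def)
    qed (use x S in auto)
    then show ?thesis using S by blast
  qed
  show False
  proof (cases "w \<in> set xs")
    case True
    obtain a b where ab: "a \<in> set xs" "b \<in> set xs" "a \<noteq> b" "a \<noteq> w" "b \<noteq> w" "(w, a) \<in> E" "(w, b) \<in> E"
      "conn E (set xs - {w})" using is_cycle_distinct_edges[OF symE xs(1) True] by metis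
    obtain S where "set xs - {w} \<subseteq> S" "S \<subseteq> ?X" "conn E S" "\<not> joined E S (?X - S)"
      using inside[OF ab(8)] xs(2) by blast
    then show False using comp[of S] ab by blast
  next
    case False
    have "conn E (set xs)" using is_path_conn[OF symE] xs(1) by (simp add: is_cycle_def)
    then obtain S where "set xs \<subseteq> S" "S \<subseteq> ?X" "conn E S" "\<not> joined E S (?X - S)"
      using inside[of "set xs"] False xs(2) by blast
    then show False using comp[of S] xs(1) by (auto simp: has_cycle_def)
  qed
qed

text \<open>By 3-connectivity \<open>H\<close> is connected, hence a tree, and any of its vertices
  that is not a leaf serves as \<open>w\<close>. Each component of \<open>H - w\<close> sends at
  least one edge to \<open>w\<close> by connectivity and at most one by acyclicity.\<close>

lemma acyclic_tree_cut:
  assumes ac: "\<not> has_cycle E (V - {u, v})"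
  shows "\<exists>w. tree_cut w"
proof -
  let ?H = "V - {u, v}"
  have card: "card ?H \<ge> 4" using card_ge_6 uv by (simp add: card_Diff_subset)
  have cH: "conn E ?H"
    unfolding conn_def
  proof (intro conjI allI impI)
    show "?H \<noteq> {}" using card by (metis card.empty not_numeral_le_zero)
    fix A assume A: "A \<subseteq> ?H" "A \<noteq> {}" "A \<noteq> ?H"
    then obtain y where "y \<in> ?H" "y \<notin> A" by blast
    then have "joined E A (V - A - {u, v})" using A uv(3) by (intro joined_outside[of A "{u, v}" y]) (auto simp: card_insert_if)
    then show "joined E A (?H - A)" by (rule joined_mono) auto
  qed
  have two: False if "conn E A" "conn E B" "A \<inter> B = {}" "A \<union> B \<subseteq> ?H" "a \<in> A" "a' \<in> A" "b \<in> B" "b' \<in> B"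
    "(a, b) \<in> E" "(a', b') \<in> E" "a \<noteq> a' \<or> b \<noteq> b'" for A B a a' b b'
    using has_cycle_two_edges[OF symE that(1-3) that(5-11)] has_cycle_mono[OF _ that(4)] ac by blast
  \<comment> \<open>If no vertex disconnected \<open>H\<close>, two neighbours of a vertex would
    close a cycle through the rest. All degrees in \<open>H\<close> would be at most one, which is
    impossible for a connected set of at least four vertices.\<close>
  have "\<exists>w\<in>?H. \<not> conn E (?H - {w})"
  proof (rule ccontr)
    assume "\<not> (\<exists>w\<in>?H. \<not> conn E (?H - {w}))"
    then have all: "conn E (?H - {w})" if "w \<in> ?H" for w using that by blast
    have uniq: "a = b" if "w \<in> ?H" "a \<in> ?H" "b \<in> ?H" "(w, a) \<in> E" "(w, b) \<in> E" for w a b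
    proof (rule ccontr)
      assume "a \<noteq> b"
      then show False
        using two[OF conn_singleton all[OF that(1)], of w w w a b] that E_neq[OF that(4)] E_neq[OF that(5)] by auto
    qed
    obtain x where x: "x \<in> ?H" using conn_nonempty[OF cH] by blast
    have "card ?H \<noteq> card {x}" using card by simp
    then have "{x} \<noteq> ?H" by metis
    then have "joined E {x} (?H - {x})" using x by (intro conn_joined[OF cH]) auto
    then obtain y where y: "y \<in> ?H" "y \<noteq> x" "(x, y) \<in> E" by (auto simp: joined_def)
    have "card {x, y} \<noteq> card ?H" using card y(2) by simp
    then have "{x, y} \<noteq> ?H" by metis
    then have "joined E {x, y} (?H - {x, y})" using x y by (intro conn_joined[OF cH]) auto
    then obtain s t where st: "s \<in> {x, y}" "t \<in> ?H - {x, y}" "(s, t) \<in> E" unfolding joined_def by blast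
    then consider "(x, t) \<in> E" | "(y, t) \<in> E" by blast
    then show False
    proof cases
      case 1
      then have "t = y" using uniq[OF x _ y(1) _ y(3)] st(2) by blast
      then show False using st(2) by blast
    next
      case 2
      then have "t = x" using uniq[OF y(1) _ x _ E_sym[OF y(3)]] st(2) by blast
      then show False using st(2) by blast
    qed
  qed
  then obtain w where w: "w \<in> ?H" "\<not> conn E (?H - {w})" by blast
  let ?X = "V - {u, v, w}"
  have X: "?H - {w} = ?X" by auto
  have Xne: "?X \<noteq> {}"
  proof
    assume "?X = {}"
    then have "?H \<subseteq> {w}" by auto
    then have "card ?H \<le> card {w}" by (intro card_mono) auto
    then show False using card by simp
  qed
  have "tree_cut w"
    unfolding tree_cut_def
  proof (intro conjI ballI)
    show "w \<in> V" using w by auto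
    show "vertex_cut G {u, v, w}"
      unfolding vertex_cut_def del_verts_def using w X uv Xne connected_iff_conn[OF graph] by auto
    fix K assume "K \<in> components (del_verts G {u, v, w})"
    then obtain S where S: "S \<subseteq> ?X" "conn E S" "\<not> joined E S (?X - S)" "K = with_proj G \<restriction> S"
      unfolding del_verts_def components_iff[OF graph] by blast
    have "\<not> has_cycle E S" using ac S(1) has_cycle_mono[of E S ?H] by blast
    then show "undirected_tree K" using S undirected_tree_iff[OF graph] by simp
    have "joined E S (?H - S)" using S w conn_nonempty[OF S(2)] by (intro conn_joined[OF cH]) auto
    then obtain s where s: "s \<in> S" "(s, w) \<in> E" using S(3) by (auto simp: joined_def)
    show "\<exists>!x. x \<in> verts K \<and> (w, x) \<in> E"
    proof (rule ex1I[of _ s])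
      show "s \<in> verts K \<and> (w, s) \<in> E" using s S(4) E_sym by simp
      fix x assume "x \<in> verts K \<and> (w, x) \<in> E"
      then have x: "x \<in> S" "(w, x) \<in> E" using S(4) by auto
      show "x = s"
      proof (rule ccontr)
        assume "x \<noteq> s"
        then show False using two[OF conn_singleton S(2), of w w w x s] x E_sym[OF s(2)] s(1) S(1) w by auto
      qed
    qed
  qed
  then show ?thesis by blast
qed

end

theorem theorem1p3:
  fixes G :: "'a pair_pre_digraph" and u v :: 'a
  assumes "pair_graph G"
    and "k_connected 3 G"
    and "card (pverts G) \<ge> 6"
    and "(u, v) \<in> parcs G"
  shows "\<not> has_minor_using prism G u v \<longleftrightarrow>
    (\<exists>n\<ge>3. graph_iso G (wheel n) \<or> graph_iso G (K3 n) \<or> graph_iso G (K3' n) \<or>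
            graph_iso G (K3'' n) \<or> graph_iso G (K3''' n)) \<or>
    (\<exists>w \<in> pverts G. vertex_cut G {u, v, w} \<and>
       (\<forall>K \<in> components (del_verts G {u, v, w}).
          undirected_tree K \<and> (\<exists>!x. x \<in> verts K \<and> (w, x) \<in> parcs G)))"
    (is "_ \<longleftrightarrow> ?a \<or> ?b")
proof -
  interpret rooted_graph G u v using assms by (intro rooted_graph.intro)
  have b: "?b \<longleftrightarrow> (\<exists>w. tree_cut w)" by (auto simp: tree_cut_def)
  show ?thesis
  proof
    assume np: "\<not> has_minor_using prism G u v"
    show "?a \<or> ?b"
    proof (cases "has_cycle E (V - {u, v})")
      case True
      obtain xs T where "cycle_and_rest G u v xs T" using ex_cycle_and_rest .
      then interpret no_prism G u v xs T
        using np True by (intro no_prism.intro no_prism_axioms.intro)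
      have "\<exists>n\<ge>3. graph_iso G (wheel n) \<or> graph_iso G (K3 n) \<or> graph_iso G (K3' n) \<or>
            graph_iso G (K3'' n) \<or> graph_iso G (K3''' n)"
        using wheel_or_K3 wheel_like_iso[OF graph] K3_like_iso[OF graph _ card_ge_6] by meson
      then show ?thesis by blast
    next
      case False
      then show ?thesis using acyclic_tree_cut b by blast
    qed
  next
    assume "?a \<or> ?b"
    then show "\<not> has_minor_using prism G u v"
    proof
      assume ?a
      then obtain n where n: "3 \<le> n" "graph_iso G (wheel n) \<or> graph_iso G (K3 n) \<or> graph_iso G (K3' n) \<or>
            graph_iso G (K3'' n) \<or> graph_iso G (K3''' n)" by blast
      have "\<not> two_disjoint_cycles G"
      proof
        assume c: "two_disjoint_cycles G"
        have K: "\<not> graph_iso G (K3_plus E0 n)" if "E0 \<subseteq> {0..<3} \<times> {0..<3}" for E0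
          using two_disjoint_cycles_iso[OF _ c] not_two_disjoint_cycles_K3_plus[OF that] by blast
        have "\<not> graph_iso G (wheel n)"
          using two_disjoint_cycles_iso[OF _ c] not_two_disjoint_cycles_wheel[OF n(1)] by blast
        then show False
          using n(2) K[of "{}"] K[of "{(0, 1)}"] K[of "{(0, 1), (1, 2)}"] K[of "{(0, 1), (1, 2), (0, 2)}"]
          by (simp add: K3_def K3'_def K3''_def K3'''_def)
      qed
      then show ?thesis using prism_cycles(2) by blast
    next
      assume ?b
      then show ?thesis using b tree_cut_acyclic prism_cycles(1) by blast
    qed
  qed
qed

end
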